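(* Let $h$ be the almost surely constant limit $h=\lim_{n\to\infty}\frac1nH_n$, where $H_n=-\sum_{|x|=n}\Delta_x\log\Delta_x$. Then $$h=\mathbf E\left(\sum_{i=1}^K\lambda^*\tau_i\,e^{-\lambda^*\tau_i}\right),$$ where $\tau_i$ is the birth time of the $i$-th child of the root.
   Context: Fix an integer $K\ge 2$, let $\mathbb I=\{1,\dots,K\}$, and fix a weight function $w:\{0,1,\dots,K-1\}\to(0,\infty)$. Let $\mathcal N=\bigcup_{n\ge 0}\mathbb I^n$ be the set of finite words over $\mathbb I$ ($\mathbb I^0=\{\emptyset\}$, $\emptyset$ is the root); $xi$ is the $i$-th child of $x$, $|x|$ is the length of $x$, and $xy$ denotes concatenation. A finite rooted ordered tree is a finite set $G\subset\mathcal N$ containing $\emptyset$ and such that $yi\in G$ implies $y\in G$, and $y(i-1)\in G$ if $i>1$; $\deg(x,G)$ is the number of children of $x$ in $G$. The random tree $\Upsilon(t)$, $t\ge 0$, is the right-continuous continuous-time Markov chain on finite rooted ordered trees with $\Upsilon(0)=\{\emptyset\}$ such that from $G$, for every $x\in G$ with $\deg(x,G)=j<K$, it jumps to $G\cup\{x(j+1)\}$ with rate $w(j)$. Let $\tau_x$ be the birth time of $x$ (the first time $x$ is in the tree, $\tau_\emptyset=0$), $\sigma_\emptyset=0$, $\sigma_{y1}=\tau_{y1}-\tau_y$ and $\sigma_{yi}=\tau_{yi}-\tau_{y(i-1)}$ for $i\ge 2$. Equivalently in law: the $\sigma_{yi}$ ($y\in\mathcal N$, $i\in\mathbb I$) are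 independent, $\sigma_{yi}$ is exponential with parameter (rate) $w(i-1)$, $\tau_{yi}=\tau_y+\sigma_{y1}+\dots+\sigma_{yi}$, and $\Upsilon(t)=\{x:\tau_x\le t\}$. $\lambda^*>0$ denotes the unique positive root of $\sum_{j=1}^K\prod_{i=0}^{j-1}\frac{w(i)}{\lambda+w(i)}=1$. For $x\in\mathcal N$ let $\Theta_x=\lim_{t\to\infty}e^{-\lambda^*(t-\tau_x)}|\{y:xy\in\Upsilon(t)\}|$, and $\Theta=\Theta_\emptyset$ (it is known that these limits exist almost surely, lie in $(0,\infty)$, and have finite second moment). Let $$\Delta_x=\lim_{t\to\infty}\frac{|\{y:xy\in\Upsilon(t)\}|}{|\Upsilon(t)|}=\frac{e^{-\lambda^*\tau_x}\Theta_x}{\Theta}.$$ Almost surely $\Delta_\emptyset=1$ and $\Delta_y=\sum_{i=1}^K\Delta_{yi}$. The limit $\lim_n\frac1nH_n$ exists almost surely and is an almost sure constant, denoted $h$. *)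

theory Defs
  imports "HOL-Probability.Probability"
begin

text \<open>
  Vertices are finite words over \<open>{1..K}\<close>, encoded as lists of naturals; the empty list is the
  root and \<open>x @ [i]\<close> is the \<open>i\<close>-th child of \<open>x\<close>. The random tree is driven by the waiting
  times \<open>\<sigma> (y @ [i])\<close>, the time between the birth of the \<open>(i-1)\<close>-th child of \<open>y\<close> (of \<open>y\<close> itself
  if \<open>i = 1\<close>) and the birth of its \<open>i\<close>-th child. When these are independent and exponential with
  rate \<open>w (i - 1)\<close>, the process \<open>tree\<close> below is the continuous-time Markov chain in which a vertex
  with \<open>j < K\<close> children receives its next child at rate \<open>w j\<close>.
\<close>

definition words :: "nat \<Rightarrow> nat list set" where
  "words K = lists {1..K}"

text \<open>The positive root of the characteristic equation, which is unique if \<open>K \<ge> 2\<close> and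
  \<open>w > 0\<close> on \<open>{..<K}\<close>.\<close>

definition malthus :: "nat \<Rightarrow> (nat \<Rightarrow> real) \<Rightarrow> real" where
  "malthus K w = (THE l. l > 0 \<and> (\<Sum>j=1..K. \<Prod>i<j. w i / (l + w i)) = 1)"

function birth :: "(nat list \<Rightarrow> 'a \<Rightarrow> real) \<Rightarrow> nat list \<Rightarrow> 'a \<Rightarrow> real" where
  "birth \<sigma> x \<omega> = (if x = [] then 0
     else birth \<sigma> (butlast x) \<omega> + (\<Sum>j=1..last x. \<sigma> (butlast x @ [j]) \<omega>))"
  by pat_completeness auto
termination
  by (relation "Wellfounded.measure (\<lambda>(\<sigma>, x, \<omega>). length x)") auto

declare birth.simps [simp del]

definition tree :: "nat \<Rightarrow> (nat list \<Rightarrow> 'a \<Rightarrow> real) \<Rightarrow> real \<Rightarrow> 'a \<Rightarrow> nat list set" where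
  "tree K \<sigma> t \<omega> = {x \<in> words K. birth \<sigma> x \<omega> \<le> t}"

definition subtree ::
  "nat \<Rightarrow> (nat list \<Rightarrow> 'a \<Rightarrow> real) \<Rightarrow> nat list \<Rightarrow> real \<Rightarrow> 'a \<Rightarrow> nat list set" where
  "subtree K \<sigma> x t \<omega> = {y. x @ y \<in> tree K \<sigma> t \<omega>}"

text \<open>Almost surely all trees are finite and the following limits exist and are positive; outside
  of that event the value is irrelevant.\<close>

definition Delta :: "nat \<Rightarrow> (nat list \<Rightarrow> 'a \<Rightarrow> real) \<Rightarrow> nat list \<Rightarrow> 'a \<Rightarrow> real" where
  "Delta K \<sigma> x \<omega> =
     Lim at_top (\<lambda>t. real (card (subtree K \<sigma> x t \<omega>)) / real (card (tree K \<sigma> t \<omega>)))"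

definition H :: "nat \<Rightarrow> (nat list \<Rightarrow> 'a \<Rightarrow> real) \<Rightarrow> nat \<Rightarrow> 'a \<Rightarrow> real" where
  "H K \<sigma> n \<omega> =
     - (\<Sum>x \<in> {x \<in> words K. length x = n}. Delta K \<sigma> x \<omega> * ln (Delta K \<sigma> x \<omega>))"

end

theory Submission
  imports Defs "HOL-Real_Asymp.Real_Asymp"
begin

text \<open>
  Cut at the root, the tree size \<open>N t\<close> satisfies
  \<open>N t = 1 + (\<Sum>i. N\<^sub>i (t - \<tau>\<^sub>i))\<close> with independent copies \<open>N\<^sub>i\<close> of \<open>N\<close>. The mean of
  \<open>X t = exp (- \<lambda> t) * N t\<close> therefore solves the renewal equation with the probability density
  \<open>f\<close> of the measure \<open>E (\<Sum>i. exp (- \<lambda> \<tau>\<^sub>i) \<delta>\<^bsub>\<tau>\<^sub>i\<^esub>)\<close>. As the hazard rate of \<open>f\<close> is bounded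
  below, the increments of the mean decay exponentially; the same recursion for second moments, where
  \<open>E (\<Sum>i. exp (- 2 \<lambda> \<tau>\<^sub>i)) < 1\<close>, makes the increments of \<open>X\<close> decay exponentially in mean
  square. Hence \<open>X\<close> converges almost surely along every lattice and, \<open>N\<close> being monotone, along the
  reals. The limit \<open>\<Theta>\<close> is square integrable with positive mean, satisfies
  \<open>\<Theta> = (\<Sum>i. exp (- \<lambda> \<tau>\<^sub>i) \<Theta>\<^sub>i)\<close>, and \<open>q = P(\<Theta> = 0)\<close> satisfies \<open>q = q ^ K\<close>, so that
  \<open>\<Theta> > 0\<close> almost surely and \<open>\<Delta>\<^sub>x = exp (- \<lambda> \<tau>\<^sub>x) \<Theta>\<^sub>x / \<Theta>\<close>.

  Inserting this into \<open>H\<^sub>n\<close> and taking expectations with weight \<open>\<Theta>\<close>, the terms with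
  \<open>\<Theta> ln \<Theta>\<close> cancel and \<open>E (\<Theta> H\<^sub>n) = n * h' * E \<Theta>\<close> holds exactly, \<open>h'\<close> being the claimed value.
  Since \<open>0 \<le> H\<^sub>n \<le> n ln K\<close>, dominated convergence gives \<open>h * E \<Theta> = h' * E \<Theta>\<close>.
\<close>

subsection \<open>Renewal equations with hazard rate bounded below\<close>

text \<open>\<open>Delta\<close> is defined by a \<open>Lim\<close>, which says nothing unless the
  limit exists, so existence, positivity and square integrability of \<Theta> have to be established
  before the entropy can be touched. Weighting by \<Theta> is what makes the entropy computable: the
  factor 1/\<Theta> in each \<Delta> depends on all subtrees at once, and multiplication by \<Theta>
  leaves terms in the birth time and the limit of one subtree, apart from a single \<Theta> ln
  \<Theta>. The weight is harmless because h is constant and factors out of the expectation. Square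
  integrability serves twice: for almost sure convergence and for the integrability of \<Theta> ln
  \<Theta>. The hazard bound stands in for a renewal theorem. It holds because, as long as the root
  has fewer than K children, the next birth occurs at rate at least min w. Mere convergence of the
  mean would not do: increments along a lattice must be summable, and this requires a rate.
  Positivity of the mean of \<Theta> is read off the quantity that the renewal equation conserves,
  without identifying the limit.\<close>

lemma min_exp_le:
  fixes e l t :: real
  assumes "0 \<le> e" "e \<le> l"
  shows "min 1 (exp (- l * t)) \<le> exp (- e * t)"
proof (cases "0 \<le> t")
  case True
  then have "- l * t \<le> - e * t" using assms by (simp add: mult_right_mono)
  then show ?thesis by (simp add: min.coboundedI2)
next
  case False
  then have "1 \<le> exp (- e * t)" using assms by (simp add: mult_nonneg_nonpos)
  then show ?thesis by (simp add: min.coboundedI1)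
qed

lemma nn_integral_reflect:
  fixes g :: "real \<Rightarrow> ennreal"
  assumes [measurable]: "g \<in> borel_measurable borel"
  shows "(\<integral>\<^sup>+u. g (t - u) \<partial>lborel) = (\<integral>\<^sup>+u. g u \<partial>lborel)"
  using nn_integral_real_affine[of g "-1" t] by simp

lemma nn_integral_shift:
  fixes g :: "real \<Rightarrow> ennreal"
  assumes [measurable]: "g \<in> borel_measurable borel"
  shows "(\<integral>\<^sup>+u. g (u - t) \<partial>lborel) = (\<integral>\<^sup>+u. g u \<partial>lborel)"
  using nn_integral_real_affine[of g "1" "-t"] by simp

lemma nn_integral_exp_ge_0:
  fixes l :: real
  assumes "0 < l"
  shows "(\<integral>\<^sup>+u. ennreal (exp (- l * u)) * indicator {0..} u \<partial>lborel) = ennreal (1 / l)"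
proof -
  have "(\<integral>\<^sup>+u. ennreal (exponential_density l u) \<partial>lborel) = 1"
    using prob_space.emeasure_space_1[OF prob_space_exponential_density[OF assms]]
    by (simp add: emeasure_density)
  moreover have "ennreal (exp (- l * u)) * indicator {0..} u = ennreal (1 / l) * ennreal (exponential_density l u)" for u
    using assms by (auto simp: exponential_density_def indicator_def ennreal_mult'[symmetric] mult_ac)
  ultimately show ?thesis
    by (simp add: nn_integral_cmult)
qed

text \<open>The supremum of \<open>y t * exp (e * t)\<close> over \<open>t \<le> T\<close> is finite because \<open>y\<close> is bounded, and it
  bounds itself with a contraction factor.\<close>

lemma convolution_contraction_decay:
  fixes y k :: "real \<Rightarrow> ennreal" and e C \<kappa> B :: real
  assumes [measurable]: "k \<in> borel_measurable borel"
    and k_neg: "\<And>u. u < 0 \<Longrightarrow> k u = 0"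
    and ineq: "\<And>t. y t \<le> ennreal (C * exp (- e * t)) + (\<integral>\<^sup>+u. k u * y (t - u) \<partial>lborel)"
    and bound: "\<And>t. y t \<le> ennreal B"
    and k_int: "(\<integral>\<^sup>+u. k u * ennreal (exp (e * u)) \<partial>lborel) \<le> ennreal \<kappa>"
    and \<kappa>: "0 \<le> \<kappa>" "\<kappa> < 1" and e: "0 \<le> e" and C: "0 \<le> C"
  shows "y t \<le> ennreal (C / (1 - \<kappa>) * exp (- e * t))"
proof -
  define S where "S = (SUP t'\<in>{..t}. y t' * ennreal (exp (e * t')))"
  \<comment> \<open>Cutting the supremum off at \<open>t\<close> keeps \<open>exp (e * t')\<close>
    bounded. Only for finite \<open>S\<close> can the inequality
    \<open>S \<le> C + \<kappa> * S\<close> be solved.\<close>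
  have "S \<le> ennreal (max 0 B * exp (e * t))"
    unfolding S_def
  proof (rule SUP_least)
    fix t' assume "t' \<in> {..t}"
    then have "exp (e * t') \<le> exp (e * t)" using e by (simp add: mult_left_mono)
    moreover have "y t' \<le> ennreal (max 0 B)" using bound[of t'] by (simp add: max_def split: if_splits) (use ennreal_neg in fastforce)
    ultimately have "y t' * ennreal (exp (e * t')) \<le> ennreal (max 0 B) * ennreal (exp (e * t))"
      by (intro mult_mono) (auto simp: ennreal_leI)
    then show "y t' * ennreal (exp (e * t')) \<le> ennreal (max 0 B * exp (e * t))"
      by (simp add: ennreal_mult')
  qed
  then have S_fin: "S < \<top>" using ennreal_less_top le_less_trans by blast
  have up: "y t' * ennreal (exp (e * t')) \<le> ennreal C + ennreal \<kappa> * S" if t': "t' \<le> t" for t'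
  proof -
    \<comment> \<open>As \<open>k\<close> vanishes on negative arguments, the convolution only looks
      at times \<open>t' - u \<le> t\<close>, which the supremum covers.\<close>
    have yS: "y (t' - u) \<le> S * ennreal (exp (- e * (t' - u)))" if "0 \<le> u" for u
    proof -
      have "y (t' - u) * ennreal (exp (e * (t' - u))) \<le> S"
        unfolding S_def using that t' by (intro SUP_upper) auto
      then have "y (t' - u) * ennreal (exp (e * (t' - u))) * ennreal (exp (- e * (t' - u))) \<le> S * ennreal (exp (- e * (t' - u)))"
        by (rule mult_right_mono) simp
      then show ?thesis by (simp add: mult.assoc ennreal_mult'[symmetric] exp_add[symmetric])
    qed
    have "(\<integral>\<^sup>+u. k u * y (t' - u) \<partial>lborel) \<le> (\<integral>\<^sup>+u. (S * ennreal (exp (- e * t'))) * (k u * ennreal (exp (e * u))) \<partial>lborel)"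
    proof (rule nn_integral_mono)
      fix u
      show "k u * y (t' - u) \<le> (S * ennreal (exp (- e * t'))) * (k u * ennreal (exp (e * u)))"
      proof (cases "u < 0")
        case False
        then have "k u * y (t' - u) \<le> k u * (S * ennreal (exp (- e * (t' - u))))"
          by (intro mult_left_mono yS) auto
        also have "ennreal (exp (- e * (t' - u))) = ennreal (exp (- e * t')) * ennreal (exp (e * u))"
          by (simp add: ennreal_mult'[symmetric] exp_add[symmetric] algebra_simps)
        finally show ?thesis by (simp add: mult_ac)
      qed (simp add: k_neg)
    qed
    also have "\<dots> = (S * ennreal (exp (- e * t'))) * (\<integral>\<^sup>+u. k u * ennreal (exp (e * u)) \<partial>lborel)"
      by (subst nn_integral_cmult) auto
    also have "\<dots> \<le> (S * ennreal (exp (- e * t'))) * ennreal \<kappa>"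
      by (intro mult_left_mono k_int) auto
    finally have "y t' \<le> ennreal (C * exp (- e * t')) + (S * ennreal (exp (- e * t'))) * ennreal \<kappa>"
      using ineq[of t'] by (meson add_left_mono order_trans)
    also have "\<dots> = (ennreal C + ennreal \<kappa> * S) * ennreal (exp (- e * t'))"
      using C by (simp add: ennreal_mult' algebra_simps)
    finally have "y t' * ennreal (exp (e * t')) \<le> (ennreal C + ennreal \<kappa> * S) * ennreal (exp (- e * t')) * ennreal (exp (e * t'))"
      by (rule mult_right_mono) simp
    then show ?thesis by (simp add: mult.assoc ennreal_mult'[symmetric] exp_add[symmetric])
  qed
  have "S \<le> ennreal C + ennreal \<kappa> * S"
    unfolding S_def[of] by (rule SUP_least) (use up in \<open>auto simp: S_def\<close>)
  moreover obtain s where s: "S = ennreal s" "0 \<le> s" using S_fin by (cases S) auto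
  ultimately have "s \<le> C + \<kappa> * s"
    using C \<kappa> by (simp add: ennreal_mult'[symmetric] ennreal_plus[symmetric] del: ennreal_plus)
  then have s_le: "s \<le> C / (1 - \<kappa>)" using \<kappa> by (simp add: field_simps)
  have "y t * ennreal (exp (e * t)) \<le> S" unfolding S_def by (rule SUP_upper) simp
  also have "S \<le> ennreal (C / (1 - \<kappa>))" using s s_le by (simp add: ennreal_leI)
  finally have "y t * ennreal (exp (e * t)) * ennreal (exp (- e * t)) \<le> ennreal (C / (1 - \<kappa>)) * ennreal (exp (- e * t))"
    by (rule mult_right_mono) simp
  then show ?thesis using C \<kappa> by (simp add: mult.assoc ennreal_mult'[symmetric] exp_add[symmetric])
qed

text \<open>The renewal equation conserves the convolution with the tail, so that subtracting \<open>\<theta>\<close> times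
  this convolution turns the kernel \<open>f\<close> into the kernel \<open>f - \<theta> * tail\<close> of mass less than one.\<close>

locale renewal_density =
  fixes f :: "real \<Rightarrow> real" and l \<theta> C :: real
  assumes f_meas[measurable]: "f \<in> borel_measurable borel"
    and f_nonneg: "\<And>u. 0 \<le> f u" and f_neg: "\<And>u. u < 0 \<Longrightarrow> f u = 0"
    and f_total: "(\<integral>\<^sup>+u. ennreal (f u) \<partial>lborel) = 1"
    and l_pos: "0 < l" and \<theta>_pos: "0 < \<theta>"
    and f_le_exp: "\<And>u. 0 \<le> u \<Longrightarrow> f u \<le> C * exp (- l * u)"
    and hazard: "\<And>u. 0 \<le> u \<Longrightarrow>
       ennreal \<theta> * (\<integral>\<^sup>+v. ennreal (f v) * indicator {0<..} (v - u) \<partial>lborel) \<le> ennreal (f u)"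
begin

section \<open>The tail kernel and the quantity conserved by the renewal equation\<close>

definition tail :: "real \<Rightarrow> ennreal" where
  "tail u = (\<integral>\<^sup>+v. ennreal (f v) * indicator {0<..} (v - u) \<partial>lborel) * indicator {0..} u"

definition ker :: "real \<Rightarrow> ennreal" where
  "ker u = ennreal (f u) - ennreal \<theta> * tail u"

definition \<kappa> :: real where "\<kappa> = enn2real (\<integral>\<^sup>+u. ker u \<partial>lborel)"

definition src :: "real \<Rightarrow> ennreal" where
  "src t = ennreal (exp (- l * t)) * indicator {0..} t"

definition isrc :: "real \<Rightarrow> ennreal" where
  "isrc t = (\<integral>\<^sup>+v. src v * indicator {0..} (t - v) \<partial>lborel)"

lemma tail_meas[measurable]: "tail \<in> borel_measurable borel"
  unfolding tail_def[abs_def] by measurable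

lemma ker_meas[measurable]: "ker \<in> borel_measurable borel"
  unfolding ker_def[abs_def] by measurable

lemma src_meas[measurable]: "src \<in> borel_measurable borel"
  unfolding src_def[abs_def] by measurable

lemma tail_split: "tail u + (\<integral>\<^sup>+v. ennreal (f v) * indicator {0..} (u - v) \<partial>lborel) = indicator {0..} u"
proof (cases "0 \<le> u")
  case True
  have "tail u + (\<integral>\<^sup>+v. ennreal (f v) * indicator {0..} (u - v) \<partial>lborel)
      = (\<integral>\<^sup>+v. ennreal (f v) * indicator {0<..} (v - u) + ennreal (f v) * indicator {0..} (u - v) \<partial>lborel)"
    using True by (subst nn_integral_add) (auto simp: tail_def)
  also have "\<dots> = (\<integral>\<^sup>+v. ennreal (f v) \<partial>lborel)"
    by (intro nn_integral_cong) (auto simp: indicator_def)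
  finally show ?thesis using True f_total by simp
next
  case False
  have "(\<integral>\<^sup>+v. ennreal (f v) * indicator {0..} (u - v) \<partial>lborel) = (\<integral>\<^sup>+(v::real). 0 \<partial>lborel)"
    by (rule nn_integral_cong) (use False in \<open>auto simp: indicator_def f_neg\<close>)
  then show ?thesis using False by (simp add: tail_def)
qed

lemma tail_le_1: "tail u \<le> 1"
proof -
  have "tail u \<le> tail u + (\<integral>\<^sup>+v. ennreal (f v) * indicator {0..} (u - v) \<partial>lborel)" by simp
  also have "\<dots> \<le> 1" unfolding tail_split by (simp add: indicator_def)
  finally show ?thesis .
qed

lemma hazard_tail: "ennreal \<theta> * tail u \<le> ennreal (f u)"
  using hazard[of u] by (cases "0 \<le> u") (auto simp: tail_def)

lemma ker_split: "ker u + ennreal \<theta> * tail u = ennreal (f u)"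
  unfolding ker_def using hazard_tail[of u] by (simp add: diff_add_cancel_ennreal)

lemma ker_le: "ker u \<le> ennreal (f u)"
  unfolding ker_def by (simp add: diff_le_self_ennreal)

text \<open>Cumulating the convolution with \<open>f\<close> up to \<open>t\<close> convolves
  \<open>m\<close> with the distribution function of \<open>f\<close>, and by
  \<open>tail_split\<close> this function and \<open>tail\<close> add up to the indicator of the
  half-line. The identity is stated as a sum to avoid subtraction in \<open>ennreal\<close>.\<close>

lemma conv_tail:
  fixes m :: "real \<Rightarrow> ennreal"
  assumes [measurable]: "m \<in> borel_measurable borel"
  shows "(\<integral>\<^sup>+u. tail u * m (t - u) \<partial>lborel)
      + (\<integral>\<^sup>+v. (\<integral>\<^sup>+u. ennreal (f u) * m (v - u) \<partial>lborel) * indicator {0..} (t - v) \<partial>lborel)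
      = (\<integral>\<^sup>+v. m v * indicator {0..} (t - v) \<partial>lborel)"
proof -
  have "(\<integral>\<^sup>+v. (\<integral>\<^sup>+u. ennreal (f u) * m (v - u) \<partial>lborel) * indicator {0..} (t - v) \<partial>lborel)
      = (\<integral>\<^sup>+v. (\<integral>\<^sup>+u. ennreal (f u) * m (v - u) * indicator {0..} (t - v) \<partial>lborel) \<partial>lborel)"
    by (intro nn_integral_cong, subst nn_integral_multc) auto
  also have "\<dots> = (\<integral>\<^sup>+u. (\<integral>\<^sup>+v. ennreal (f u) * m (v - u) * indicator {0..} (t - v) \<partial>lborel) \<partial>lborel)"
    by (rule lborel_pair.Fubini') measurable
  also have "\<dots> = (\<integral>\<^sup>+u. (\<integral>\<^sup>+z. ennreal (f u) * m z * indicator {0..} (t - u - z) \<partial>lborel) \<partial>lborel)"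
  proof (rule nn_integral_cong)
    fix u
    have "(\<integral>\<^sup>+z. ennreal (f u) * m z * indicator {0..} (t - u - z) \<partial>lborel)
       = (\<integral>\<^sup>+v. ennreal (f u) * m (v - u) * indicator {0..} (t - u - (v - u)) \<partial>lborel)"
      by (rule nn_integral_shift[symmetric]) measurable
    then show "(\<integral>\<^sup>+v. ennreal (f u) * m (v - u) * indicator {0..} (t - v) \<partial>lborel)
       = (\<integral>\<^sup>+z. ennreal (f u) * m z * indicator {0..} (t - u - z) \<partial>lborel)" by simp
  qed
  also have "\<dots> = (\<integral>\<^sup>+z. (\<integral>\<^sup>+u. ennreal (f u) * m z * indicator {0..} (t - u - z) \<partial>lborel) \<partial>lborel)"
    by (rule lborel_pair.Fubini') measurable
  also have "\<dots> = (\<integral>\<^sup>+z. m z * (\<integral>\<^sup>+u. ennreal (f u) * indicator {0..} (t - z - u) \<partial>lborel) \<partial>lborel)"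
    by (intro nn_integral_cong, subst nn_integral_cmult[symmetric]) (auto simp: mult_ac algebra_simps)
  finally have 2: "(\<integral>\<^sup>+v. (\<integral>\<^sup>+u. ennreal (f u) * m (v - u) \<partial>lborel) * indicator {0..} (t - v) \<partial>lborel)
     = (\<integral>\<^sup>+z. m z * (\<integral>\<^sup>+u. ennreal (f u) * indicator {0..} (t - z - u) \<partial>lborel) \<partial>lborel)" .
  have "(\<integral>\<^sup>+z. tail (t - (t - z)) * m (t - z) \<partial>lborel) = (\<integral>\<^sup>+z. tail (t - z) * m z \<partial>lborel)"
    by (rule nn_integral_reflect) measurable
  then have 1: "(\<integral>\<^sup>+u. tail u * m (t - u) \<partial>lborel) = (\<integral>\<^sup>+z. tail (t - z) * m z \<partial>lborel)" by simp
  have "(\<integral>\<^sup>+z. tail (t - z) * m z \<partial>lborel)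
      + (\<integral>\<^sup>+z. m z * (\<integral>\<^sup>+u. ennreal (f u) * indicator {0..} (t - z - u) \<partial>lborel) \<partial>lborel)
    = (\<integral>\<^sup>+z. m z * (tail (t - z) + (\<integral>\<^sup>+u. ennreal (f u) * indicator {0..} (t - z - u) \<partial>lborel)) \<partial>lborel)"
    by (subst nn_integral_add[symmetric]) (auto simp: algebra_simps)
  then show ?thesis unfolding 1 2 tail_split .
qed

section \<open>The mass of the reduced kernel\<close>

lemma C_pos: "0 < C"
proof (rule ccontr)
  assume "\<not> 0 < C"
  then have "f u \<le> 0" for u
    using f_le_exp[of u] f_neg[of u] by (smt (verit) exp_gt_zero mult_le_0_iff)
  then have "(\<integral>\<^sup>+u. ennreal (f u) \<partial>lborel) = (\<integral>\<^sup>+(u::real). 0 \<partial>lborel)"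
    by (intro nn_integral_cong) (simp add: ennreal_neg)
  then show False using f_total by simp
qed

lemma ker_tail_total: "(\<integral>\<^sup>+u. ker u \<partial>lborel) + ennreal \<theta> * (\<integral>\<^sup>+u. tail u \<partial>lborel) = 1"
proof -
  have "(\<integral>\<^sup>+u. ker u \<partial>lborel) + ennreal \<theta> * (\<integral>\<^sup>+u. tail u \<partial>lborel)
      = (\<integral>\<^sup>+u. ker u + ennreal \<theta> * tail u \<partial>lborel)"
    by (simp add: nn_integral_add nn_integral_cmult)
  then show ?thesis by (simp add: ker_split f_total)
qed

lemma tail_integral_finite: "(\<integral>\<^sup>+u. tail u \<partial>lborel) < \<top>"
proof (rule ccontr)
  assume "\<not> ?thesis"
  then have "(\<integral>\<^sup>+u. tail u \<partial>lborel) = \<top>" using less_top by blast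
  then show False using ker_tail_total \<theta>_pos by (simp add: ennreal_mult_top)
qed

text \<open>The density is at most \<open>C\<close>, so at most half of its mass lies in
  \<open>{0..u}\<close>. Hence subtracting \<open>\<theta> * tail\<close> removes a positive mass
  from \<open>f\<close>.\<close>

lemma tail_ge_half:
  assumes "0 \<le> u" "u \<le> 1 / (2 * C)"
  shows "ennreal (1/2) \<le> tail u"
proof -
  have "(\<integral>\<^sup>+v. ennreal (f v) * indicator {0..} (u - v) \<partial>lborel) \<le> (\<integral>\<^sup>+v. ennreal C * indicator {0..u} v \<partial>lborel)"
  proof (rule nn_integral_mono)
    fix v
    have "f v \<le> C" if "0 \<le> v"
    proof -
      have "C * exp (- l * v) \<le> C * 1" using that l_pos C_pos by (intro mult_left_mono) auto
      then show ?thesis using f_le_exp[OF that] by simp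
    qed
    then show "ennreal (f v) * indicator {0..} (u - v) \<le> ennreal C * indicator {0..u} v"
      by (cases "0 \<le> v") (auto simp: indicator_def f_neg ennreal_leI)
  qed
  also have "\<dots> = ennreal C * ennreal u" using assms by (simp add: nn_integral_cmult)
  also have "\<dots> = ennreal (C * u)" using C_pos by (simp add: ennreal_mult')
  also have "\<dots> \<le> ennreal (1/2)" using assms C_pos by (intro ennreal_leI) (simp add: field_simps)
  finally have "indicator {0..} u \<le> tail u + ennreal (1/2)"
    unfolding tail_split[of u, symmetric] by (rule add_left_mono)
  then have le: "1 \<le> tail u + ennreal (1/2)" using assms by simp
  show ?thesis
  proof (rule ccontr)
    assume "\<not> ?thesis"
    then have "tail u < ennreal (1/2)" by simp
    then obtain r where r: "tail u = ennreal r" "0 \<le> r" by (cases "tail u") auto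
    with \<open>tail u < ennreal (1/2)\<close> have "r < 1/2" by (simp only: ennreal_less_iff)
    note r = r this
    then have "tail u + ennreal (1/2) = ennreal (r + 1/2)" by (subst ennreal_plus) auto
    also have "\<dots> < ennreal 1" using r by (subst ennreal_less_iff) auto
    finally show False using le by simp
  qed
qed

lemma ker_total_less_1: "(\<integral>\<^sup>+u. ker u \<partial>lborel) < 1"
proof (rule ccontr)
  assume "\<not> ?thesis"
  then have "1 \<le> (\<integral>\<^sup>+u. ker u \<partial>lborel)" by simp
  define I where "I = (\<integral>\<^sup>+u. tail u \<partial>lborel)"
  define J where "J = (\<integral>\<^sup>+u. ker u \<partial>lborel)"
  have eq: "J + ennreal \<theta> * I = 1" using ker_tail_total by (simp add: I_def J_def)
  have "1 \<le> J" using \<open>1 \<le> (\<integral>\<^sup>+u. ker u \<partial>lborel)\<close> by (simp add: J_def)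
  then have "1 + ennreal \<theta> * I \<le> 1" using eq by (metis add_right_mono)
  then have "ennreal \<theta> * I = 0"
    using ennreal_add_left_cancel_le[of 1 "ennreal \<theta> * I" 0] by simp
  then have "I = 0" using \<theta>_pos by simp
  have "(\<integral>\<^sup>+u. ennreal (1/2) * indicator {0..1 / (2 * C)} u \<partial>lborel) \<le> I"
    unfolding I_def by (rule nn_integral_mono) (use tail_ge_half in \<open>auto simp: indicator_def\<close>)
  moreover have "(\<integral>\<^sup>+u. ennreal (1/2) * indicator {0..1 / (2 * C)} u \<partial>lborel) = ennreal (1/2) * ennreal (1 / (2 * C))"
    using C_pos by (subst nn_integral_cmult) auto
  ultimately show False using \<open>I = 0\<close> C_pos by simp
qed

lemma \<kappa>: "(\<integral>\<^sup>+u. ker u \<partial>lborel) = ennreal \<kappa>" "0 \<le> \<kappa>" "\<kappa> < 1"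
proof -
  show 1: "(\<integral>\<^sup>+u. ker u \<partial>lborel) = ennreal \<kappa>"
    unfolding \<kappa>_def using ker_total_less_1 by (metis ennreal_enn2real ennreal_one_less_top order_less_trans)
  show "0 \<le> \<kappa>" by (simp add: \<kappa>_def)
  then show "\<kappa> < 1" using ker_total_less_1 unfolding 1 by (simp add: ennreal_less_iff)
qed

section \<open>The source term and the iterates of the renewal equation\<close>

lemma src_total: "(\<integral>\<^sup>+u. src u \<partial>lborel) = ennreal (1 / l)"
  unfolding src_def by (rule nn_integral_exp_ge_0[OF l_pos])

lemma isrc_mono: "t \<le> t' \<Longrightarrow> isrc t \<le> isrc t'"
  unfolding isrc_def by (rule nn_integral_mono) (auto simp: indicator_def)

lemma isrc_le: "isrc t \<le> ennreal (1 / l)"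
  unfolding src_total[symmetric] isrc_def by (rule nn_integral_mono) (auto simp: indicator_def)

text \<open>The part of \<open>src\<close> beyond \<open>t\<close> has mass
  \<open>exp (- l * t) / l\<close> for \<open>t \<ge> 0\<close> and the full mass
  \<open>1 / l\<close> for negative \<open>t\<close>, whence the minimum.\<close>

lemma isrc_ge: "ennreal (1 / l) \<le> isrc t + ennreal (min 1 (exp (- l * t)) / l)"
proof -
  have "(\<integral>\<^sup>+u. src u \<partial>lborel) \<le> (\<integral>\<^sup>+u. src u * indicator {0..} (t - u) + src u * indicator {0..} (u - t) \<partial>lborel)"
    by (rule nn_integral_mono) (auto simp: indicator_def)
  also have "\<dots> = isrc t + (\<integral>\<^sup>+u. src u * indicator {0..} (u - t) \<partial>lborel)"
    unfolding isrc_def by (rule nn_integral_add) measurable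
  also have "(\<integral>\<^sup>+u. src u * indicator {0..} (u - t) \<partial>lborel) \<le> ennreal (min 1 (exp (- l * t)) / l)"
  proof -
    have "(\<integral>\<^sup>+u. src u * indicator {0..} (u - t) \<partial>lborel) \<le> (\<integral>\<^sup>+u. src u \<partial>lborel)"
      by (rule nn_integral_mono) (auto simp: indicator_def)
    then have 1: "(\<integral>\<^sup>+u. src u * indicator {0..} (u - t) \<partial>lborel) \<le> ennreal (1 / l)" unfolding src_total .
    have "(\<integral>\<^sup>+u. src u * indicator {0..} (u - t) \<partial>lborel) = (\<integral>\<^sup>+z. src (z + t) * indicator {0..} z \<partial>lborel)"
      using nn_integral_shift[of "\<lambda>z. src (z + t) * indicator {0..} z" t] by simp
    also have "\<dots> \<le> (\<integral>\<^sup>+z. ennreal (exp (- l * t)) * (ennreal (exp (- l * z)) * indicator {0..} z) \<partial>lborel)"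
      by (rule nn_integral_mono)
        (auto simp: src_def indicator_def ennreal_mult'[symmetric] exp_add[symmetric] algebra_simps)
    also have "\<dots> = ennreal (exp (- l * t)) * ennreal (1 / l)"
      by (subst nn_integral_cmult) (auto simp: nn_integral_exp_ge_0[OF l_pos, simplified])
    also have "\<dots> = ennreal (exp (- l * t) / l)" by (simp add: ennreal_mult'[symmetric])
    finally show ?thesis using 1 by (simp add: min_def)
  qed
  finally show ?thesis unfolding src_total by (simp add: add_left_mono)
qed

lemma cum_finite:
  assumes [measurable]: "m \<in> borel_measurable borel"
    and "\<And>t. t < 0 \<Longrightarrow> m t = 0" and "\<And>t. m t \<le> ennreal B"
  shows "(\<integral>\<^sup>+v. m v * indicator {0..} (t - v :: real) \<partial>lborel) < \<top>"
proof -
  have "(\<integral>\<^sup>+v. m v * indicator {0..} (t - v) \<partial>lborel) \<le> (\<integral>\<^sup>+v. ennreal B * indicator {0..max 0 t} v \<partial>lborel)"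
  proof (rule nn_integral_mono)
    fix v show "m v * indicator {0..} (t - v) \<le> ennreal B * indicator {0..max 0 t} v"
      using assms(2)[of v] assms(3)[of v] by (cases "v < 0") (auto simp: indicator_def max_def)
  qed
  also have "\<dots> = ennreal B * ennreal (max 0 t)" by (subst nn_integral_cmult) auto
  also have "\<dots> < \<top>" by (simp add: ennreal_mult_less_top)
  finally show ?thesis .
qed

lemma cum_renewal:
  fixes m :: "real \<Rightarrow> ennreal"
  assumes [measurable]: "m \<in> borel_measurable borel"
  shows "(\<integral>\<^sup>+v. (src v + (\<integral>\<^sup>+u. ennreal (f u) * m (v - u) \<partial>lborel)) * indicator {0..} (t - v) \<partial>lborel)
    = isrc t + (\<integral>\<^sup>+v. (\<integral>\<^sup>+u. ennreal (f u) * m (v - u) \<partial>lborel) * indicator {0..} (t - v) \<partial>lborel)"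
  unfolding isrc_def by (subst nn_integral_add[symmetric]) (auto simp: distrib_right)

text \<open>After cumulating the equation, the convolution with \<open>f\<close> occurs on both
  sides by \<open>conv_tail\<close>; cancelling it leaves the cumulated source. Cancellation in
  \<open>ennreal\<close> needs a finite term, which is where boundedness and vanishing on the
  negative axis enter. The inequality serves the iterates, the equation the solution.\<close>

lemma tail_conv_le:
  fixes m m' :: "real \<Rightarrow> ennreal"
  assumes [measurable]: "m \<in> borel_measurable borel"
    and neg: "\<And>t. t < 0 \<Longrightarrow> m t = 0" and bd: "\<And>t. m t \<le> ennreal B"
    and m': "\<And>t. m' t = src t + (\<integral>\<^sup>+u. ennreal (f u) * m (t - u) \<partial>lborel)"
  shows "(\<And>t. m t \<le> m' t) \<Longrightarrow> (\<integral>\<^sup>+u. tail u * m (t - u) \<partial>lborel) \<le> isrc t"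
    and "(\<And>t. m t = m' t) \<Longrightarrow> (\<integral>\<^sup>+u. tail u * m (t - u) \<partial>lborel) = isrc t"
proof -
  define D where "D = (\<integral>\<^sup>+v. (\<integral>\<^sup>+u. ennreal (f u) * m (v - u) \<partial>lborel) * indicator {0..} (t - v) \<partial>lborel)"
  have D: "(\<integral>\<^sup>+u. tail u * m (t - u) \<partial>lborel) + D = (\<integral>\<^sup>+v. m v * indicator {0..} (t - v) \<partial>lborel)"
    unfolding D_def by (rule conv_tail) measurable
  have Dfin: "D < \<top>" using cum_finite[OF assms(1) neg bd, of t] unfolding D[symmetric] by simp
  have E: "(\<integral>\<^sup>+v. m' v * indicator {0..} (t - v) \<partial>lborel) = isrc t + D"
    unfolding m' D_def by (rule cum_renewal) measurable
  show "(\<integral>\<^sup>+u. tail u * m (t - u) \<partial>lborel) \<le> isrc t" if "\<And>t. m t \<le> m' t"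
  proof -
    have "(\<integral>\<^sup>+u. tail u * m (t - u) \<partial>lborel) + D \<le> isrc t + D"
      unfolding D E[symmetric] using that by (intro nn_integral_mono mult_right_mono) auto
    then show ?thesis using Dfin ennreal_add_left_cancel_le[of D] by (auto simp: add.commute)
  qed
  show "(\<integral>\<^sup>+u. tail u * m (t - u) \<partial>lborel) = isrc t" if "\<And>t. m t = m' t"
  proof -
    have "(\<integral>\<^sup>+u. tail u * m (t - u) \<partial>lborel) + D = isrc t + D"
      unfolding D E[symmetric] using that by simp
    then show ?thesis using Dfin ennreal_add_left_cancel[of D] by (auto simp: add.commute)
  qed
qed

lemma conv_ker_split:
  fixes m :: "real \<Rightarrow> ennreal"
  assumes [measurable]: "m \<in> borel_measurable borel"
  shows "(\<integral>\<^sup>+u. ennreal (f u) * m (t - u) \<partial>lborel)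
    = (\<integral>\<^sup>+u. ker u * m (t - u) \<partial>lborel) + ennreal \<theta> * (\<integral>\<^sup>+u. tail u * m (t - u) \<partial>lborel)"
  by (simp add: nn_integral_add[symmetric] nn_integral_cmult[symmetric] ker_split[symmetric]
      distrib_right mult.assoc del: nn_integral_add nn_integral_cmult)

text \<open>Increasing iterates are subsolutions, so their convolution with \<open>tail\<close> is
  at most \<open>1 / l\<close>, while the remaining kernel \<open>ker\<close> contracts. The bound
  is the fixed point of \<open>B = 1 + \<theta> / l + \<kappa> * B\<close> and therefore survives
  the induction.\<close>

lemma renewal_iterates_bounded:
  fixes m :: "nat \<Rightarrow> real \<Rightarrow> ennreal"
  assumes meas: "\<And>n. m n \<in> borel_measurable borel"
    and neg: "\<And>n t. t < 0 \<Longrightarrow> m n t = 0"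
    and m_0: "\<And>t. m 0 t = src t"
    and m_Suc: "\<And>n t. m (Suc n) t = src t + (\<integral>\<^sup>+u. ennreal (f u) * m n (t - u) \<partial>lborel)"
    and mono: "\<And>n t. m n t \<le> m (Suc n) t"
  shows "m n t \<le> ennreal ((1 + \<theta> / l) / (1 - \<kappa>))"
proof (induction n arbitrary: t)
  have src1: "src t \<le> 1" for t using l_pos by (auto simp: src_def indicator_def)
  define B where "B = (1 + \<theta> / l) / (1 - \<kappa>)"
  have "(1 - \<kappa>) * B = 1 + \<theta> / l" using \<kappa> by (simp add: B_def)
  then have B: "1 + \<theta> / l + \<kappa> * B = B" by (simp add: algebra_simps)
  have B0: "0 \<le> B" using \<kappa> \<theta>_pos l_pos by (simp add: B_def)
  {
    case 0
    have "1 \<le> B" using B \<kappa> B0 \<theta>_pos l_pos by (smt (verit) divide_pos_pos mult_nonneg_nonneg)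
    then show ?case unfolding m_0 B_def[symmetric] using src1[of t] by (metis ennreal_1 ennreal_leI order_trans)
  next
    case (Suc n)
    note meas[measurable]
    have "m (Suc n) t = src t + ((\<integral>\<^sup>+u. ker u * m n (t - u) \<partial>lborel) + ennreal \<theta> * (\<integral>\<^sup>+u. tail u * m n (t - u) \<partial>lborel))"
      unfolding m_Suc by (subst conv_ker_split) auto
    also have "\<dots> \<le> 1 + ((\<integral>\<^sup>+u. ker u * ennreal B \<partial>lborel) + ennreal \<theta> * ennreal (1 / l))"
    proof (intro add_mono mult_left_mono nn_integral_mono)
      show "(\<integral>\<^sup>+u. tail u * m n (t - u) \<partial>lborel) \<le> ennreal (1 / l)"
        by (rule order_trans[OF tail_conv_le(1)[OF meas neg Suc m_Suc mono] isrc_le])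
    qed (use src1 Suc in \<open>auto simp: B_def\<close>)
    also have "(\<integral>\<^sup>+u. ker u * ennreal B \<partial>lborel) = ennreal \<kappa> * ennreal B"
      by (subst nn_integral_multc) (auto simp: \<kappa>)
    also have "1 + (ennreal \<kappa> * ennreal B + ennreal \<theta> * ennreal (1 / l)) = ennreal (1 + \<theta> / l + \<kappa> * B)"
      using \<kappa> \<theta>_pos l_pos B0 by (simp add: ennreal_mult'[symmetric] ennreal_plus[symmetric] ennreal_1[symmetric] del: ennreal_plus ennreal_1)
    finally show ?case unfolding B by (simp add: B_def)
  }
qed

text \<open>Convexity of the exponential function interpolates between the exponent
  \<open>0\<close>, where the integral is \<open>\<kappa>\<close>, and the exponent
  \<open>l / 2\<close>, where it is at most \<open>2 * C / l\<close>. The cap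
  \<open>e \<le> l / 4\<close> keeps \<open>2 * e\<close> below \<open>l\<close>, as the second
  moments will require.\<close>

lemma ker_exponential_moment:
  obtains e \<kappa>' where "0 < e" "e \<le> l / 4" "0 \<le> \<kappa>'" "\<kappa>' < 1"
    "(\<integral>\<^sup>+u. ker u * ennreal (exp (e * u)) \<partial>lborel) \<le> ennreal \<kappa>'"
proof -
  define D where "D = 2 * C / l"
  have D: "0 < D" using C_pos l_pos by (simp add: D_def)
  have "(\<integral>\<^sup>+u. ker u * ennreal (exp (l / 2 * u)) \<partial>lborel)
      \<le> (\<integral>\<^sup>+u. ennreal C * (ennreal (exp (- (l / 2) * u)) * indicator {0..} u) \<partial>lborel)"
  proof (rule nn_integral_mono)
    fix u :: real
    show "ker u * ennreal (exp (l / 2 * u)) \<le> ennreal C * (ennreal (exp (- (l / 2) * u)) * indicator {0..} u)"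
    proof (cases "0 \<le> u")
      case True
      have "ker u * ennreal (exp (l / 2 * u)) \<le> ennreal (C * exp (- l * u)) * ennreal (exp (l / 2 * u))"
        by (intro mult_right_mono order_trans[OF ker_le] ennreal_leI f_le_exp True) simp
      also have "\<dots> = ennreal C * ennreal (exp (- (l / 2) * u))"
        using C_pos by (simp add: ennreal_mult'[symmetric] mult.assoc exp_add[symmetric])
      finally show ?thesis using True by simp
    qed (use ker_le[of u] in \<open>simp add: f_neg\<close>)
  qed
  also have "\<dots> = ennreal C * ennreal (1 / (l / 2))"
    using l_pos by (subst nn_integral_cmult) (auto simp: nn_integral_exp_ge_0[of "l/2", simplified])
  also have "\<dots> = ennreal D" using C_pos by (simp add: D_def ennreal_mult'[symmetric] mult.commute)
  finally have half: "(\<integral>\<^sup>+u. ker u * ennreal (exp (l / 2 * u)) \<partial>lborel) \<le> ennreal D" .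
  \<comment> \<open>With this \<open>s\<close> the new mass \<open>\<kappa> + s * D\<close> is at
    most halfway between \<open>\<kappa>\<close> and \<open>1\<close>, and
    \<open>s \<le> 1/2\<close> yields the cap on \<open>e = s * (l / 2)\<close>.\<close>
  define s where "s = min (1/2) ((1 - \<kappa>) / (2 * D))"
  have s: "0 < s" "s \<le> 1/2" using \<kappa> D by (auto simp: s_def)
  have sD: "s * D \<le> (1 - \<kappa>) / 2"
    using D mult_right_mono[of s "(1 - \<kappa>) / (2 * D)" D] by (simp add: s_def)
  have "(\<integral>\<^sup>+u. ker u * ennreal (exp (s * (l / 2) * u)) \<partial>lborel)
      \<le> (\<integral>\<^sup>+u. ker u + ennreal s * (ker u * ennreal (exp (l / 2 * u))) \<partial>lborel)"
  proof (rule nn_integral_mono)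
    fix u :: real
    have "exp ((1 - s) * 0 + s * (l / 2 * u)) \<le> (1 - s) * exp 0 + s * exp (l / 2 * u)"
      using convex_onD[OF exp_convex, of s 0 "l / 2 * u"] s by simp
    then have "exp (s * (l / 2) * u) \<le> 1 + s * exp (l / 2 * u)" using s by (simp add: mult.assoc)
    then have "ker u * ennreal (exp (s * (l / 2) * u)) \<le> ker u * ennreal (1 + s * exp (l / 2 * u))"
      by (intro mult_left_mono ennreal_leI) auto
    also have "\<dots> = ker u + ennreal s * (ker u * ennreal (exp (l / 2 * u)))"
      using s by (simp add: ennreal_plus ennreal_mult' distrib_left mult_ac)
    finally show "ker u * ennreal (exp (s * (l / 2) * u)) \<le> \<dots>" .
  qed
  also have "\<dots> = ennreal \<kappa> + ennreal s * (\<integral>\<^sup>+u. ker u * ennreal (exp (l / 2 * u)) \<partial>lborel)"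
    by (subst nn_integral_add) (auto simp: \<kappa> nn_integral_cmult)
  also have "\<dots> \<le> ennreal \<kappa> + ennreal s * ennreal D"
    by (intro add_left_mono mult_left_mono half) simp
  also have "\<dots> = ennreal (\<kappa> + s * D)"
    using \<kappa> s D by (simp add: ennreal_mult'[symmetric] ennreal_plus[symmetric] del: ennreal_plus)
  finally have "(\<integral>\<^sup>+u. ker u * ennreal (exp (s * (l / 2) * u)) \<partial>lborel) \<le> ennreal (\<kappa> + s * D)" .
  moreover have "0 < s * (l / 2)" using s l_pos by simp
  moreover have "s * (l / 2) \<le> l / 4" using s l_pos mult_right_mono[of s "1/2" "l/2"] by simp
  moreover have "0 \<le> \<kappa> + s * D" "\<kappa> + s * D < 1" using \<kappa> s D sD by auto
  ultimately show thesis using that by blast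
qed

end

section \<open>Bounded solutions: decay of the increments and positivity of the limit\<close>

locale renewal_solution = renewal_density +
  fixes m :: "real \<Rightarrow> real" and B :: real
  assumes m_meas[measurable]: "m \<in> borel_measurable borel"
    and m_nonneg: "\<And>t. 0 \<le> m t" and m_neg: "\<And>t. t < 0 \<Longrightarrow> m t = 0" and m_le: "\<And>t. m t \<le> B"
    and renewal: "\<And>t. ennreal (m t) = src t + (\<integral>\<^sup>+u. ennreal (f u) * ennreal (m (t - u)) \<partial>lborel)"
begin

lemma tail_conv: "(\<integral>\<^sup>+u. tail u * ennreal (m (t - u)) \<partial>lborel) = isrc t"
  by (rule tail_conv_le(2)[where B = B, OF _ _ _ renewal refl]) (simp_all add: m_neg m_le ennreal_leI)

text \<open>The conserved quantity turns the part \<open>\<theta> * tail\<close> of the kernel into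
  the explicit source \<open>\<theta> * isrc\<close>, so that only the contracting
  \<open>ker\<close> still acts on \<open>m\<close>.\<close>

lemma ker_renewal:
  "ennreal (m t) = src t + ((\<integral>\<^sup>+u. ker u * ennreal (m (t - u)) \<partial>lborel) + ennreal \<theta> * isrc t)"
  unfolding renewal[of t] by (subst conv_ker_split) (auto simp: tail_conv)

lemma ker_finite: "ker u = ennreal (enn2real (ker u))"
  using ker_le[of u] ennreal_less_top[of "f u"] by (metis ennreal_enn2real le_less_trans)

lemma ker_integrable: "integrable lborel (\<lambda>u. enn2real (ker u))"
  using \<kappa> by (intro integrableI_nonneg) (auto simp: ker_finite[symmetric])

lemma ker_m_integrable: "integrable lborel (\<lambda>u. enn2real (ker u) * m (t - u))"
proof (rule Bochner_Integration.integrable_bound)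
  show "integrable lborel (\<lambda>u. B * enn2real (ker u))" using ker_integrable by simp
  have "\<bar>m s\<bar> \<le> \<bar>B\<bar>" for s using m_nonneg[of s] m_le[of s] by auto
  then show "AE u in lborel. norm (enn2real (ker u) * m (t - u)) \<le> norm (B * enn2real (ker u))"
    by (intro AE_I2) (simp add: abs_mult mult.commute[of "\<bar>B\<bar>"] mult_left_mono)
qed measurable

text \<open>Increments need subtraction, hence this real-valued form.\<close>

lemma ker_renewal_real:
  "m t = enn2real (src t) + (LBINT u. enn2real (ker u) * m (t - u)) + \<theta> * enn2real (isrc t)"
proof -
  have "(\<integral>\<^sup>+u. ker u * ennreal (m (t - u)) \<partial>lborel) = (\<integral>\<^sup>+u. ennreal (enn2real (ker u) * m (t - u)) \<partial>lborel)"
    by (intro nn_integral_cong) (subst ker_finite, simp add: ennreal_mult')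
  also have "\<dots> = ennreal (LBINT u. enn2real (ker u) * m (t - u))"
    by (intro nn_integral_eq_integral ker_m_integrable) (auto simp: m_nonneg)
  finally have 1: "(\<integral>\<^sup>+u. ker u * ennreal (m (t - u)) \<partial>lborel) = ennreal (LBINT u. enn2real (ker u) * m (t - u))" .
  have 2: "0 \<le> (LBINT u. enn2real (ker u) * m (t - u))" by (intro integral_nonneg_AE) (auto simp: m_nonneg)
  have 3: "src t = ennreal (enn2real (src t))" by (simp add: src_def indicator_def)
  have "isrc t < \<top>" using isrc_le[of t] ennreal_less_top le_less_trans by blast
  then have 4: "isrc t = ennreal (enn2real (isrc t))" by simp
  have "ennreal (m t) = ennreal (enn2real (src t) + (LBINT u. enn2real (ker u) * m (t - u)) + \<theta> * enn2real (isrc t))"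
  proof -
    have "ennreal (m t) = ennreal (enn2real (src t)) + (ennreal (LBINT u. enn2real (ker u) * m (t - u)) + ennreal \<theta> * ennreal (enn2real (isrc t)))"
      using ker_renewal[of t] unfolding 1 3[symmetric] 4[symmetric] .
    also have "\<dots> = ennreal (enn2real (src t) + (LBINT u. enn2real (ker u) * m (t - u)) + \<theta> * enn2real (isrc t))"
      using 2 \<theta>_pos by (simp add: ennreal_mult' ennreal_plus add.assoc del: ennreal_enn2real)
    finally show ?thesis .
  qed
  then show ?thesis using m_nonneg 2 \<theta>_pos by (subst (asm) ennreal_inj) auto
qed

text \<open>For negative \<open>t\<close> the increment may straddle the jump of \<open>src\<close>
  at \<open>0\<close>, which costs up to \<open>1\<close>; hence the minimum.\<close>

lemma src_diff:
  assumes "0 \<le> \<delta>"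
  shows "\<bar>enn2real (src (t + \<delta>)) - enn2real (src t)\<bar> \<le> min 1 (exp (- l * t))"
proof -
  have src: "enn2real (src s) = (if 0 \<le> s then exp (- l * s) else 0)" for s
    by (simp add: src_def)
  have le1: "exp (- l * s) \<le> 1" if "0 \<le> s" for s using that l_pos by simp
  show ?thesis
  proof (cases "0 \<le> t")
    case True
    have "exp (- l * (t + \<delta>)) \<le> exp (- l * t)" using assms l_pos by (simp add: mult_left_mono)
    moreover have "0 < exp (- l * (t + \<delta>))" by simp
    ultimately show ?thesis using True assms le1[OF True] unfolding src by simp
  next
    case False
    then have "1 \<le> exp (- l * t)" using l_pos by (simp add: mult_pos_neg less_imp_le)
    then show ?thesis using False le1[of "t + \<delta>"] unfolding src by simp
  qed
qed

lemma isrc_diff: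
  assumes "0 \<le> \<delta>"
  shows "\<bar>enn2real (isrc (t + \<delta>)) - enn2real (isrc t)\<bar> \<le> min 1 (exp (- l * t)) / l"
proof -
  have fin: "isrc t = ennreal (enn2real (isrc t))" for t
    using isrc_le[of t] ennreal_less_top[of "1 / l"] by (metis ennreal_enn2real le_less_trans)
  have "ennreal (enn2real (isrc t)) \<le> ennreal (enn2real (isrc (t + \<delta>)))"
    using isrc_mono[of t "t + \<delta>"] assms unfolding fin[symmetric] by simp
  then have 1: "enn2real (isrc t) \<le> enn2real (isrc (t + \<delta>))" by (subst (asm) ennreal_le_iff) auto
  have "isrc (t + \<delta>) \<le> isrc t + ennreal (min 1 (exp (- l * t)) / l)"
    using isrc_le isrc_ge order_trans by blast
  then have "ennreal (enn2real (isrc (t + \<delta>))) \<le> ennreal (enn2real (isrc t) + min 1 (exp (- l * t)) / l)"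
    using l_pos fin[of t] fin[of "t + \<delta>"] by (subst ennreal_plus) auto
  then have "enn2real (isrc (t + \<delta>)) \<le> enn2real (isrc t) + min 1 (exp (- l * t)) / l"
    using l_pos by (subst (asm) ennreal_le_iff) auto
  then show ?thesis using 1 by simp
qed

text \<open>The increments of both sources are of order \<open>exp (- l * t)\<close>, and the
  increment of \<open>m\<close> obeys an inequality with the contracting kernel, which lowers the
  rate to \<open>e\<close>. Neither \<open>A\<close> nor \<open>e\<close> may depend on
  \<open>\<delta>\<close>, since \<open>\<delta>\<close> is later sent to infinity.\<close>

lemma increment_decay:
  obtains e A where "0 < e" "e \<le> l / 4" "0 \<le> A"
    "\<And>\<delta> t. 0 \<le> \<delta> \<Longrightarrow> \<bar>m (t + \<delta>) - m t\<bar> \<le> A * exp (- e * t)"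
proof -
  obtain e \<kappa>' where e: "0 < e" "e \<le> l / 4" and \<kappa>': "0 \<le> \<kappa>'" "\<kappa>' < 1"
    and int: "(\<integral>\<^sup>+u. ker u * ennreal (exp (e * u)) \<partial>lborel) \<le> ennreal \<kappa>'"
    by (rule ker_exponential_moment)
  define A where "A = (1 + \<theta> / l)"
  have A: "0 \<le> A" using \<theta>_pos l_pos by (simp add: A_def)
  have dec: "\<bar>m (t + \<delta>) - m t\<bar> \<le> A / (1 - \<kappa>') * exp (- e * t)" if \<delta>: "0 \<le> \<delta>" for \<delta> t
  proof -
    define y where "y t = m (t + \<delta>) - m t" for t
    have [measurable]: "y \<in> borel_measurable borel" unfolding y_def by measurable
    have min: "min 1 (exp (- l * t)) \<le> exp (- e * t)" for t
      by (rule min_exp_le) (use e l_pos in simp_all)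
    have ineq: "ennreal \<bar>y t\<bar> \<le> ennreal (A * exp (- e * t)) + (\<integral>\<^sup>+u. ker u * ennreal \<bar>y (t - u)\<bar> \<partial>lborel)" for t
    proof -
      have split: "enn2real (ker u) * y (t - u) = enn2real (ker u) * m (t + \<delta> - u) - enn2real (ker u) * m (t - u)" for u
        unfolding y_def by (simp add: right_diff_distrib diff_add_eq)
      have int1: "integrable lborel (\<lambda>u. enn2real (ker u) * y (t - u))"
        unfolding split by (intro Bochner_Integration.integrable_diff ker_m_integrable)
      have "(LBINT u. enn2real (ker u) * y (t - u))
          = (LBINT u. enn2real (ker u) * m (t + \<delta> - u)) - (LBINT u. enn2real (ker u) * m (t - u))"
        unfolding split by (intro Bochner_Integration.integral_diff ker_m_integrable)
      then have "y t = (enn2real (src (t + \<delta>)) - enn2real (src t)) + \<theta> * (enn2real (isrc (t + \<delta>)) - enn2real (isrc t))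
          + (LBINT u. enn2real (ker u) * y (t - u))"
        unfolding y_def[of t] using ker_renewal_real[of "t + \<delta>"] ker_renewal_real[of t]
        by (simp only: right_diff_distrib)
      moreover have "\<bar>\<theta> * (enn2real (isrc (t + \<delta>)) - enn2real (isrc t))\<bar> = \<theta> * \<bar>enn2real (isrc (t + \<delta>)) - enn2real (isrc t)\<bar>"
        using \<theta>_pos by (simp add: abs_mult)
      moreover have "\<bar>enn2real (src (t + \<delta>)) - enn2real (src t)\<bar> \<le> exp (- e * t)"
        by (rule order_trans[OF src_diff[OF \<delta>] min])
      moreover have "\<bar>enn2real (isrc (t + \<delta>)) - enn2real (isrc t)\<bar> \<le> exp (- e * t) / l"
        by (rule order_trans[OF isrc_diff[OF \<delta>]]) (use min[of t] l_pos in \<open>auto intro: divide_right_mono\<close>)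
      then have "\<theta> * \<bar>enn2real (isrc (t + \<delta>)) - enn2real (isrc t)\<bar> \<le> \<theta> * (exp (- e * t) / l)"
        using \<theta>_pos by (intro mult_left_mono) auto
      moreover have "exp (- e * t) + \<theta> * (exp (- e * t) / l) = A * exp (- e * t)"
        by (simp add: A_def algebra_simps)
      ultimately have "\<bar>y t\<bar> \<le> A * exp (- e * t) + \<bar>LBINT u. enn2real (ker u) * y (t - u)\<bar>" by linarith
      then have "ennreal \<bar>y t\<bar> \<le> ennreal (A * exp (- e * t)) + ennreal \<bar>LBINT u. enn2real (ker u) * y (t - u)\<bar>"
        using A by (simp add: ennreal_leI flip: ennreal_plus)
      then show ?thesis
      proof (rule order_trans, intro add_left_mono)
        have "(\<integral>\<^sup>+u. ennreal (norm (enn2real (ker u) * y (t - u))) \<partial>lborel) = (\<integral>\<^sup>+u. ker u * ennreal \<bar>y (t - u)\<bar> \<partial>lborel)"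
          by (intro nn_integral_cong) (metis abs_mult abs_of_nonneg ennreal_mult' enn2real_nonneg ker_finite real_norm_def)
        then show "ennreal \<bar>LBINT u. enn2real (ker u) * y (t - u)\<bar> \<le> (\<integral>\<^sup>+u. ker u * ennreal \<bar>y (t - u)\<bar> \<partial>lborel)"
          using integral_norm_bound_ennreal[OF int1] by simp
      qed
    qed
    have bd: "ennreal \<bar>y t\<bar> \<le> ennreal B" for t
      unfolding y_def using m_nonneg[of t] m_nonneg[of "t + \<delta>"] m_le[of t] m_le[of "t + \<delta>"] by (intro ennreal_leI) auto
    have k0: "ker u = 0" if "u < 0" for u using ker_le[of u] f_neg[OF that] by simp
    have "ennreal \<bar>y t\<bar> \<le> ennreal (A / (1 - \<kappa>') * exp (- e * t))"
      by (rule convolution_contraction_decay[OF ker_meas k0 ineq bd int \<kappa>' less_imp_le[OF e(1)] A])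
    moreover have "0 \<le> A / (1 - \<kappa>') * exp (- e * t)" using A \<kappa>' by simp
    ultimately show ?thesis unfolding y_def by (simp only: ennreal_le_iff)
  qed
  show thesis by (rule that[OF e _ dec]) (use A \<kappa>' in auto)
qed

text \<open>If \<open>m\<close> tended to zero, so would its convolution with the integrable
  \<open>tail\<close>; but this convolution is \<open>isrc\<close>, which tends to
  \<open>1 / l\<close>. The growth condition carries the convergence from integer times to the
  shifted times \<open>real n - u\<close>.\<close>

lemma limit_pos:
  assumes growth: "\<And>s t. 0 \<le> s \<Longrightarrow> m t \<le> exp (l * s) * m (t + s)"
    and lim: "(\<lambda>n. m (real n)) \<longlonglongrightarrow> L"
  shows "0 < L"
proof (rule ccontr)
  assume "\<not> 0 < L"
  moreover have "0 \<le> L" by (rule LIMSEQ_le_const[OF lim]) (auto simp: m_nonneg)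
  ultimately have lim0: "(\<lambda>n. m (real n)) \<longlonglongrightarrow> 0" using lim by simp
  have shift: "(\<lambda>n. m (real n - u)) \<longlonglongrightarrow> 0" if "0 \<le> u" for u
  proof (rule tendsto_sandwich[OF _ _ tendsto_const])
    \<comment> \<open>The time \<open>real n - u\<close> lies less than one unit before the integer
      \<open>n - k\<close>, so growth costs at most the factor \<open>exp l\<close>.\<close>
    define k where "k = nat \<lfloor>u\<rfloor>"
    have k: "real k \<le> u" "u < real k + 1" using that by (auto simp: k_def)
    show "\<forall>\<^sub>F n in sequentially. 0 \<le> m (real n - u)" by (simp add: m_nonneg)
    show "\<forall>\<^sub>F n in sequentially. m (real n - u) \<le> exp l * m (real (n - k))"
      using eventually_ge_at_top[of k]
    proof eventually_elim
      case (elim n)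
      have "m (real n - u) \<le> exp (l * (u - real k)) * m (real (n - k))"
        using growth[of "u - real k" "real n - u"] k elim by (simp add: of_nat_diff)
      also have "\<dots> \<le> exp l * m (real (n - k))"
        using k l_pos by (intro mult_right_mono m_nonneg) auto
      finally show ?case .
    qed
    have "filterlim (\<lambda>n. n - k) at_top sequentially" by (rule filterlim_minus_const_nat_at_top)
    then have "(\<lambda>n. m (real (n - k))) \<longlonglongrightarrow> 0" by (rule filterlim_compose[OF lim0])
    then show "(\<lambda>n. exp l * m (real (n - k))) \<longlonglongrightarrow> 0" by (intro tendsto_mult_right_zero)
  qed
  have "(\<lambda>n. \<integral>\<^sup>+u. tail u * ennreal (m (real n - u)) \<partial>lborel) \<longlonglongrightarrow> (\<integral>\<^sup>+(u::real). 0 \<partial>lborel)"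
  proof (rule nn_integral_dominated_convergence[where w = "\<lambda>u. tail u * ennreal B"])
    show "(\<integral>\<^sup>+u. tail u * ennreal B \<partial>lborel) < \<infinity>"
      using tail_integral_finite by (subst nn_integral_multc) (auto simp: ennreal_mult_less_top)
    show "AE u in lborel. tail u * ennreal (m (real n - u)) \<le> tail u * ennreal B" for n
      by (intro AE_I2 mult_left_mono ennreal_leI m_le) auto
    show "AE u in lborel. (\<lambda>n. tail u * ennreal (m (real n - u))) \<longlonglongrightarrow> 0"
    proof (rule AE_I2)
      fix u
      show "(\<lambda>n. tail u * ennreal (m (real n - u))) \<longlonglongrightarrow> 0"
      proof (cases "0 \<le> u")
        case True
        have "tail u < \<top>" using tail_le_1[of u] by (simp add: le_less_trans)
        then have "(\<lambda>n. tail u * ennreal (m (real n - u))) \<longlonglongrightarrow> tail u * ennreal 0"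
          by (intro ennreal_tendsto_cmult tendsto_ennrealI shift True)
        then show ?thesis by simp
      qed (simp add: tail_def)
    qed
  qed auto
  then have "(\<lambda>n. isrc (real n)) \<longlonglongrightarrow> 0" by (simp add: tail_conv)
  moreover have "(\<lambda>n. ennreal (exp (- l * real n) / l)) \<longlonglongrightarrow> 0"
  proof -
    have "(\<lambda>n. exp (- l * real n) / l) \<longlonglongrightarrow> 0" using l_pos by real_asymp
    then show ?thesis using tendsto_ennrealI by fastforce
  qed
  ultimately have "(\<lambda>n. isrc (real n) + ennreal (exp (- l * real n) / l)) \<longlonglongrightarrow> 0 + 0"
    by (rule tendsto_add)
  moreover have "ennreal (1 / l) \<le> isrc (real n) + ennreal (exp (- l * real n) / l)" for n
    using isrc_ge[of "real n"] l_pos by (simp add: min_absorb2)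
  ultimately have "ennreal (1 / l) \<le> 0 + 0"
    by (intro LIMSEQ_le_const) auto
  then show False using l_pos by simp
qed

end

subsection \<open>The canonical probability space\<close>

lemma malthus_root:
  fixes K :: nat and w :: "nat \<Rightarrow> real"
  assumes K: "2 \<le> K" and w: "\<And>j. j < K \<Longrightarrow> 0 < w j"
  shows "0 < malthus K w" "(\<Sum>j=1..K. \<Prod>i<j. w i / (malthus K w + w i)) = 1"
proof -
  define g where "g l = (\<Sum>j=1..K. \<Prod>i<j. w i / (l + w i))" for l
  have anti: "g b < g a" if "0 \<le> a" "a < b" for a b
    unfolding g_def
  proof (rule sum_strict_mono)
    fix j assume j: "j \<in> {1..K}"
    show "(\<Prod>i<j. w i / (b + w i)) < (\<Prod>i<j. w i / (a + w i))"
    proof (rule prod_mono_strict[of 0])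
      fix i assume i: "i \<in> {..<j}"
      then have "0 < w i" using w j by auto
      then show "0 \<le> w i / (b + w i) \<and> w i / (b + w i) \<le> w i / (a + w i)"
        using that by (auto intro!: divide_left_mono)
      show "0 < w i / (a + w i)" using \<open>0 < w i\<close> that by simp
    next
      \<comment> \<open>Every product contains the factor \<open>i = 0\<close>, as
        \<open>j \<ge> 1\<close>; it makes the product decrease strictly.\<close>
      have "0 < w 0" using w K by auto
      then show "w 0 / (b + w 0) < w 0 / (a + w 0)" using that by (intro divide_strict_left_mono) auto
    qed (use j in auto)
  qed (use K in auto)
  have "w j \<noteq> 0" if "j < K" for j using w[OF that] by simp
  then have "g 0 = (\<Sum>j=1..K. 1)"
    unfolding g_def by (intro sum.cong refl prod.neutral) auto
  then have g0: "1 \<le> g 0" "g 0 \<noteq> 1" using K by auto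
  have "(g \<longlongrightarrow> (\<Sum>j=1..K. \<Prod>i<j. 0)) at_top"
    unfolding g_def
  proof (intro tendsto_sum tendsto_prod)
    fix i j
    show "((\<lambda>l. w i / (l + w i)) \<longlongrightarrow> 0) at_top" by real_asymp
  qed
  also have "(\<Sum>j=1..K. \<Prod>i<j. 0::real) = 0" by (intro sum.neutral) auto
  finally have "\<forall>\<^sub>F l in at_top. g l < 1" by (rule order_tendstoD) simp
  then obtain L where L: "\<And>l. L \<le> l \<Longrightarrow> g l < 1" by (auto simp: eventually_at_top_linorder)
  have "\<exists>x. 0 \<le> x \<and> x \<le> max L 0 \<and> g x = 1"
  proof (rule IVT2)
    show "\<forall>x. 0 \<le> x \<and> x \<le> max L 0 \<longrightarrow> isCont g x"
    proof safe
      fix x :: real assume "0 \<le> x"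
      then have "x + w i \<noteq> 0" if "i < K" for i using w[OF that] by linarith
      then show "isCont g x" unfolding g_def[abs_def] by (intro continuous_intros) auto
    qed
  qed (use g0 L[of "max L 0"] in auto)
  then obtain x where x: "0 \<le> x" "g x = 1" by blast
  then have x0: "0 < x" using g0 by (cases "x = 0") auto
  have "malthus K w = x"
    unfolding malthus_def g_def[symmetric]
  proof (rule the_equality)
    fix l assume "0 < l \<and> g l = 1"
    then show "l = x" using anti[of l x] anti[of x l] x x0 by (cases l x rule: linorder_cases) auto
  qed (use x x0 in auto)
  then show "0 < malthus K w" "(\<Sum>j=1..K. \<Prod>i<j. w i / (malthus K w + w i)) = 1"
    using x x0 by (auto simp: g_def)
qed

lemma birth_Nil [simp]: "birth \<sigma> [] \<omega> = 0"
  by (simp add: birth.simps)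

lemma birth_snoc: "birth \<sigma> (x @ [i]) \<omega> = birth \<sigma> x \<omega> + (\<Sum>j=1..i. \<sigma> (x @ [j]) \<omega>)"
  by (subst birth.simps) simp

text \<open>\<open>birth\<close> recurses on the last letter, but cutting the tree at the root
  requires recursion on the first one; the subtree at \<open>i\<close> is driven by the waiting
  times \<open>\<sigma> (i # x)\<close>.\<close>

lemma birth_Cons: "birth \<sigma> (i # y) \<omega> = (\<Sum>j=1..i. \<sigma> [j] \<omega>) + birth (\<lambda>x. \<sigma> (i # x)) y \<omega>"
proof (induction y rule: rev_induct)
  case Nil
  show ?case using birth_snoc[of \<sigma> "[]"] by simp
next
  case (snoc k y)
  have "birth \<sigma> (i # y @ [k]) \<omega> = birth \<sigma> (i # y) \<omega> + (\<Sum>j=1..k. \<sigma> (i # y @ [j]) \<omega>)"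
    using birth_snoc[of \<sigma> "i # y"] by simp
  then show ?case using snoc birth_snoc[of "\<lambda>x. \<sigma> (i # x)" y] by simp
qed

section \<open>The product space of waiting times\<close>

locale weighted_tree =
  fixes K :: nat and w :: "nat \<Rightarrow> real"
  assumes K2: "2 \<le> K" and w_pos: "\<And>j. j < K \<Longrightarrow> 0 < w j"
begin

definition I :: "nat set" where "I = {1..K}"

lemma I_iff: "i \<in> I \<longleftrightarrow> 1 \<le> i \<and> i \<le> K"
  by (simp add: I_def)

lemma finite_I [simp, intro]: "finite I"
  by (simp add: I_def)

lemma I_ne: "I \<noteq> {}"
  using K2 by (auto simp: I_def)

definition J :: "nat list set" where "J = words K - {[]}"

text \<open>The value \<open>1\<close> outside \<open>J\<close> makes every \<open>E x\<close> a
  probability measure, as the product space locale asks of all indices.\<close>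

definition rate :: "nat list \<Rightarrow> real" where "rate x = (if x \<in> J then w (last x - 1) else 1)"

definition E :: "nat list \<Rightarrow> real measure" where
  "E x = density lborel (exponential_density (rate x))"

text \<open>A sample \<open>s\<close> of \<open>P\<close> assigns to each nonempty word its waiting time, \<open>shift i s\<close> are the waiting
  times in the subtree at the \<open>i\<close>-th child of the root, and \<open>st i s\<close> is the birth time of this child.\<close>

definition P :: "(nat list \<Rightarrow> real) measure" where "P = PiM J E"

definition shift :: "nat \<Rightarrow> (nat list \<Rightarrow> real) \<Rightarrow> nat list \<Rightarrow> real" where
  "shift i s = (\<lambda>y\<in>J. s (i # y))"

definition st :: "nat \<Rightarrow> (nat list \<Rightarrow> real) \<Rightarrow> real" where
  "st i s = (\<Sum>j=1..i. s [j])"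

primrec tau :: "nat list \<Rightarrow> (nat list \<Rightarrow> real) \<Rightarrow> real" where
  "tau [] s = 0"
| "tau (i # y) s = st i s + tau y (shift i s)"

lemma Cons_J: "i \<in> I \<Longrightarrow> y \<in> J \<Longrightarrow> i # y \<in> J"
  by (auto simp: J_def words_def I_def)

lemma single_J: "i \<in> I \<Longrightarrow> [i] \<in> J"
  by (auto simp: J_def words_def I_def)

lemma countable_J: "countable J"
  by auto

lemma words_Cons: "i # y \<in> words K \<longleftrightarrow> i \<in> I \<and> y \<in> words K"
  by (auto simp: words_def I_def)

lemma words_Nil: "[] \<in> words K"
  by (auto simp: words_def)

lemma rate_pos: "0 < rate x"
proof (cases "x \<in> J")
  case True
  then have "x \<noteq> []" "set x \<subseteq> I" by (auto simp: J_def words_def I_def)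
  then have "last x \<in> I" using last_in_set by blast
  then show ?thesis using True by (auto simp: rate_def I_def intro!: w_pos)
qed (simp add: rate_def)

lemma prob_E: "prob_space (E x)"
  unfolding E_def by (rule prob_space_exponential_density[OF rate_pos])

lemma sets_E [measurable_cong]: "sets (E x) = sets borel"
  by (simp add: E_def)

lemma space_E [simp]: "space (E x) = UNIV"
  by (simp add: E_def)

text \<open>The rate depends on the last letter only, and prefixing a nonempty word does not change
  it. This self-similarity is why \<open>shift i\<close> preserves \<open>P\<close>.\<close>

lemma E_Cons: "y \<in> J \<Longrightarrow> i \<in> I \<Longrightarrow> E (i # y) = E y"
  using Cons_J[of i y] by (auto simp: E_def rate_def J_def)

sublocale P: prob_space P
  unfolding P_def by (rule prob_space_PiM) (rule prob_E)

sublocale PE: product_prob_space E J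
  by (intro product_prob_spaceI prob_E)

lemma sets_P [measurable_cong]: "sets P = sets (PiM J (\<lambda>_. borel))"
  unfolding P_def by (intro sets_PiM_cong refl sets_E)

lemma space_P: "space P = J \<rightarrow>\<^sub>E UNIV"
  unfolding P_def by (simp add: space_PiM)

lemma coord_meas: "x \<in> J \<Longrightarrow> (\<lambda>s. s x) \<in> borel_measurable P"
  unfolding measurable_cong_sets[OF sets_P refl] by (rule measurable_component_singleton)

lemma shift_meas [measurable]: "i \<in> I \<Longrightarrow> shift i \<in> measurable P P"
  unfolding shift_def[abs_def] measurable_cong_sets[OF refl sets_P]
  by (intro measurable_restrict coord_meas Cons_J)

lemma st_meas [measurable]: "i \<le> K \<Longrightarrow> st i \<in> borel_measurable P"
  unfolding st_def[abs_def] by (intro borel_measurable_sum coord_meas single_J) (auto simp: I_def)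

lemma tau_meas: "x \<in> words K \<Longrightarrow> tau x \<in> borel_measurable P"
proof (induction x)
  case (Cons i y)
  then have [measurable]: "i \<in> I" "tau y \<in> borel_measurable P" by (auto simp: words_Cons)
  then have [measurable]: "i \<le> K" by (simp add: I_def)
  show ?case by simp
next
  case Nil
  show ?case by (simp add: fun_eq_iff cong: measurable_cong)
qed

lemma distr_coord: "x \<in> J \<Longrightarrow> distr P borel (\<lambda>s. s x) = E x"
  using PE.PiM_component[of x] unfolding P_def by (metis distr_cong sets_E)

lemma coords_indep: "P.indep_vars (\<lambda>_. borel) (\<lambda>x s. s x) J"
proof (subst P.indep_vars_iff_distr_eq_PiM')
  show "J \<noteq> {}" using single_J I_ne by blast
  have "distr P (PiM J (\<lambda>_. borel)) (\<lambda>s. \<lambda>x\<in>J. s x) = distr P P (\<lambda>s. s)"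
    by (rule distr_cong) (auto simp: sets_P space_P fun_eq_iff extensional_def PiE_def)
  also have "\<dots> = PiM J (\<lambda>x. distr P borel (\<lambda>s. s x))"
    by (simp add: distr_id2) (simp add: P_def distr_coord[unfolded P_def] cong: PiM_cong)
  finally show "distr P (PiM J (\<lambda>_. borel)) (\<lambda>s. \<lambda>x\<in>J. s x) = PiM J (\<lambda>x. distr P borel (\<lambda>s. s x))" .
qed (rule coord_meas)

lemma distr_shift: "i \<in> I \<Longrightarrow> distr P P (shift i) = P"
proof -
  assume i: "i \<in> I"
  have "distr (PiM J E) (PiM J (\<lambda>y. E (i # y))) (\<lambda>s. \<lambda>y\<in>J. s (i # y)) = PiM J (\<lambda>y. E (i # y))"
    using i by (intro distr_PiM_reindex prob_E) (auto simp: Cons_J)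
  moreover have "PiM J (\<lambda>y. E (i # y)) = P"
    unfolding P_def using i by (intro PiM_cong) (auto simp: E_Cons)
  ultimately show ?thesis by (simp add: P_def[symmetric] shift_def[abs_def])
qed

section \<open>The branching property\<close>

definition PI :: "(nat \<Rightarrow> nat list \<Rightarrow> real) measure" where "PI = PiM I (\<lambda>_. P)"

definition rt :: "(nat list \<Rightarrow> real) \<Rightarrow> nat \<Rightarrow> real" where "rt s = (\<lambda>i\<in>I. s [i])"

definition shifts :: "(nat list \<Rightarrow> real) \<Rightarrow> nat \<Rightarrow> nat list \<Rightarrow> real" where
  "shifts s = (\<lambda>i\<in>I. shift i s)"

sublocale PI: prob_space PI
  unfolding PI_def by (rule prob_space_PiM) (rule P.prob_space_axioms)

sublocale PF: product_prob_space "\<lambda>_. P" I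
  by (intro product_prob_spaceI P.prob_space_axioms)

lemma shifts_meas [measurable]: "shifts \<in> measurable P PI"
  unfolding shifts_def[abs_def] PI_def by (intro measurable_restrict shift_meas)

lemma rt_meas [measurable]: "rt \<in> measurable P (PiM I (\<lambda>_. borel))"
  unfolding rt_def[abs_def] by (intro measurable_restrict coord_meas single_J)

text \<open>Words below distinct children form disjoint sets of coordinates, so the subtrees are
  independent, each with law \<open>P\<close>.\<close>

lemma distr_shifts: "distr P PI shifts = PI"
proof -
  have "P.indep_vars (\<lambda>i. PiM (Cons i ` J) (\<lambda>_. borel)) (\<lambda>i s. restrict (\<lambda>x. s x) (Cons i ` J)) I"
    by (rule P.indep_vars_restrict[OF coords_indep]) (auto simp: Cons_J disjoint_family_on_def)
  then have "P.indep_vars (\<lambda>_. P) (\<lambda>i s. (\<lambda>y\<in>J. (restrict (\<lambda>x. s x) (Cons i ` J)) (i # y))) I"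
  proof (rule P.indep_vars_compose2)
    fix i assume "i \<in> I"
    show "(\<lambda>g. \<lambda>y\<in>J. g (i # y)) \<in> measurable (PiM (Cons i ` J) (\<lambda>_. borel)) P"
      unfolding measurable_cong_sets[OF refl sets_P]
      by (intro measurable_restrict measurable_component_singleton) auto
  qed
  also have "(\<lambda>i s. (\<lambda>y\<in>J. (restrict (\<lambda>x. s x) (Cons i ` J)) (i # y))) = shift"
    by (auto simp: fun_eq_iff shift_def)
  finally have "P.indep_vars (\<lambda>_. P) shift I" .
  then have "distr P (PiM I (\<lambda>_. P)) (\<lambda>s. \<lambda>i\<in>I. shift i s) = PiM I (\<lambda>i. distr P P (shift i))"
    using I_ne by (subst (asm) P.indep_vars_iff_distr_eq_PiM') auto
  also have "\<dots> = PI" unfolding PI_def by (intro PiM_cong refl) (simp add: distr_shift)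
  finally show ?thesis by (simp add: PI_def shifts_def[abs_def])
qed

text \<open>Words of length one and words of length at least two are disjoint sets of coordinates.
  Hence, given the births of the children, the subtrees can be integrated out as independent
  samples.\<close>

lemma root_decomposition:
  assumes F: "F \<in> borel_measurable (PiM I (\<lambda>_. borel) \<Otimes>\<^sub>M PI)"
  shows "(\<integral>\<^sup>+s. F (rt s, shifts s) \<partial>P) = (\<integral>\<^sup>+s. \<integral>\<^sup>+ss. F (rt s, ss) \<partial>PI \<partial>P)"
proof -
  note F[measurable]
  define A where "A = (\<lambda>i. [i]) ` I"
  define B where "B = (\<Union>i\<in>I. Cons i ` J)"
  define rA :: "(nat list \<Rightarrow> real) \<Rightarrow> nat list \<Rightarrow> real" where "rA s = restrict s A" for s
  define rB :: "(nat list \<Rightarrow> real) \<Rightarrow> nat list \<Rightarrow> real" where "rB s = restrict s B" for s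
  let ?MA = "PiM A (\<lambda>_. borel) :: (nat list \<Rightarrow> real) measure"
  let ?MB = "PiM B (\<lambda>_. borel) :: (nat list \<Rightarrow> real) measure"
  define a :: "(nat list \<Rightarrow> real) \<Rightarrow> nat \<Rightarrow> real" where "a g = (\<lambda>i\<in>I. g [i])" for g
  define b :: "(nat list \<Rightarrow> real) \<Rightarrow> nat \<Rightarrow> nat list \<Rightarrow> real" where "b g = (\<lambda>i\<in>I. \<lambda>y\<in>J. g (i # y))" for g
  have "P.indep_var ?MA (\<lambda>s. restrict (\<lambda>x. s x) A) ?MB (\<lambda>s. restrict (\<lambda>x. s x) B)"
    by (rule P.indep_var_restrict[OF coords_indep]) (auto simp: A_def B_def J_def words_def I_def)
  then have ind: "P.indep_var ?MA rA ?MB rB" by (simp add: rA_def[abs_def] rB_def[abs_def])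
  have [measurable]: "rA \<in> measurable P ?MA" "rB \<in> measurable P ?MB"
    using ind by (auto dest: P.indep_var_rv1 P.indep_var_rv2)
  have [measurable]: "a \<in> measurable ?MA (PiM I (\<lambda>_. borel))"
    unfolding a_def[abs_def] by (intro measurable_restrict measurable_component_singleton) (auto simp: A_def)
  have [measurable]: "b \<in> measurable ?MB PI"
    unfolding PI_def b_def[abs_def]
  proof (rule measurable_restrict)
    fix i assume "i \<in> I"
    then show "(\<lambda>g. \<lambda>y\<in>J. g (i # y)) \<in> measurable ?MB P"
      unfolding measurable_cong_sets[OF refl sets_P]
      by (intro measurable_restrict measurable_component_singleton) (auto simp: B_def)
  qed
  have a: "a (rA s) = rt s" for s
    by (auto simp: fun_eq_iff a_def rA_def rt_def A_def)
  have b: "b (rB s) = shifts s" for s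
    by (auto simp: fun_eq_iff b_def rB_def shifts_def shift_def B_def)
  interpret B: prob_space "distr P ?MB rB" by (rule P.prob_space_distr) measurable
  have "(\<integral>\<^sup>+s. F (rt s, shifts s) \<partial>P) = (\<integral>\<^sup>+z. F (a (fst z), b (snd z)) \<partial>distr P (?MA \<Otimes>\<^sub>M ?MB) (\<lambda>s. (rA s, rB s)))"
    by (subst nn_integral_distr) (auto simp: a b)
  also have "distr P (?MA \<Otimes>\<^sub>M ?MB) (\<lambda>s. (rA s, rB s)) = distr P ?MA rA \<Otimes>\<^sub>M distr P ?MB rB"
    using ind unfolding P.indep_var_distribution_eq by simp
  also have "(\<integral>\<^sup>+z. F (a (fst z), b (snd z)) \<partial>(distr P ?MA rA \<Otimes>\<^sub>M distr P ?MB rB))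
      = (\<integral>\<^sup>+x. \<integral>\<^sup>+y. F (a x, b y) \<partial>distr P ?MB rB \<partial>distr P ?MA rA)"
    by (subst B.nn_integral_fst[symmetric]) auto
  also have "\<dots> = (\<integral>\<^sup>+s. \<integral>\<^sup>+y. F (rt s, b y) \<partial>distr P ?MB rB \<partial>P)"
    by (subst nn_integral_distr) (auto simp: a)
  also have "\<dots> = (\<integral>\<^sup>+s. \<integral>\<^sup>+ss. F (rt s, ss) \<partial>PI \<partial>P)"
  proof (rule nn_integral_cong)
    fix s assume "s \<in> space P"
    then have [measurable]: "rt s \<in> space (PiM I (\<lambda>_. borel))" by (rule measurable_space[OF rt_meas])
    have "(\<integral>\<^sup>+y. F (rt s, b y) \<partial>distr P ?MB rB) = (\<integral>\<^sup>+s'. F (rt s, shifts s') \<partial>P)"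
      by (subst nn_integral_distr) (auto simp: b)
    also have "\<dots> = (\<integral>\<^sup>+ss. F (rt s, ss) \<partial>distr P PI shifts)"
      by (subst nn_integral_distr) auto
    finally show "(\<integral>\<^sup>+y. F (rt s, b y) \<partial>distr P ?MB rB) = (\<integral>\<^sup>+ss. F (rt s, ss) \<partial>PI)"
      unfolding distr_shifts .
  qed
  finally show ?thesis .
qed

text \<open>Projection of the branching property to one subtree, which is enough for means by
  linearity.\<close>

lemma root_decomposition_single:
  assumes i: "i \<in> I" and G: "G \<in> borel_measurable (borel \<Otimes>\<^sub>M P)"
  shows "(\<integral>\<^sup>+s. G (st i s, shift i s) \<partial>P) = (\<integral>\<^sup>+s. \<integral>\<^sup>+s'. G (st i s, s') \<partial>P \<partial>P)"
proof -
  note G[measurable]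
  have st: "st i s = (\<Sum>j=1..i. rt s j)" for s
    unfolding st_def rt_def using i by (intro sum.cong) (auto simp: I_iff)
  have [measurable]: "(\<lambda>ss. ss i) \<in> measurable PI P"
    unfolding PI_def by (rule measurable_component_singleton[OF i])
  have [measurable]: "(\<lambda>r::nat \<Rightarrow> real. \<Sum>j=1..i. r j) \<in> borel_measurable (PiM I (\<lambda>_. borel))"
    by (intro borel_measurable_sum measurable_component_singleton) (use i in \<open>auto simp: I_iff\<close>)
  have "(\<integral>\<^sup>+s. G (st i s, shift i s) \<partial>P) = (\<integral>\<^sup>+s. (\<lambda>(r, ss). G (\<Sum>j=1..i. r j, ss i)) (rt s, shifts s) \<partial>P)"
    using i by (simp add: st shifts_def)
  also have "\<dots> = (\<integral>\<^sup>+s. \<integral>\<^sup>+ss. (\<lambda>(r, ss). G (\<Sum>j=1..i. r j, ss i)) (rt s, ss) \<partial>PI \<partial>P)"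
    by (rule root_decomposition) measurable
  also have "\<dots> = (\<integral>\<^sup>+s. \<integral>\<^sup>+ss. G (st i s, ss i) \<partial>PI \<partial>P)" by (simp add: st)
  also have "\<dots> = (\<integral>\<^sup>+s. \<integral>\<^sup>+s'. G (st i s, s') \<partial>P \<partial>P)"
  proof (rule nn_integral_cong)
    fix s
    have "(\<integral>\<^sup>+ss. G (st i s, ss i) \<partial>PI) = (\<integral>\<^sup>+s'. G (st i s, s') \<partial>distr PI P (\<lambda>ss. ss i))"
      by (subst nn_integral_distr) auto
    also have "distr PI P (\<lambda>ss. ss i) = P"
      unfolding PI_def by (rule distr_PiM_component[OF _ i]) (rule P.prob_space_axioms)
    finally show "(\<integral>\<^sup>+ss. G (st i s, ss i) \<partial>PI) = (\<integral>\<^sup>+s'. G (st i s, s') \<partial>P)" .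
  qed
  finally show ?thesis .
qed

lemma AE_shift: "i \<in> I \<Longrightarrow> AE s in P. Q s \<Longrightarrow> AE s in P. Q (shift i s)"
  by (rule AE_distrD[OF shift_meas]) (simp, subst distr_shift)

end

subsection \<open>The intensity of the births of the children of the root\<close>

lemma exponential_laplace:
  fixes l a :: real
  assumes "0 < l" "0 \<le> a"
  shows "(\<integral>\<^sup>+b. ennreal (exp (- a * b)) \<partial>density lborel (exponential_density l)) = ennreal (l / (a + l))"
proof -
  have "(\<integral>\<^sup>+b. ennreal (exp (- a * b)) \<partial>density lborel (exponential_density l))
      = (\<integral>\<^sup>+b. ennreal l * (ennreal (exp (- (a + l) * b)) * indicator {0..} b) \<partial>lborel)"
  proof (subst nn_integral_density)
    show "(\<integral>\<^sup>+b. ennreal (exponential_density l b) * ennreal (exp (- a * b)) \<partial>lborel)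
      = (\<integral>\<^sup>+b. ennreal l * (ennreal (exp (- (a + l) * b)) * indicator {0..} b) \<partial>lborel)"
    proof (rule nn_integral_cong)
      fix b :: real
      have "exp (- (b * l)) * exp (- (a * b)) = exp ((- a - l) * b)"
        by (simp add: exp_add[symmetric] algebra_simps)
      then show "ennreal (exponential_density l b) * ennreal (exp (- a * b))
        = ennreal l * (ennreal (exp (- (a + l) * b)) * indicator {0..} b)"
        using assms by (auto simp: exponential_density_def indicator_def ennreal_mult'[symmetric] mult.assoc)
    qed
  qed auto
  also have "\<dots> = ennreal l * ennreal (1 / (a + l))"
    using assms by (subst nn_integral_cmult, simp) (subst nn_integral_exp_ge_0, auto)
  finally show ?thesis using assms by (simp add: ennreal_mult'[symmetric])
qed

lemma exponential_tail:
  fixes l c :: real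
  assumes "0 < l" "0 \<le> c"
  shows "(\<integral>\<^sup>+b. indicator {0<..} (b - c) \<partial>density lborel (exponential_density l)) = ennreal (exp (- l * c))"
proof -
  let ?M = "density lborel (exponential_density l)"
  interpret prob_space ?M by (rule prob_space_exponential_density[OF assms(1)])
  have "distributed ?M lborel (\<lambda>x. x) (exponential_density l)"
    unfolding distributed_def by (auto simp: distr_id2)
  then have "\<P>(x in ?M. c < x) = exp (- c * l)"
    by (rule exponential_distributedD_gt[OF _ assms(2,1)])
  then have em: "emeasure ?M {x. c < x} = ennreal (exp (- l * c))"
    by (simp add: emeasure_eq_measure mult.commute)
  have "(\<integral>\<^sup>+b. indicator {0<..} (b - c) \<partial>?M) = (\<integral>\<^sup>+b. indicator {x. c < x} b \<partial>?M)"
    by (rule nn_integral_cong) (auto simp: indicator_def)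
  also have "\<dots> = emeasure ?M {x. c < x}" by (rule nn_integral_indicator) simp
  finally show ?thesis unfolding em .
qed

context weighted_tree begin

definition lam :: real where "lam = malthus K w"

lemma lam_pos: "0 < lam"
  unfolding lam_def by (rule malthus_root[OF K2 w_pos])

lemma w_nonneg: "j < K \<Longrightarrow> 0 \<le> w j"
  using w_pos[of j] by simp

lemma factor_nonneg: "j < K \<Longrightarrow> 0 \<le> w j / (lam + w j)"
  using w_pos[of j] lam_pos by simp

lemma st_0 [simp]: "st 0 s = 0"
  by (simp add: st_def)

lemma st_Suc: "st (Suc l) s = st l s + s [Suc l]"
  by (simp add: st_def)

lemma E_single: "l < K \<Longrightarrow> E [Suc l] = density lborel (exponential_density (w l))"
  using single_J[of "Suc l"] by (simp add: E_def rate_def I_iff)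

section \<open>The children of the root as a pure birth process\<close>

lemma stage_independent:
  assumes l: "l < K" and G: "G \<in> borel_measurable (borel \<Otimes>\<^sub>M borel)"
  shows "(\<integral>\<^sup>+s. G (st l s, s [Suc l]) \<partial>P)
    = (\<integral>\<^sup>+s. \<integral>\<^sup>+b. G (st l s, b) \<partial>density lborel (exponential_density (w l)) \<partial>P)"
proof -
  note G[measurable]
  have [measurable]: "st l \<in> borel_measurable P" "(\<lambda>s. s [Suc l]) \<in> borel_measurable P"
    using l coord_meas[OF single_J[of "Suc l"]] by (auto simp: I_iff)
  let ?A = "(\<lambda>j. [j]) ` {1..l}"
  have "P.indep_var borel (\<lambda>s. s [Suc l]) borel (\<lambda>s. \<Sum>x\<in>?A. s x)"
    by (rule P.indep_vars_sum[OF _ _ P.indep_vars_subset[OF coords_indep]])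
       (use l single_J in \<open>auto simp: I_iff\<close>)
  moreover have "(\<Sum>x\<in>?A. s x) = st l s" for s :: "nat list \<Rightarrow> real"
    unfolding st_def by (subst sum.reindex) (auto simp: inj_on_def)
  ultimately have ind: "P.indep_var borel (\<lambda>s. s [Suc l]) borel (st l)" by simp
  let ?E = "E [Suc l]"
  have d: "distr P borel (\<lambda>s. s [Suc l]) = ?E" by (rule distr_coord) (use l single_J in \<open>auto simp: I_iff\<close>)
  interpret E: prob_space ?E by (rule prob_E)
  interpret S: prob_space "distr P borel (st l)" by (rule P.prob_space_distr) simp
  interpret ES: pair_sigma_finite ?E "distr P borel (st l)" ..
  have "(\<integral>\<^sup>+s. G (st l s, s [Suc l]) \<partial>P)
      = (\<integral>\<^sup>+z. G (snd z, fst z) \<partial>distr P (borel \<Otimes>\<^sub>M borel) (\<lambda>s. (s [Suc l], st l s)))"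
    by (subst nn_integral_distr) auto
  also have "distr P (borel \<Otimes>\<^sub>M borel) (\<lambda>s. (s [Suc l], st l s)) = ?E \<Otimes>\<^sub>M distr P borel (st l)"
    using ind unfolding P.indep_var_distribution_eq d by simp
  also have "(\<integral>\<^sup>+z. G (snd z, fst z) \<partial>(?E \<Otimes>\<^sub>M distr P borel (st l)))
      = (\<integral>\<^sup>+a. \<integral>\<^sup>+b. G (a, b) \<partial>?E \<partial>distr P borel (st l))"
    by (subst ES.nn_integral_snd[symmetric]) auto
  also have "\<dots> = (\<integral>\<^sup>+s. \<integral>\<^sup>+b. G (st l s, b) \<partial>?E \<partial>P)"
    by (subst nn_integral_distr) auto
  finally show ?thesis unfolding E_single[OF l] .
qed

text \<open>The probability that the root has exactly \<open>l\<close> children at time \<open>u\<close> (see \<open>p_eq\<close> below), with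
  the waiting time for the next child already integrated out.\<close>

definition p :: "nat \<Rightarrow> real \<Rightarrow> ennreal" where
  "p l u = (\<integral>\<^sup>+s. ennreal (exp (- w l * (u - st l s))) * indicator {0..} (u - st l s) \<partial>P)"

lemma p_meas [measurable]: "l < K \<Longrightarrow> p l \<in> borel_measurable borel"
proof -
  assume "l < K"
  then have [measurable]: "st l \<in> borel_measurable P" by simp
  show ?thesis unfolding p_def[abs_def] by measurable
qed

text \<open>Child \<open>Suc l\<close> is born at rate \<open>w l\<close> while exactly
  \<open>l\<close> children are present, so \<open>w l * p l\<close> is the density of its birth
  time.\<close>

lemma nn_integral_st_Suc:
  assumes l: "l < K" and \<psi>: "\<psi> \<in> borel_measurable borel"
  shows "(\<integral>\<^sup>+s. \<psi> (st (Suc l) s) \<partial>P) = (\<integral>\<^sup>+u. \<psi> u * (ennreal (w l) * p l u) \<partial>lborel)"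
proof -
  note \<psi>[measurable]
  have wl: "0 < w l" using w_pos[OF l] .
  have [measurable]: "st l \<in> borel_measurable P" using l by simp
  have "(\<integral>\<^sup>+s. \<psi> (st (Suc l) s) \<partial>P) = (\<integral>\<^sup>+s. (\<lambda>(a, b). \<psi> (a + b)) (st l s, s [Suc l]) \<partial>P)"
    by (simp add: st_Suc)
  also have "\<dots> = (\<integral>\<^sup>+s. \<integral>\<^sup>+b. (\<lambda>(a, b). \<psi> (a + b)) (st l s, b) \<partial>density lborel (exponential_density (w l)) \<partial>P)"
    by (rule stage_independent[OF l]) measurable
  also have "\<dots> = (\<integral>\<^sup>+s. \<integral>\<^sup>+b. ennreal (exponential_density (w l) b) * \<psi> (st l s + b) \<partial>lborel \<partial>P)"
    by (simp add: nn_integral_density)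
  also have "\<dots> = (\<integral>\<^sup>+s. \<integral>\<^sup>+u. ennreal (exponential_density (w l) (u - st l s)) * \<psi> u \<partial>lborel \<partial>P)"
  proof (rule nn_integral_cong)
    fix s
    show "(\<integral>\<^sup>+b. ennreal (exponential_density (w l) b) * \<psi> (st l s + b) \<partial>lborel)
      = (\<integral>\<^sup>+u. ennreal (exponential_density (w l) (u - st l s)) * \<psi> u \<partial>lborel)"
      using nn_integral_shift[of "\<lambda>b. ennreal (exponential_density (w l) b) * \<psi> (st l s + b)" "st l s"] by simp
  qed
  also have "\<dots> = (\<integral>\<^sup>+u. \<integral>\<^sup>+s. ennreal (exponential_density (w l) (u - st l s)) * \<psi> u \<partial>P \<partial>lborel)"
  proof (rule pair_sigma_finite.Fubini')
    show "pair_sigma_finite lborel P" ..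
  qed measurable
  also have "\<dots> = (\<integral>\<^sup>+u. \<psi> u * (ennreal (w l) * p l u) \<partial>lborel)"
  proof (rule nn_integral_cong)
    fix u :: real
    have "(\<integral>\<^sup>+s. ennreal (exponential_density (w l) (u - st l s)) * \<psi> u \<partial>P)
      = (\<integral>\<^sup>+s. (\<psi> u * ennreal (w l)) * (ennreal (exp (- w l * (u - st l s))) * indicator {0..} (u - st l s)) \<partial>P)"
    proof (rule nn_integral_cong)
      fix s
      have "ennreal (exponential_density (w l) (u - st l s)) = ennreal (w l) * (ennreal (exp (- w l * (u - st l s))) * indicator {0..} (u - st l s))"
        using wl by (auto simp: exponential_density_def indicator_def ennreal_mult' mult.commute minus_mult_right[symmetric] algebra_simps)
      then show "ennreal (exponential_density (w l) (u - st l s)) * \<psi> u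
        = (\<psi> u * ennreal (w l)) * (ennreal (exp (- w l * (u - st l s))) * indicator {0..} (u - st l s))"
        by (simp add: mult_ac)
    qed
    also have "\<dots> = (\<psi> u * ennreal (w l)) * p l u"
      unfolding p_def by (subst nn_integral_cmult) auto
    finally show "(\<integral>\<^sup>+s. ennreal (exponential_density (w l) (u - st l s)) * \<psi> u \<partial>P) = \<psi> u * (ennreal (w l) * p l u)"
      by (simp add: mult.assoc)
  qed
  finally show ?thesis .
qed

lemma p_eq:
  assumes l: "l < K"
  shows "p l u = (\<integral>\<^sup>+s. indicator {0..} (u - st l s) * indicator {0<..} (st (Suc l) s - u) \<partial>P)"
proof -
  have "(\<integral>\<^sup>+s. indicator {0..} (u - st l s) * indicator {0<..} (st (Suc l) s - u) \<partial>P)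
    = (\<integral>\<^sup>+s. (\<lambda>(a, b). indicator {0..} (u - a) * indicator {0<..} (b - (u - a)) :: ennreal) (st l s, s [Suc l]) \<partial>P)"
    by (simp add: st_Suc algebra_simps)
  also have "\<dots> = (\<integral>\<^sup>+s. \<integral>\<^sup>+b. (\<lambda>(a, b). indicator {0..} (u - a) * indicator {0<..} (b - (u - a)) :: ennreal) (st l s, b)
      \<partial>density lborel (exponential_density (w l)) \<partial>P)"
    by (rule stage_independent[OF l]) measurable
  also have "\<dots> = p l u"
    unfolding p_def
  proof (rule nn_integral_cong)
    fix s
    show "(\<integral>\<^sup>+b. (\<lambda>(a, b). indicator {0..} (u - a) * indicator {0<..} (b - (u - a)) :: ennreal) (st l s, b)
      \<partial>density lborel (exponential_density (w l))) = ennreal (exp (- w l * (u - st l s))) * indicator {0..} (u - st l s)"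
    proof (cases "st l s \<le> u")
      case True
      then show ?thesis using exponential_tail[OF w_pos[OF l], of "u - st l s"] by simp
    qed simp
  qed
  finally show ?thesis ..
qed

lemma p_le_1: "l < K \<Longrightarrow> p l u \<le> 1"
proof -
  assume l: "l < K"
  have "p l u \<le> (\<integral>\<^sup>+s. 1 \<partial>P)" unfolding p_eq[OF l] by (rule nn_integral_mono) (auto simp: indicator_def)
  then show ?thesis by (simp add: P.emeasure_space_1)
qed

text \<open>Samples range over all real families, so monotonicity of birth times has to come from an
  almost sure event, and from one that passes to subtrees.\<close>

definition nonneg :: "(nat list \<Rightarrow> real) \<Rightarrow> bool" where "nonneg s \<longleftrightarrow> (\<forall>x\<in>J. 0 \<le> s x)"

lemma AE_nonneg: "AE s in P. nonneg s"
  unfolding nonneg_def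
proof (subst AE_ball_countable[OF countable_J], safe)
  fix x assume "x \<in> J"
  moreover have "AE b in E x. 0 \<le> b"
    unfolding E_def by (subst AE_density) (auto simp: exponential_density_def)
  ultimately show "AE s in P. 0 \<le> s x"
    unfolding P_def by (intro AE_PiM_component prob_E)
qed

lemma nonneg_shift: "nonneg s \<Longrightarrow> i \<in> I \<Longrightarrow> nonneg (shift i s)"
  by (auto simp: nonneg_def shift_def Cons_J)

lemma nonneg_st_mono: "nonneg s \<Longrightarrow> i \<le> j \<Longrightarrow> j \<le> K \<Longrightarrow> st i s \<le> st j s"
  unfolding st_def using single_J by (intro sum_mono2) (auto simp: nonneg_def I_iff)

lemma nonneg_st: "nonneg s \<Longrightarrow> i \<le> K \<Longrightarrow> 0 \<le> st i s"
  using nonneg_st_mono[of s 0 i] by simp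

text \<open>The sum is the intensity of births of children of the root at time
  \<open>u\<close>.\<close>

definition f :: "real \<Rightarrow> real" where
  "f u = (if u < 0 then 0 else exp (- lam * u) * (\<Sum>l<K. w l * enn2real (p l u)))"

lemma p_neg: "l < K \<Longrightarrow> u < 0 \<Longrightarrow> p l u = 0"
proof -
  assume l: "l < K" and u: "u < 0"
  have "p l u = (\<integral>\<^sup>+s. 0 \<partial>P)"
    unfolding p_def
  proof (rule nn_integral_cong_AE)
    show "AE s in P. ennreal (exp (- w l * (u - st l s))) * indicator {0..} (u - st l s) = 0"
      using AE_nonneg by eventually_elim (use nonneg_st[of _ l] l u in \<open>force simp: indicator_def\<close>)
  qed
  then show ?thesis by simp
qed

lemma ennreal_p: "l < K \<Longrightarrow> ennreal (enn2real (p l u)) = p l u"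
  using p_le_1[of l u] by (simp add: le_less_trans)

lemma ennreal_f: "ennreal (f u) = ennreal (exp (- lam * u)) * (\<Sum>l<K. ennreal (w l) * p l u)"
proof (cases "u < 0")
  case True
  then show ?thesis by (simp add: f_def p_neg)
next
  case False
  have "ennreal (\<Sum>l<K. w l * enn2real (p l u)) = (\<Sum>l<K. ennreal (w l * enn2real (p l u)))"
    by (rule sum_ennreal[symmetric]) (auto intro!: mult_nonneg_nonneg w_nonneg)
  also have "\<dots> = (\<Sum>l<K. ennreal (w l) * p l u)"
    using w_pos by (intro sum.cong) (auto simp: ennreal_mult less_imp_le ennreal_p)
  finally show ?thesis using False by (simp add: f_def ennreal_mult')
qed

text \<open>Sum the densities \<open>w l * p l\<close> of the birth times and absorb the discount
  into \<open>f\<close>; child \<open>i\<close> belongs to stage \<open>l = i - 1\<close>.\<close>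

lemma first_moment:
  assumes [measurable]: "\<psi> \<in> borel_measurable borel"
  shows "(\<Sum>i\<in>I. \<integral>\<^sup>+s. ennreal (exp (- lam * st i s)) * \<psi> (st i s) \<partial>P) = (\<integral>\<^sup>+u. ennreal (f u) * \<psi> u \<partial>lborel)"
proof -
  have "(\<Sum>i\<in>I. \<integral>\<^sup>+s. ennreal (exp (- lam * st i s)) * \<psi> (st i s) \<partial>P)
      = (\<Sum>l<K. \<integral>\<^sup>+s. ennreal (exp (- lam * st (Suc l) s)) * \<psi> (st (Suc l) s) \<partial>P)"
    unfolding I_def by (rule sum.reindex_bij_witness[of _ Suc "\<lambda>i. i - 1"]) auto
  also have "\<dots> = (\<Sum>l<K. \<integral>\<^sup>+u. (ennreal (exp (- lam * u)) * \<psi> u) * (ennreal (w l) * p l u) \<partial>lborel)"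
  proof (intro sum.cong refl)
    fix l assume "l \<in> {..<K}"
    then show "(\<integral>\<^sup>+s. ennreal (exp (- lam * st (Suc l) s)) * \<psi> (st (Suc l) s) \<partial>P)
      = (\<integral>\<^sup>+u. (ennreal (exp (- lam * u)) * \<psi> u) * (ennreal (w l) * p l u) \<partial>lborel)"
      using nn_integral_st_Suc[of l "\<lambda>u. ennreal (exp (- lam * u)) * \<psi> u"] by simp
  qed
  also have "\<dots> = (\<integral>\<^sup>+u. (\<Sum>l<K. (ennreal (exp (- lam * u)) * \<psi> u) * (ennreal (w l) * p l u)) \<partial>lborel)"
    by (subst nn_integral_sum) auto
  also have "\<dots> = (\<integral>\<^sup>+u. ennreal (f u) * \<psi> u \<partial>lborel)"
    unfolding ennreal_f by (simp add: sum_distrib_left sum_distrib_right mult_ac)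
  finally show ?thesis .
qed

lemma laplace_st: "l \<le> K \<Longrightarrow> (\<integral>\<^sup>+s. ennreal (exp (- lam * st l s)) \<partial>P) = ennreal (\<Prod>i<l. w i / (lam + w i))"
proof (induction l)
  case 0
  then show ?case by (simp add: P.emeasure_space_1)
next
  case (Suc l)
  then have l: "l < K" by simp
  then have [measurable]: "st l \<in> borel_measurable P" by simp
  have "(\<integral>\<^sup>+s. ennreal (exp (- lam * st (Suc l) s)) \<partial>P)
      = (\<integral>\<^sup>+s. (\<lambda>(a, b). ennreal (exp (- lam * a)) * ennreal (exp (- lam * b))) (st l s, s [Suc l]) \<partial>P)"
    by (simp add: st_Suc ennreal_mult'[symmetric] exp_add[symmetric] algebra_simps)
  also have "\<dots> = (\<integral>\<^sup>+s. \<integral>\<^sup>+b. (\<lambda>(a, b). ennreal (exp (- lam * a)) * ennreal (exp (- lam * b))) (st l s, b)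
      \<partial>density lborel (exponential_density (w l)) \<partial>P)"
    by (rule stage_independent[OF l]) measurable
  also have "\<dots> = (\<integral>\<^sup>+s. ennreal (exp (- lam * st l s)) * ennreal (w l / (lam + w l)) \<partial>P)"
  proof (rule nn_integral_cong)
    fix s
    show "(\<integral>\<^sup>+b. (\<lambda>(a, b). ennreal (exp (- lam * a)) * ennreal (exp (- lam * b))) (st l s, b)
      \<partial>density lborel (exponential_density (w l))) = ennreal (exp (- lam * st l s)) * ennreal (w l / (lam + w l))"
      unfolding prod.case
      by (subst nn_integral_cmult, simp)
         (subst exponential_laplace, use w_pos[OF l] lam_pos in auto)
  qed
  also have "\<dots> = ennreal (\<Prod>i<l. w i / (lam + w i)) * ennreal (w l / (lam + w l))"
    by (subst nn_integral_multc) (use Suc in auto)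
  also have "\<dots> = ennreal (\<Prod>i<Suc l. w i / (lam + w i))"
    by (subst ennreal_mult'[symmetric]) (use l in \<open>auto intro!: prod_nonneg factor_nonneg\<close>)
  finally show ?case .
qed

text \<open>Here the characteristic equation enters: it gives \<open>f\<close> total mass
  one.\<close>

lemma laplace_sum: "(\<Sum>i\<in>I. \<integral>\<^sup>+s. ennreal (exp (- lam * st i s)) \<partial>P) = 1"
proof -
  have "(\<Sum>i\<in>I. \<integral>\<^sup>+s. ennreal (exp (- lam * st i s)) \<partial>P) = (\<Sum>i\<in>I. ennreal (\<Prod>j<i. w j / (lam + w j)))"
    by (intro sum.cong refl laplace_st) (simp add: I_iff)
  also have "\<dots> = ennreal (\<Sum>i\<in>I. \<Prod>j<i. w j / (lam + w j))"
    by (rule sum_ennreal) (auto intro!: prod_nonneg factor_nonneg simp: I_iff)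
  also have "(\<Sum>i\<in>I. \<Prod>j<i. w j / (lam + w j)) = 1"
    unfolding lam_def I_def by (rule malthus_root[OF K2 w_pos])
  finally show ?thesis by simp
qed

section \<open>The hazard bound for the intensity\<close>

definition wmin :: real where "wmin = Min (w ` {..<K})"

lemma wmin: "0 < wmin" "l < K \<Longrightarrow> wmin \<le> w l"
proof -
  have "wmin \<in> w ` {..<K}" unfolding wmin_def using K2 by (intro Min_in) (auto simp: lessThan_empty_iff)
  then show "0 < wmin" using w_pos by auto
  show "wmin \<le> w l" if "l < K" using that by (auto simp: wmin_def)
qed

text \<open>A child born after \<open>u\<close> is discounted by at most
  \<open>exp (- lam * u)\<close>, and its late birth forces the last child to be born after
  \<open>u\<close> too. So the tail is at most \<open>K * exp (- lam * u)\<close> times the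
  probability that fewer than \<open>K\<close> children exist at time \<open>u\<close>, and on that
  event the next birth has rate at least \<open>wmin\<close>. This is the origin of
  \<open>wmin / K\<close>.\<close>

lemma hazard_rate:
  assumes u: "0 \<le> u"
  shows "ennreal (wmin / real K) * (\<integral>\<^sup>+v. ennreal (f v) * indicator {0<..} (v - u) \<partial>lborel) \<le> ennreal (f u)"
proof -
  have [measurable]: "st i \<in> borel_measurable P" if "i \<in> I" for i using that by (simp add: I_iff)
  have [measurable]: "st K \<in> borel_measurable P" by simp
  have "(\<integral>\<^sup>+v. ennreal (f v) * indicator {0<..} (v - u) \<partial>lborel)
      = (\<Sum>i\<in>I. \<integral>\<^sup>+s. ennreal (exp (- lam * st i s)) * indicator {0<..} (st i s - u) \<partial>P)"
    by (rule first_moment[symmetric]) measurable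
  also have "\<dots> \<le> (\<Sum>i\<in>I. \<integral>\<^sup>+s. ennreal (exp (- lam * u)) * indicator {0<..} (st K s - u) \<partial>P)"
  proof (intro sum_mono nn_integral_mono_AE)
    fix i assume i: "i \<in> I"
    show "AE s in P. ennreal (exp (- lam * st i s)) * indicator {0<..} (st i s - u)
        \<le> ennreal (exp (- lam * u)) * indicator {0<..} (st K s - u)"
      using AE_nonneg
    proof eventually_elim
      case (elim s)
      have "st i s \<le> st K s" using elim i by (intro nonneg_st_mono) (auto simp: I_iff)
      moreover have "exp (- lam * st i s) \<le> exp (- lam * u)" if "u < st i s"
        using that lam_pos by (simp add: mult_left_mono less_imp_le)
      ultimately show ?case by (auto simp: indicator_def intro!: ennreal_leI)
    qed
  qed
  also have "\<dots> = of_nat K * (ennreal (exp (- lam * u)) * (\<integral>\<^sup>+s. indicator {0<..} (st K s - u) \<partial>P))"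
    by (simp add: nn_integral_cmult) (simp add: I_def)
  also have "(\<integral>\<^sup>+s. indicator {0<..} (st K s - u) \<partial>P) \<le> (\<integral>\<^sup>+s. (\<Sum>l<K. indicator {0..} (u - st l s) * indicator {0<..} (st (Suc l) s - u)) \<partial>P)"
  proof (rule nn_integral_mono)
    fix s
    show "indicator {0<..} (st K s - u) \<le> (\<Sum>l<K. indicator {0..} (u - st l s) * indicator {0<..} (st (Suc l) s - u) :: ennreal)"
    proof (cases "u < st K s")
      case True
      \<comment> \<open>The first child born after \<open>u\<close>; it is not \<open>0\<close>, as
        \<open>st 0 s = 0 \<le> u\<close>, so stage \<open>n - 1\<close> is the one in force at time
        \<open>u\<close>.\<close>
      define n where "n = (LEAST n. u < st n s)"
      have n: "u < st n s" unfolding n_def by (rule LeastI[of "\<lambda>n. u < st n s", OF True])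
      have nK: "n \<le> K" unfolding n_def by (rule Least_le[of "\<lambda>n. u < st n s", OF True])
      have n0: "n \<noteq> 0" using n u by (cases n) auto
      then obtain l where l: "n = Suc l" by (cases n) auto
      have "\<not> u < st l s" using not_less_Least[of l "\<lambda>n. u < st n s"] l unfolding n_def[symmetric] by simp
      then have "(1::ennreal) \<le> indicator {0..} (u - st l s) * indicator {0<..} (st (Suc l) s - u)"
        using n l by simp
      also have "\<dots> \<le> (\<Sum>l<K. indicator {0..} (u - st l s) * indicator {0<..} (st (Suc l) s - u))"
        by (rule member_le_sum[of l "{..<K}" "\<lambda>l. indicator {0..} (u - st l s) * indicator {0<..} (st (Suc l) s - u)"]) (use l nK in auto)
      finally show ?thesis using True by simp
    qed simp
  qed
  also have "\<dots> = (\<Sum>l<K. p l u)"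
    by (subst nn_integral_sum) (auto simp: p_eq)
  finally have "(\<integral>\<^sup>+v. ennreal (f v) * indicator {0<..} (v - u) \<partial>lborel)
      \<le> of_nat K * (ennreal (exp (- lam * u)) * (\<Sum>l<K. p l u))"
    by (simp add: mult_left_mono)
  then have "ennreal (wmin / real K) * (\<integral>\<^sup>+v. ennreal (f v) * indicator {0<..} (v - u) \<partial>lborel)
      \<le> ennreal (wmin / real K) * (of_nat K * (ennreal (exp (- lam * u)) * (\<Sum>l<K. p l u)))"
    by (rule mult_left_mono) simp
  also have "\<dots> = (ennreal (wmin / real K) * of_nat K) * (ennreal (exp (- lam * u)) * (\<Sum>l<K. p l u))"
    by (simp only: mult.assoc)
  also have "ennreal (wmin / real K) * of_nat K = ennreal wmin"
    using K2 wmin by (simp add: ennreal_of_nat_eq_real_of_nat ennreal_mult'[symmetric])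
  also have "ennreal wmin * (ennreal (exp (- lam * u)) * (\<Sum>l<K. p l u)) = ennreal (exp (- lam * u)) * (\<Sum>l<K. ennreal wmin * p l u)"
    by (simp add: sum_distrib_left mult_ac)
  also have "\<dots> \<le> ennreal (f u)"
    unfolding ennreal_f by (intro mult_left_mono sum_mono mult_right_mono ennreal_leI wmin) auto
  finally show ?thesis .
qed

sublocale renewal_density f lam "wmin / real K" "\<Sum>l<K. w l"
proof
  show "f \<in> borel_measurable borel"
    unfolding f_def[abs_def] by measurable
  show "0 \<le> f u" for u
    unfolding f_def by (auto intro!: sum_nonneg mult_nonneg_nonneg w_nonneg)
  show "f u = 0" if "u < 0" for u using that by (simp add: f_def)
  show "(\<integral>\<^sup>+u. ennreal (f u) \<partial>lborel) = 1"
    using first_moment[of "\<lambda>_. 1"] laplace_sum by simp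
  show "0 < lam" by (rule lam_pos)
  show "0 < wmin / real K" using wmin K2 by simp
  show "f u \<le> (\<Sum>l<K. w l) * exp (- lam * u)" if "0 \<le> u" for u
  proof -
    \<comment> \<open>That \<open>p l u\<close> is a probability gives the constant
      \<open>\<Sum>l<K. w l\<close>.\<close>
    have "enn2real (p l u) \<le> 1" if "l < K" for l using p_le_1[OF that] by (simp add: enn2real_leI)
    then have "(\<Sum>l<K. w l * enn2real (p l u)) \<le> (\<Sum>l<K. w l)"
      using w_pos by (intro sum_mono) (auto intro: mult_left_le less_imp_le)
    then show ?thesis using that by (simp add: f_def mult.commute)
  qed
qed (rule hazard_rate)

end

subsection \<open>Second moments\<close>

text \<open>The missing mass is the integral of \<open>f u * (1 - exp (- c * u))\<close>, whose
  integrand is positive wherever \<open>f\<close> is, except at the single point \<open>0\<close>.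
  For \<open>c = lam\<close> this is the contraction factor of the second moments.\<close>

lemma (in renewal_density) exponential_moment_less_1:
  assumes c: "0 < c"
  shows "(\<integral>\<^sup>+u. ennreal (f u) * ennreal (exp (- c * u)) \<partial>lborel) < 1"
proof (rule ccontr)
  define R where "R = (\<integral>\<^sup>+u. ennreal (f u) * ennreal (exp (- c * u)) \<partial>lborel)"
  define R' where "R' = (\<integral>\<^sup>+u. ennreal (f u * (1 - exp (- c * u))) \<partial>lborel)"
  have nn: "0 \<le> f u * (1 - exp (- c * u))" for u
    using c f_nonneg[of u] f_neg[of u] by (cases "u < 0") auto
  have "R + R' = (\<integral>\<^sup>+u. ennreal (f u) * ennreal (exp (- c * u)) + ennreal (f u * (1 - exp (- c * u))) \<partial>lborel)"
    unfolding R_def R'_def by (subst nn_integral_add) auto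
  also have "\<dots> = (\<integral>\<^sup>+u. ennreal (f u) \<partial>lborel)"
  proof (rule nn_integral_cong)
    fix u
    have "ennreal (f u) * ennreal (exp (- c * u)) + ennreal (f u * (1 - exp (- c * u)))
      = ennreal (f u * exp (- c * u) + f u * (1 - exp (- c * u)))"
      using nn[of u] f_nonneg[of u] by (simp add: ennreal_mult' ennreal_plus)
    then show "ennreal (f u) * ennreal (exp (- c * u)) + ennreal (f u * (1 - exp (- c * u))) = ennreal (f u)"
      by (simp add: algebra_simps)
  qed
  finally have RR: "R + R' = 1" by (simp add: f_total)
  assume "\<not> ?thesis"
  then have "1 \<le> R" by (simp add: R_def)
  then have "1 + R' \<le> 1 + 0" using RR by (metis add.right_neutral add_right_mono)
  then have "R' = 0" using ennreal_add_left_cancel_le[of 1 R' 0] by simp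
  then have "AE u in lborel. ennreal (f u * (1 - exp (- c * u))) = 0"
    unfolding R'_def by (subst (asm) nn_integral_0_iff_AE) auto
  moreover have "AE u in lborel. u \<noteq> (0::real)" by (rule AE_lborel_singleton)
  ultimately have "AE u in lborel. ennreal (f u) = 0"
  proof eventually_elim
    case (elim u)
    then have "f u * (1 - exp (- c * u)) = 0" using nn[of u] by simp
    then show ?case using elim(2) c by simp
  qed
  then have "(\<integral>\<^sup>+u. ennreal (f u) \<partial>lborel) = (\<integral>\<^sup>+(u::real). 0 \<partial>lborel)"
    by (rule nn_integral_cong_AE)
  then show False using f_total by simp
qed

text \<open>Squared mean plus variance, with the variance bounded by the second moment so that the
  estimate can be iterated.\<close>

lemma (in prob_space) nn_integral_square_add_le:
  fixes g :: "'a \<Rightarrow> real"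
  assumes [measurable]: "g \<in> borel_measurable M"
    and fin: "(\<integral>\<^sup>+x. ennreal ((g x)\<^sup>2) \<partial>M) < \<top>"
  shows "(\<integral>\<^sup>+x. ennreal ((b + g x)\<^sup>2) \<partial>M) \<le> ennreal ((b + expectation g)\<^sup>2) + (\<integral>\<^sup>+x. ennreal ((g x)\<^sup>2) \<partial>M)"
proof -
  have i2: "integrable M (\<lambda>x. (g x)\<^sup>2)" using fin by (intro integrableI_nonneg) auto
  then have i1: "integrable M g" by (rule square_integrable_imp_integrable[rotated]) simp
  have sq: "(b + g x)\<^sup>2 = b\<^sup>2 + 2 * b * g x + (g x)\<^sup>2" for x by (simp add: power2_eq_square algebra_simps)
  have "integrable M (\<lambda>x. (b + g x)\<^sup>2)" unfolding sq using i1 i2 by simp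
  then have "(\<integral>\<^sup>+x. ennreal ((b + g x)\<^sup>2) \<partial>M) = ennreal (expectation (\<lambda>x. (b + g x)\<^sup>2))"
    by (intro nn_integral_eq_integral) auto
  also have "expectation (\<lambda>x. (b + g x)\<^sup>2) = b\<^sup>2 + 2 * b * expectation g + expectation (\<lambda>x. (g x)\<^sup>2)"
    unfolding sq using i1 i2 by (simp add: prob_space)
  also have "\<dots> \<le> (b + expectation g)\<^sup>2 + expectation (\<lambda>x. (g x)\<^sup>2)"
    by (simp add: power2_eq_square algebra_simps)
  also have "ennreal \<dots> = ennreal ((b + expectation g)\<^sup>2) + ennreal (expectation (\<lambda>x. (g x)\<^sup>2))"
    by (intro ennreal_plus) auto
  also have "ennreal (expectation (\<lambda>x. (g x)\<^sup>2)) = (\<integral>\<^sup>+x. ennreal ((g x)\<^sup>2) \<partial>M)"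
    using i2 by (intro nn_integral_eq_integral[symmetric]) auto
  finally show ?thesis by (simp add: ennreal_leI)
qed

text \<open>Integrating one coordinate at a time moves its mean into the constant, which is why
  \<open>a\<close> is arbitrary in the induction.\<close>

lemma (in prob_space) nn_integral_PiM_square_sum_le:
  fixes g :: "'i \<Rightarrow> 'a \<Rightarrow> real"
  assumes "finite A"
    and meas: "\<And>i. i \<in> A \<Longrightarrow> g i \<in> borel_measurable M"
    and fin: "\<And>i. i \<in> A \<Longrightarrow> (\<integral>\<^sup>+x. ennreal ((g i x)\<^sup>2) \<partial>M) < \<top>"
  shows "(\<integral>\<^sup>+x. ennreal ((a + (\<Sum>i\<in>A. g i (x i)))\<^sup>2) \<partial>PiM A (\<lambda>_. M))
    \<le> ennreal ((a + (\<Sum>i\<in>A. expectation (g i)))\<^sup>2) + (\<Sum>i\<in>A. \<integral>\<^sup>+x. ennreal ((g i x)\<^sup>2) \<partial>M)"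
  using assms
proof (induction A arbitrary: a)
  case empty
  interpret E: prob_space "PiM {} (\<lambda>_::'i. M)" by (rule prob_space_PiM) (rule prob_space_axioms)
  show ?case by (simp add: E.emeasure_space_1)
next
  case (insert i A)
  interpret product_sigma_finite "\<lambda>_::'i. M" by unfold_locales
  interpret A: prob_space "PiM A (\<lambda>_. M)" by (rule prob_space_PiM) (rule prob_space_axioms)
  have [measurable]: "g j \<in> borel_measurable M" if "j \<in> insert i A" for j using insert.prems that by auto
  have "(\<integral>\<^sup>+x. ennreal ((a + (\<Sum>j\<in>insert i A. g j (x j)))\<^sup>2) \<partial>PiM (insert i A) (\<lambda>_. M))
    = (\<integral>\<^sup>+x. \<integral>\<^sup>+y. ennreal ((a + (\<Sum>j\<in>insert i A. g j ((x(i := y)) j)))\<^sup>2) \<partial>M \<partial>PiM A (\<lambda>_. M))"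
    by (rule product_nn_integral_insert) (use insert.hyps in \<open>auto intro!: borel_measurable_sum\<close>)
  also have "\<dots> = (\<integral>\<^sup>+x. \<integral>\<^sup>+y. ennreal (((a + (\<Sum>j\<in>A. g j (x j))) + g i y)\<^sup>2) \<partial>M \<partial>PiM A (\<lambda>_. M))"
  proof (intro nn_integral_cong)
    fix x y
    have "(\<Sum>j\<in>insert i A. g j ((x(i := y)) j)) = g i y + (\<Sum>j\<in>A. g j (x j))"
      using insert.hyps by (auto intro!: sum.cong)
    then show "ennreal ((a + (\<Sum>j\<in>insert i A. g j ((x(i := y)) j)))\<^sup>2) = ennreal (((a + (\<Sum>j\<in>A. g j (x j))) + g i y)\<^sup>2)"
      by (simp add: add_ac)
  qed
  also have "\<dots> \<le> (\<integral>\<^sup>+x. ennreal (((a + expectation (g i)) + (\<Sum>j\<in>A. g j (x j)))\<^sup>2)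
      + (\<integral>\<^sup>+y. ennreal ((g i y)\<^sup>2) \<partial>M) \<partial>PiM A (\<lambda>_. M))"
  proof (rule nn_integral_mono)
    fix x
    show "(\<integral>\<^sup>+y. ennreal (((a + (\<Sum>j\<in>A. g j (x j))) + g i y)\<^sup>2) \<partial>M)
      \<le> ennreal (((a + expectation (g i)) + (\<Sum>j\<in>A. g j (x j)))\<^sup>2) + (\<integral>\<^sup>+y. ennreal ((g i y)\<^sup>2) \<partial>M)"
      using nn_integral_square_add_le[of "g i" "a + (\<Sum>j\<in>A. g j (x j))"] insert.prems by (simp add: add_ac)
  qed
  also have "\<dots> = (\<integral>\<^sup>+x. ennreal (((a + expectation (g i)) + (\<Sum>j\<in>A. g j (x j)))\<^sup>2) \<partial>PiM A (\<lambda>_. M))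
      + (\<integral>\<^sup>+y. ennreal ((g i y)\<^sup>2) \<partial>M)"
    by (subst nn_integral_add) (auto simp: A.emeasure_space_1 intro!: borel_measurable_sum)
  also have "\<dots> \<le> (ennreal (((a + expectation (g i)) + (\<Sum>j\<in>A. expectation (g j)))\<^sup>2) + (\<Sum>j\<in>A. \<integral>\<^sup>+x. ennreal ((g j x)\<^sup>2) \<partial>M))
      + (\<integral>\<^sup>+y. ennreal ((g i y)\<^sup>2) \<partial>M)"
    by (intro add_right_mono insert.IH) (use insert.prems in auto)
  finally show ?case using insert.hyps by (simp add: add_ac)
qed

context weighted_tree begin

text \<open>Conditionally on the births of the children of the root, the summands are independent; their
  means contribute the first term and their variances are bounded by second moments.\<close>

lemma square_recursion:
  fixes \<phi> :: "real \<Rightarrow> (nat list \<Rightarrow> real) \<Rightarrow> real" and M M' e a t :: real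
  assumes \<phi>: "(\<lambda>z. \<phi> (fst z) (snd z)) \<in> borel_measurable (borel \<Otimes>\<^sub>M P)"
    and fin: "\<And>t. (\<integral>\<^sup>+s. ennreal ((\<phi> t s)\<^sup>2) \<partial>P) < \<top>"
    and mean: "\<And>t. \<bar>P.expectation (\<phi> t)\<bar> \<le> M * exp (- e * t)"
    and a: "\<bar>a\<bar> \<le> M' * exp (- e * t)" and e: "0 \<le> e" "e \<le> lam" and M: "0 \<le> M"
  shows "(\<integral>\<^sup>+s. ennreal ((a + (\<Sum>i\<in>I. exp (- lam * st i s) * \<phi> (t - st i s) (shift i s)))\<^sup>2) \<partial>P)
    \<le> ennreal ((M' + K * M)\<^sup>2 * exp (- (2 * e) * t))
      + (\<integral>\<^sup>+u. (ennreal (f u) * ennreal (exp (- lam * u))) * (\<integral>\<^sup>+s. ennreal ((\<phi> (t - u) s)\<^sup>2) \<partial>P) \<partial>lborel)"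
proof -
  have sec [measurable]: "\<phi> u \<in> borel_measurable P" for u
    using measurable_compose[OF measurable_Pair1'[of u borel P] \<phi>] by simp
  define Q where "Q u = (\<integral>\<^sup>+s. ennreal ((\<phi> u s)\<^sup>2) \<partial>P)" for u
  have Q_meas [measurable]: "Q \<in> borel_measurable borel"
    unfolding Q_def[abs_def]
    by (rule P.borel_measurable_nn_integral) (use \<phi> in \<open>simp add: case_prod_beta\<close>)
  define T where "T i r = (\<Sum>j=1..i. r j)" for i and r :: "nat \<Rightarrow> real"
  have T: "T i (rt s) = st i s" if "i \<in> I" for i s
    unfolding T_def st_def rt_def using that by (intro sum.cong) (auto simp: I_iff)
  have T_meas [measurable]: "T i \<in> borel_measurable (PiM I (\<lambda>_. borel))" if "i \<in> I" for i
    unfolding T_def[abs_def] by (intro borel_measurable_sum measurable_component_singleton) (use that in \<open>auto simp: I_iff\<close>)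
  have c_meas [measurable]: "(\<lambda>ss. ss i) \<in> measurable PI P" if "i \<in> I" for i
    unfolding PI_def by (rule measurable_component_singleton[OF that])
  have st_meas' [measurable]: "st i \<in> borel_measurable P" if "i \<in> I" for i using that by (simp add: I_iff)
  define F where "F z = ennreal ((a + (\<Sum>i\<in>I. exp (- lam * T i (fst z)) * \<phi> (t - T i (fst z)) (snd z i)))\<^sup>2)"
    for z :: "(nat \<Rightarrow> real) \<times> (nat \<Rightarrow> nat list \<Rightarrow> real)"
  have [measurable]: "(\<lambda>z. \<phi> (t - T i (fst z)) (snd z i)) \<in> borel_measurable (PiM I (\<lambda>_. borel) \<Otimes>\<^sub>M PI)"
    if [measurable]: "i \<in> I" for i
  proof -
    have "(\<lambda>z. (t - T i (fst z), snd z i)) \<in> measurable (PiM I (\<lambda>_. borel) \<Otimes>\<^sub>M PI) (borel \<Otimes>\<^sub>M P)"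
      by measurable
    from measurable_compose[OF this \<phi>] show ?thesis by simp
  qed
  have F_meas: "F \<in> borel_measurable (PiM I (\<lambda>_. borel) \<Otimes>\<^sub>M PI)"
    unfolding F_def[abs_def] by measurable
  \<comment> \<open>Of the two discount factors, \<open>first_moment\<close> absorbs one into
    \<open>f\<close>; the other stays in the kernel and makes it contract.\<close>
  define S where "S s = (\<Sum>i\<in>I. ennreal (exp (- lam * st i s)) * (ennreal (exp (- lam * st i s)) * Q (t - st i s)))" for s
  define c where "c = ennreal ((M' + K * M)\<^sup>2 * exp (- (2 * e) * t))"
  have S_meas [measurable]: "S \<in> borel_measurable P" unfolding S_def[abs_def] by measurable
  have F_rt: "F (rt s, shifts s) = ennreal ((a + (\<Sum>i\<in>I. exp (- lam * st i s) * \<phi> (t - st i s) (shift i s)))\<^sup>2)" for s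
    unfolding F_def fst_conv snd_conv by (intro arg_cong[where f = ennreal]) (simp add: T shifts_def)
  have bound: "(\<integral>\<^sup>+s. \<integral>\<^sup>+ss. F (rt s, ss) \<partial>PI \<partial>P) \<le> (\<integral>\<^sup>+s. c + S s \<partial>P)"
  proof (rule nn_integral_mono_AE)
    show "AE s in P. (\<integral>\<^sup>+ss. F (rt s, ss) \<partial>PI) \<le> c + S s"
      using AE_nonneg
    proof eventually_elim
      case (elim s)
      define g where "g i s' = exp (- lam * st i s) * \<phi> (t - st i s) s'" for i s'
      have g_meas [measurable]: "g i \<in> borel_measurable P" for i unfolding g_def[abs_def] by measurable
      have g2: "(\<integral>\<^sup>+s'. ennreal ((g i s')\<^sup>2) \<partial>P)
          = ennreal (exp (- lam * st i s)) * (ennreal (exp (- lam * st i s)) * Q (t - st i s))" for i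
      proof -
        have "ennreal ((g i s')\<^sup>2) = (ennreal (exp (- lam * st i s)) * ennreal (exp (- lam * st i s))) * ennreal ((\<phi> (t - st i s) s')\<^sup>2)" for s'
        proof -
          have "(g i s')\<^sup>2 = (exp (- lam * st i s) * exp (- lam * st i s)) * (\<phi> (t - st i s) s')\<^sup>2"
            by (simp add: g_def power_mult_distrib power2_eq_square)
          then show ?thesis by (simp only: ennreal_mult' exp_ge_zero mult_nonneg_nonneg)
        qed
        then show ?thesis unfolding Q_def by (simp add: nn_integral_cmult mult.assoc)
      qed
      have le1: "(\<integral>\<^sup>+ss. F (rt s, ss) \<partial>PI) = (\<integral>\<^sup>+ss. ennreal ((a + (\<Sum>i\<in>I. g i (ss i)))\<^sup>2) \<partial>PiM I (\<lambda>_. P))"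
        unfolding F_def fst_conv snd_conv PI_def g_def
        by (intro nn_integral_cong arg_cong[where f = ennreal]) (simp add: T)
      have le2: "(\<integral>\<^sup>+ss. ennreal ((a + (\<Sum>i\<in>I. g i (ss i)))\<^sup>2) \<partial>PiM I (\<lambda>_. P))
        \<le> ennreal ((a + (\<Sum>i\<in>I. P.expectation (g i)))\<^sup>2) + (\<Sum>i\<in>I. \<integral>\<^sup>+s'. ennreal ((g i s')\<^sup>2) \<partial>P)"
      proof (rule P.nn_integral_PiM_square_sum_le[where g = g])
        show "(\<integral>\<^sup>+s'. ennreal ((g i s')\<^sup>2) \<partial>P) < \<top>" for i
          unfolding g2 Q_def using fin[of "t - st i s"] by (simp only: ennreal_mult_less_top) simp
      qed (rule finite_I g_meas)+
      have le3: "ennreal ((a + (\<Sum>i\<in>I. P.expectation (g i)))\<^sup>2) \<le> ennreal ((M' + K * M)\<^sup>2 * exp (- (2 * e) * t))"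
      proof (rule ennreal_leI)
        have "\<bar>P.expectation (g i)\<bar> \<le> M * exp (- e * t)" if i: "i \<in> I" for i
        proof -
          have st: "0 \<le> st i s" using elim i by (intro nonneg_st) (auto simp: I_iff)
          have "\<bar>P.expectation (g i)\<bar> = exp (- lam * st i s) * \<bar>P.expectation (\<phi> (t - st i s))\<bar>"
            unfolding g_def by (simp add: abs_mult)
          also have "\<dots> \<le> exp (- lam * st i s) * (M * exp (- e * (t - st i s)))"
            by (intro mult_left_mono mean) simp
          also have "\<dots> = M * exp (- e * t) * exp (- (lam - e) * st i s)"
            by (simp add: exp_add[symmetric] exp_diff[symmetric] algebra_simps)
          \<comment> \<open>The delay \<open>st i s\<close> worsens the bound on the mean by
            \<open>exp (e * st i s)\<close>, which the discount outweighs because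
            \<open>e \<le> lam\<close>.\<close>
          also have "\<dots> \<le> M * exp (- e * t) * 1"
          proof (rule mult_left_mono)
            have "0 \<le> (lam - e) * st i s" using e st by (intro mult_nonneg_nonneg) auto
            then show "exp (- (lam - e) * st i s) \<le> 1" by (simp add: minus_mult_left[symmetric] del: minus_diff_eq)
          qed (use M in simp)
          finally show ?thesis by simp
        qed
        then have "\<bar>\<Sum>i\<in>I. P.expectation (g i)\<bar> \<le> (\<Sum>i\<in>I. M * exp (- e * t))"
          by (intro order_trans[OF sum_abs] sum_mono) auto
        also have "\<dots> = K * M * exp (- e * t)" by (simp add: I_def)
        finally have "\<bar>a + (\<Sum>i\<in>I. P.expectation (g i))\<bar> \<le> (M' + K * M) * exp (- e * t)"
          using a by (simp add: algebra_simps)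
        then have "(a + (\<Sum>i\<in>I. P.expectation (g i)))\<^sup>2 \<le> ((M' + K * M) * exp (- e * t))\<^sup>2"
          by (rule order_trans[OF eq_refl[OF power2_abs[symmetric]] power_mono]) simp
        also have "\<dots> = (M' + K * M)\<^sup>2 * exp (- (2 * e) * t)"
          by (simp add: power_mult_distrib power2_eq_square exp_add[symmetric] algebra_simps)
        finally show "(a + (\<Sum>i\<in>I. P.expectation (g i)))\<^sup>2 \<le> (M' + K * M)\<^sup>2 * exp (- (2 * e) * t)" .
      qed
      show ?case
        unfolding le1 c_def S_def using order_trans[OF le2 add_right_mono[OF le3]] unfolding g2 .
    qed
  qed
  have "(\<integral>\<^sup>+s. S s \<partial>P) = (\<Sum>i\<in>I. \<integral>\<^sup>+s. ennreal (exp (- lam * st i s)) * (ennreal (exp (- lam * st i s)) * Q (t - st i s)) \<partial>P)"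
    unfolding S_def by (rule nn_integral_sum) measurable
  moreover have "\<dots> = (\<integral>\<^sup>+u. ennreal (f u) * (ennreal (exp (- lam * u)) * Q (t - u)) \<partial>lborel)"
    by (rule first_moment) measurable
  ultimately have S_int: "(\<integral>\<^sup>+s. S s \<partial>P) = (\<integral>\<^sup>+u. (ennreal (f u) * ennreal (exp (- lam * u))) * Q (t - u) \<partial>lborel)"
    by (simp only: mult.assoc)
  have "(\<integral>\<^sup>+s. c + S s \<partial>P) = c + (\<integral>\<^sup>+s. S s \<partial>P)"
    by (subst nn_integral_add) (simp_all add: P.emeasure_space_1)
  then show ?thesis
    using bound unfolding root_decomposition[OF F_meas, symmetric] F_rt S_int Q_def c_def by (rule subst)
qed

end

subsection \<open>The normalised tree size\<close>

lemma nn_integral_limit_le: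
  fixes g :: "nat \<Rightarrow> 'a \<Rightarrow> ennreal"
  assumes [measurable]: "\<And>n. g n \<in> borel_measurable M"
    and lim: "AE x in M. (\<lambda>n. g n x) \<longlonglongrightarrow> h x" and le: "\<And>n. (\<integral>\<^sup>+x. g n x \<partial>M) \<le> C"
  shows "(\<integral>\<^sup>+x. h x \<partial>M) \<le> C"
proof -
  have "(\<integral>\<^sup>+x. h x \<partial>M) = (\<integral>\<^sup>+x. liminf (\<lambda>n. g n x) \<partial>M)"
    by (rule nn_integral_cong_AE) (use lim in eventually_elim, simp add: lim_imp_Liminf)
  also have "\<dots> \<le> liminf (\<lambda>n. \<integral>\<^sup>+x. g n x \<partial>M)" by (rule nn_integral_liminf) simp
  also have "\<dots> \<le> liminf (\<lambda>n. C)" by (rule Liminf_mono) (simp add: le)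
  also have "\<dots> = C" by (simp add: Liminf_const)
  finally show ?thesis .
qed

text \<open>Takes the place of Cauchy-Schwarz:
  \<open>\<bar>x\<bar> \<le> \<eta> / 2 + x\<^sup>2 / (2 * \<eta>)\<close>, with
  \<open>\<eta>\<close> at the scale of the root mean square.\<close>

lemma (in prob_space) nn_integral_abs_le:
  fixes g :: "'a \<Rightarrow> real"
  assumes [measurable]: "g \<in> borel_measurable M"
    and sq: "(\<integral>\<^sup>+x. ennreal ((g x)\<^sup>2) \<partial>M) \<le> ennreal (C * \<eta>\<^sup>2)" and \<eta>: "0 < \<eta>" and C: "0 \<le> C"
  shows "(\<integral>\<^sup>+x. ennreal \<bar>g x\<bar> \<partial>M) \<le> ennreal ((1 + C) / 2 * \<eta>)"
proof -
  have "\<bar>x\<bar> \<le> \<eta> / 2 + 1 / (2 * \<eta>) * x\<^sup>2" for x :: real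
  proof -
    have "0 \<le> (\<bar>x\<bar> - \<eta>)\<^sup>2" by simp
    then have "2 * \<eta> * \<bar>x\<bar> \<le> \<eta>\<^sup>2 + x\<^sup>2" by (simp add: power2_diff algebra_simps)
    then have "\<bar>x\<bar> \<le> (\<eta>\<^sup>2 + x\<^sup>2) / (2 * \<eta>)" using \<eta> by (simp add: pos_le_divide_eq mult.commute)
    then show ?thesis using \<eta> by (simp add: add_divide_distrib power2_eq_square)
  qed
  then have "(\<integral>\<^sup>+x. ennreal \<bar>g x\<bar> \<partial>M) \<le> (\<integral>\<^sup>+x. ennreal (\<eta> / 2) + ennreal (1 / (2 * \<eta>)) * ennreal ((g x)\<^sup>2) \<partial>M)"
    using \<eta> by (intro nn_integral_mono) (simp add: ennreal_mult'[symmetric] ennreal_plus[symmetric] ennreal_leI del: ennreal_plus)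
  also have "\<dots> = ennreal (\<eta> / 2) + ennreal (1 / (2 * \<eta>)) * (\<integral>\<^sup>+x. ennreal ((g x)\<^sup>2) \<partial>M)"
    by (subst nn_integral_add) (auto simp: nn_integral_cmult emeasure_space_1)
  also have "\<dots> \<le> ennreal (\<eta> / 2) + ennreal (1 / (2 * \<eta>)) * ennreal (C * \<eta>\<^sup>2)"
    by (intro add_left_mono mult_left_mono sq) simp
  also have "\<dots> = ennreal (\<eta> / 2 + 1 / (2 * \<eta>) * (C * \<eta>\<^sup>2))"
    using \<eta> C by (simp add: ennreal_mult'[symmetric] ennreal_plus[symmetric] del: ennreal_plus)
  also have "\<eta> / 2 + 1 / (2 * \<eta>) * (C * \<eta>\<^sup>2) = (1 + C) / 2 * \<eta>"
    using \<eta> by (simp add: power2_eq_square field_simps)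
  finally show ?thesis .
qed

context weighted_tree begin

lemma comp_meas:
  assumes "(\<lambda>z. \<phi> (fst z) (snd z)) \<in> measurable (borel \<Otimes>\<^sub>M P) N" and i: "i \<in> I"
  shows "(\<lambda>z. \<phi> (fst z - st i (snd z)) (shift i (snd z))) \<in> measurable (borel \<Otimes>\<^sub>M P) N"
proof -
  have [measurable]: "st i \<in> borel_measurable P" "shift i \<in> measurable P P" using i by (auto simp: I_iff)
  have "(\<lambda>z. (fst z - st i (snd z), shift i (snd z))) \<in> measurable (borel \<Otimes>\<^sub>M P) (borel \<Otimes>\<^sub>M P)"
    by measurable
  from measurable_compose[OF this assms(1)] show ?thesis by simp
qed

lemma sec_meas:
  assumes "(\<lambda>z. \<phi> (fst z) (snd z)) \<in> measurable (borel \<Otimes>\<^sub>M P) N"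
  shows "\<phi> t \<in> measurable P N"
  using measurable_compose[OF measurable_Pair1'[of t borel P] assms] by simp

text \<open>The branching property integrates out each subtree, then \<open>first_moment\<close> the
  birth times. Values in \<open>ennreal\<close> allow this before any moment is known to be
  finite.\<close>

lemma mean_recursion:
  fixes \<phi> :: "real \<Rightarrow> (nat list \<Rightarrow> real) \<Rightarrow> ennreal"
  assumes \<phi>: "(\<lambda>z. \<phi> (fst z) (snd z)) \<in> borel_measurable (borel \<Otimes>\<^sub>M P)"
  shows "(\<integral>\<^sup>+s. c + (\<Sum>i\<in>I. ennreal (exp (- lam * st i s)) * \<phi> (t - st i s) (shift i s)) \<partial>P)
    = c + (\<integral>\<^sup>+u. ennreal (f u) * (\<integral>\<^sup>+s. \<phi> (t - u) s \<partial>P) \<partial>lborel)"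
proof -
  define Q where "Q u = (\<integral>\<^sup>+s. \<phi> u s \<partial>P)" for u
  have Q_meas [measurable]: "Q \<in> borel_measurable borel"
    unfolding Q_def[abs_def]
    by (rule P.borel_measurable_nn_integral) (use \<phi> in \<open>simp add: case_prod_beta\<close>)
  have [measurable]: "st i \<in> borel_measurable P" if "i \<in> I" for i using that by (simp add: I_iff)
  have [measurable]: "(\<lambda>s. \<phi> (t - st i s) (shift i s)) \<in> borel_measurable P" if "i \<in> I" for i
    using sec_meas[OF comp_meas[OF \<phi> that]] by simp
  have step: "(\<integral>\<^sup>+s. ennreal (exp (- lam * st i s)) * \<phi> (t - st i s) (shift i s) \<partial>P)
      = (\<integral>\<^sup>+s. ennreal (exp (- lam * st i s)) * Q (t - st i s) \<partial>P)" if i: "i \<in> I" for i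
  proof -
    define G where "G z = ennreal (exp (- lam * fst z)) * \<phi> (t - fst z) (snd z)" for z
    have 1: "(\<lambda>z. (t - fst z, snd z)) \<in> measurable (borel \<Otimes>\<^sub>M P) (borel \<Otimes>\<^sub>M P)" by measurable
    have [measurable]: "(\<lambda>z. \<phi> (t - fst z) (snd z)) \<in> borel_measurable (borel \<Otimes>\<^sub>M P)"
      using measurable_compose[OF 1 \<phi>] by simp
    have "G \<in> borel_measurable (borel \<Otimes>\<^sub>M P)" unfolding G_def[abs_def] by measurable
    from root_decomposition_single[OF i this]
    have "(\<integral>\<^sup>+s. ennreal (exp (- lam * st i s)) * \<phi> (t - st i s) (shift i s) \<partial>P)
      = (\<integral>\<^sup>+s. \<integral>\<^sup>+s'. ennreal (exp (- lam * st i s)) * \<phi> (t - st i s) s' \<partial>P \<partial>P)"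
      by (simp only: G_def fst_conv snd_conv)
    also have "\<dots> = (\<integral>\<^sup>+s. ennreal (exp (- lam * st i s)) * Q (t - st i s) \<partial>P)"
      unfolding Q_def by (rule nn_integral_cong, rule nn_integral_cmult) (rule sec_meas[OF \<phi>])
    finally show ?thesis .
  qed
  have "(\<integral>\<^sup>+s. c + (\<Sum>i\<in>I. ennreal (exp (- lam * st i s)) * \<phi> (t - st i s) (shift i s)) \<partial>P)
    = c + (\<Sum>i\<in>I. \<integral>\<^sup>+s. ennreal (exp (- lam * st i s)) * \<phi> (t - st i s) (shift i s) \<partial>P)"
    by (simp add: nn_integral_add nn_integral_sum P.emeasure_space_1)
  also have "(\<Sum>i\<in>I. \<integral>\<^sup>+s. ennreal (exp (- lam * st i s)) * \<phi> (t - st i s) (shift i s) \<partial>P)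
    = (\<Sum>i\<in>I. \<integral>\<^sup>+s. ennreal (exp (- lam * st i s)) * Q (t - st i s) \<partial>P)"
    by (rule sum.cong[OF refl step])
  also have "\<dots> = (\<integral>\<^sup>+u. ennreal (f u) * Q (t - u) \<partial>lborel)"
    by (rule first_moment) measurable
  finally show ?thesis by (simp only: Q_def)
qed

section \<open>Truncated tree sizes\<close>

definition r :: "real \<Rightarrow> real" where "r t = (if 0 \<le> t then exp (- lam * t) else 0)"

lemma ennreal_r: "ennreal (r t) = src t"
  by (simp add: r_def src_def)

lemma r_src: "r t = enn2real (src t)"
  by (simp add: r_def src_def)

lemma r_nonneg: "0 \<le> r t"
  by (simp add: r_def)

lemma r_le_1: "r t \<le> 1"
  using lam_pos by (simp add: r_def)

lemma r_meas [measurable]: "r \<in> borel_measurable borel"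
  unfolding r_def[abs_def] by measurable

text \<open>\<open>X n t s\<close> is \<open>exp (- lam * t)\<close> times the number of vertices of length at most \<open>n\<close> born until
  time \<open>t\<close> (see \<open>X_card\<close> below). The truncation makes all moments finite a priori.\<close>

primrec X :: "nat \<Rightarrow> real \<Rightarrow> (nat list \<Rightarrow> real) \<Rightarrow> real" where
  "X 0 t s = r t"
| "X (Suc n) t s = r t + (\<Sum>i\<in>I. exp (- lam * st i s) * X n (t - st i s) (shift i s))"

lemma X_meas: "(\<lambda>z. X n (fst z) (snd z)) \<in> borel_measurable (borel \<Otimes>\<^sub>M P)"
proof (induction n)
  case (Suc n)
  have [measurable]: "st i \<in> borel_measurable P" if "i \<in> I" for i using that by (simp add: I_iff)
  have [measurable]: "(\<lambda>z. X n (fst z - st i (snd z)) (shift i (snd z))) \<in> borel_measurable (borel \<Otimes>\<^sub>M P)" if "i \<in> I" for i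
    by (rule comp_meas[OF Suc that])
  show ?case unfolding X.simps by measurable
qed simp

lemma X_sec_meas [measurable]: "X n t \<in> borel_measurable P"
  by (rule sec_meas[OF X_meas])

lemma X_nonneg: "0 \<le> X n t s"
  by (induction n arbitrary: t s) (auto intro!: add_nonneg_nonneg sum_nonneg simp: r_nonneg)

lemma X_mono_Suc: "X n t s \<le> X (Suc n) t s"
proof (induction n arbitrary: t s)
  case 0
  show ?case by (auto intro!: sum_nonneg mult_nonneg_nonneg simp: r_nonneg)
next
  case (Suc n)
  show ?case unfolding X.simps(2)[of n t s] X.simps(2)[of "Suc n" t s]
    by (intro add_left_mono sum_mono mult_left_mono Suc) simp
qed

lemma X_neg: "nonneg s \<Longrightarrow> t < 0 \<Longrightarrow> X n t s = 0"
proof (induction n arbitrary: t s)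
  case 0
  then show ?case by (simp add: r_def)
next
  case (Suc n)
  have "X n (t - st i s) (shift i s) = 0" if "i \<in> I" for i
    using that Suc.prems nonneg_st[of s i] by (intro Suc.IH nonneg_shift) (auto simp: I_iff)
  then show ?case using Suc.prems by (simp add: r_def)
qed

lemma r_growth: "0 \<le> h \<Longrightarrow> r t \<le> exp (lam * h) * r (t + h)"
  by (auto simp: r_def exp_add[symmetric] algebra_simps)

text \<open>Monotonicity in time of the unnormalised size, expressed after normalisation.\<close>

lemma X_growth: "0 \<le> h \<Longrightarrow> X n t s \<le> exp (lam * h) * X n (t + h) s"
proof (induction n arbitrary: t s)
  case 0
  then show ?case by (simp add: r_growth)
next
  case (Suc n)
  have "X (Suc n) t s \<le> exp (lam * h) * r (t + h)
      + (\<Sum>i\<in>I. exp (- lam * st i s) * (exp (lam * h) * X n (t - st i s + h) (shift i s)))"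
    unfolding X.simps by (intro add_mono r_growth sum_mono mult_left_mono Suc) (use Suc.prems in auto)
  also have "\<dots> = exp (lam * h) * X (Suc n) (t + h) s"
    unfolding X.simps by (simp add: distrib_left sum_distrib_left mult.left_commute diff_add_eq)
  finally show ?case .
qed

lemma X_Suc_ennreal:
  "ennreal (X (Suc n) t s) = src t + (\<Sum>i\<in>I. ennreal (exp (- lam * st i s)) * ennreal (X n (t - st i s) (shift i s)))"
proof -
  have "ennreal (X (Suc n) t s) = ennreal (r t) + ennreal (\<Sum>i\<in>I. exp (- lam * st i s) * X n (t - st i s) (shift i s))"
    unfolding X.simps by (intro ennreal_plus r_nonneg sum_nonneg mult_nonneg_nonneg X_nonneg) simp
  also have "ennreal (\<Sum>i\<in>I. exp (- lam * st i s) * X n (t - st i s) (shift i s))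
      = (\<Sum>i\<in>I. ennreal (exp (- lam * st i s) * X n (t - st i s) (shift i s)))"
    by (rule sum_ennreal[symmetric]) (simp add: X_nonneg)
  finally show ?thesis by (simp add: ennreal_r ennreal_mult')
qed

definition Bm :: real where "Bm = (1 + wmin / real K / lam) / (1 - \<kappa>)"

lemma Bm_nonneg: "0 \<le> Bm"
  unfolding Bm_def using \<kappa>(2,3) wmin(1) lam_pos by simp

text \<open>The means of \<open>X n\<close> are the iterates of the renewal equation started at
  \<open>src\<close>.\<close>

lemma mean_X_le: "(\<integral>\<^sup>+s. ennreal (X n t s) \<partial>P) \<le> ennreal Bm"
  unfolding Bm_def
proof (rule renewal_iterates_bounded[where m = "\<lambda>n t. \<integral>\<^sup>+s. ennreal (X n t s) \<partial>P"])
  fix n t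
  show "(\<lambda>t. \<integral>\<^sup>+s. ennreal (X n t s) \<partial>P) \<in> borel_measurable borel"
    by (rule P.borel_measurable_nn_integral) (use X_meas[of n] in \<open>simp add: case_prod_beta\<close>)
  show "(\<integral>\<^sup>+s. ennreal (X n t s) \<partial>P) = 0" if "t < 0"
  proof -
    have "(\<integral>\<^sup>+s. ennreal (X n t s) \<partial>P) = (\<integral>\<^sup>+s. 0 \<partial>P)"
      by (rule nn_integral_cong_AE) (use AE_nonneg in eventually_elim, simp add: X_neg that)
    then show ?thesis by simp
  qed
  show "(\<integral>\<^sup>+s. ennreal (X 0 t s) \<partial>P) = src t" by (simp add: ennreal_r P.emeasure_space_1)
  show "(\<integral>\<^sup>+s. ennreal (X (Suc n) t s) \<partial>P)
      = src t + (\<integral>\<^sup>+u. ennreal (f u) * (\<integral>\<^sup>+s. ennreal (X n (t - u) s) \<partial>P) \<partial>lborel)"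
    unfolding X_Suc_ennreal by (rule mean_recursion) (use X_meas[of n] in simp)
  show "(\<integral>\<^sup>+s. ennreal (X n t s) \<partial>P) \<le> (\<integral>\<^sup>+s. ennreal (X (Suc n) t s) \<partial>P)"
    by (intro nn_integral_mono ennreal_leI X_mono_Suc)
qed

text \<open>\<open>square_recursion\<close> with \<open>e = 0\<close>: bounded means give a constant
  source, and the kernel has mass \<open>\<rho> < 1\<close>. \<open>C\<close> solves
  \<open>C = C1 + \<rho> * C\<close> and so reproduces itself in the induction.\<close>

lemma square_X_bounded: obtains C where "0 \<le> C" "\<And>n t. (\<integral>\<^sup>+s. ennreal ((X n t s)\<^sup>2) \<partial>P) \<le> ennreal C"
proof -
  define \<rho> where "\<rho> = enn2real (\<integral>\<^sup>+u. ennreal (f u) * ennreal (exp (- lam * u)) \<partial>lborel)"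
  have lt1: "(\<integral>\<^sup>+u. ennreal (f u) * ennreal (exp (- lam * u)) \<partial>lborel) < 1"
    by (rule exponential_moment_less_1[OF lam_pos])
  then have fin: "(\<integral>\<^sup>+u. ennreal (f u) * ennreal (exp (- lam * u)) \<partial>lborel) < \<top>"
    by (rule less_trans) (rule ennreal_one_less_top)
  then have \<rho>: "(\<integral>\<^sup>+u. ennreal (f u) * ennreal (exp (- lam * u)) \<partial>lborel) = ennreal \<rho>" by (simp add: \<rho>_def)
  have \<rho>0: "0 \<le> \<rho>" by (simp add: \<rho>_def)
  have \<rho>1: "\<rho> < 1" using lt1 \<rho>0 unfolding \<rho> by (simp add: ennreal_less_iff)
  define C1 where "C1 = (1 + real K * Bm)\<^sup>2"
  define C where "C = C1 / (1 - \<rho>)"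
  have "1 \<le> C1" unfolding C1_def using Bm_nonneg by (intro one_le_power) simp
  have C0: "0 \<le> C" using \<rho>1 \<open>1 \<le> C1\<close> by (simp add: C_def)
  have "(1 - \<rho>) * C = C1" using \<rho>1 by (simp add: C_def)
  then have C: "C1 + \<rho> * C = C" by (simp add: algebra_simps)
  have C1C: "C1 \<le> C" using C \<rho>0 C0 by (metis le_add_same_cancel1 mult_nonneg_nonneg)
  have "(\<integral>\<^sup>+s. ennreal ((X n t s)\<^sup>2) \<partial>P) \<le> ennreal C" for n t
  proof (induction n arbitrary: t)
    case 0
    have "(r t)\<^sup>2 \<le> 1\<^sup>2" by (intro power_mono r_le_1 r_nonneg)
    then have "(r t)\<^sup>2 \<le> C" using \<open>1 \<le> C1\<close> C1C by simp
    then show ?case by (simp add: P.emeasure_space_1 ennreal_leI)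
  next
    case (Suc n)
    have mean: "\<bar>P.expectation (X n t)\<bar> \<le> Bm * exp (- 0 * t)" for t
    proof -
      have "P.expectation (X n t) = enn2real (\<integral>\<^sup>+s. ennreal (X n t s) \<partial>P)"
        by (rule integral_eq_nn_integral) (simp_all add: X_nonneg)
      also have "\<dots> \<le> Bm" using mean_X_le[of n t] Bm_nonneg by (intro enn2real_leI) auto
      finally have "P.expectation (X n t) \<le> Bm" .
      moreover have "0 \<le> P.expectation (X n t)" by (intro integral_nonneg_AE) (simp add: X_nonneg)
      ultimately show ?thesis by simp
    qed
    have "(\<integral>\<^sup>+s. ennreal ((X (Suc n) t s)\<^sup>2) \<partial>P)
      \<le> ennreal ((1 + real K * Bm)\<^sup>2 * exp (- (2 * 0) * t))
        + (\<integral>\<^sup>+u. (ennreal (f u) * ennreal (exp (- lam * u))) * (\<integral>\<^sup>+s. ennreal ((X n (t - u) s)\<^sup>2) \<partial>P) \<partial>lborel)"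
      unfolding X.simps
    proof (rule square_recursion[OF X_meas _ mean])
      show "(\<integral>\<^sup>+s. ennreal ((X n t s)\<^sup>2) \<partial>P) < \<top>" for t
        using Suc.IH[of t] by (rule le_less_trans) simp
      show "\<bar>r t\<bar> \<le> 1 * exp (- 0 * t)" using r_nonneg r_le_1 by simp
    qed (use lam_pos Bm_nonneg in simp_all)
    also have "\<dots> \<le> ennreal C1 + (\<integral>\<^sup>+u. (ennreal (f u) * ennreal (exp (- lam * u))) * ennreal C \<partial>lborel)"
      unfolding C1_def by (intro add_mono nn_integral_mono mult_left_mono Suc.IH) simp_all
    also have "(\<integral>\<^sup>+u. (ennreal (f u) * ennreal (exp (- lam * u))) * ennreal C \<partial>lborel) = ennreal \<rho> * ennreal C"
      by (subst nn_integral_multc) (simp, simp only: \<rho>)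
    also have "ennreal C1 + ennreal \<rho> * ennreal C = ennreal (C1 + \<rho> * C)"
      using \<rho>0 C0 \<open>1 \<le> C1\<close> by (simp add: ennreal_mult'[symmetric] ennreal_plus[symmetric] del: ennreal_plus)
    finally show ?case unfolding C .
  qed
  then show thesis using C0 that by blast
qed

section \<open>The untruncated tree size and its moments\<close>

definition XE :: "real \<Rightarrow> (nat list \<Rightarrow> real) \<Rightarrow> ennreal" where
  "XE t s = (SUP n. ennreal (X n t s))"

text \<open>The tree size counts as \<open>0\<close> in \<open>Xr\<close> if it is infinite.\<close>

definition Xr :: "real \<Rightarrow> (nat list \<Rightarrow> real) \<Rightarrow> real" where "Xr t s = enn2real (XE t s)"

lemma XE_meas: "(\<lambda>z. XE (fst z) (snd z)) \<in> borel_measurable (borel \<Otimes>\<^sub>M P)"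
  unfolding XE_def using X_meas by (intro borel_measurable_SUP) simp_all

lemma Xr_meas: "(\<lambda>z. Xr (fst z) (snd z)) \<in> borel_measurable (borel \<Otimes>\<^sub>M P)"
  unfolding Xr_def using XE_meas by simp

lemma XE_sec_meas [measurable]: "XE t \<in> borel_measurable P"
  by (rule sec_meas[OF XE_meas])

lemma Xr_sec_meas [measurable]: "Xr t \<in> borel_measurable P"
  by (rule sec_meas[OF Xr_meas])

lemma incseq_X: "incseq (\<lambda>n. ennreal (X n t s))"
  by (intro incseq_SucI ennreal_leI X_mono_Suc)

lemma X_tendsto_XE: "(\<lambda>n. ennreal (X n t s)) \<longlonglongrightarrow> XE t s"
  unfolding XE_def by (rule LIMSEQ_SUP[OF incseq_X])

lemma XE_rec: "XE t s = src t + (\<Sum>i\<in>I. ennreal (exp (- lam * st i s)) * XE (t - st i s) (shift i s))"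
proof (rule LIMSEQ_unique)
  show "(\<lambda>n. ennreal (X (Suc n) t s)) \<longlonglongrightarrow> XE t s" by (rule LIMSEQ_Suc[OF X_tendsto_XE])
  show "(\<lambda>n. ennreal (X (Suc n) t s)) \<longlonglongrightarrow> src t + (\<Sum>i\<in>I. ennreal (exp (- lam * st i s)) * XE (t - st i s) (shift i s))"
    unfolding X_Suc_ennreal
    by (intro tendsto_add tendsto_const tendsto_sum ennreal_tendsto_cmult X_tendsto_XE) simp
qed

lemma XE_growth: "0 \<le> h \<Longrightarrow> XE t s \<le> ennreal (exp (lam * h)) * XE (t + h) s"
  unfolding XE_def[of t]
proof (rule SUP_least)
  fix n assume "0 \<le> h"
  have "ennreal (X n t s) \<le> ennreal (exp (lam * h)) * ennreal (X n (t + h) s)"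
    using X_growth[OF \<open>0 \<le> h\<close>, of n t s] by (simp add: ennreal_mult'[symmetric] ennreal_leI)
  also have "\<dots> \<le> ennreal (exp (lam * h)) * XE (t + h) s"
    unfolding XE_def by (intro mult_left_mono SUP_upper) simp_all
  finally show "ennreal (X n t s) \<le> ennreal (exp (lam * h)) * XE (t + h) s" .
qed

lemma mean_XE_le: "(\<integral>\<^sup>+s. XE t s \<partial>P) \<le> ennreal Bm"
  by (rule nn_integral_limit_le[where g = "\<lambda>n s. ennreal (X n t s)"]) (simp_all add: X_tendsto_XE mean_X_le)

text \<open>Finiteness at all times simultaneously: the recursion evaluates subtrees at random
  times, so an exceptional set depending on \<open>t\<close> would not do.\<close>

definition good :: "(nat list \<Rightarrow> real) \<Rightarrow> bool" where
  "good s \<longleftrightarrow> nonneg s \<and> (\<forall>t. XE t s < \<top>)"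

lemma AE_good: "AE s in P. good s"
proof -
  have "AE s in P. XE (real k) s \<noteq> \<infinity>" for k
    by (rule nn_integral_PInf_AE) (use mean_XE_le[of "real k"] in \<open>auto simp: top_unique\<close>)
  then have "AE s in P. \<forall>k. XE (real k) s \<noteq> \<infinity>" by (simp add: AE_all_countable)
  then show ?thesis using AE_nonneg
  proof eventually_elim
    case (elim s)
    have "XE t s < \<top>" for t
    proof -
      obtain k :: nat where k: "t \<le> real k" using real_arch_simple by blast
      have "XE t s \<le> ennreal (exp (lam * (real k - t))) * XE (real k) s"
        using XE_growth[of "real k - t" t s] k by simp
      also have "\<dots> < \<top>" using elim(1) by (simp add: ennreal_mult_less_top less_top)
      finally show ?thesis .
    qed
    then show ?case using elim(2) by (simp add: good_def)
  qed
qed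

text \<open>The subtree at \<open>i\<close> at time \<open>t\<close> is part of the whole tree at
  time \<open>t + st i s\<close>.\<close>

lemma good_shift: assumes "good s" "i \<in> I" shows "good (shift i s)"
proof -
  have "XE t (shift i s) < \<top>" for t
  proof -
    have "XE (t + st i s) s < \<top>" using assms by (simp add: good_def)
    then have "\<forall>j\<in>I. ennreal (exp (- lam * st j s)) * XE (t + st i s - st j s) (shift j s) < \<top>"
      unfolding XE_rec[of "t + st i s" s] by simp
    then have "ennreal (exp (- lam * st i s)) * XE t (shift i s) < \<top>" using assms(2) by fastforce
    then show ?thesis by (auto simp: ennreal_mult_less_top)
  qed
  then show ?thesis using assms nonneg_shift by (auto simp: good_def)
qed

lemma Xr_XE: "good s \<Longrightarrow> ennreal (Xr t s) = XE t s"
  by (simp add: good_def Xr_def)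

lemma Xr_nonneg: "0 \<le> Xr t s"
  by (simp add: Xr_def)

lemma Xr_rec:
  assumes "good s"
  shows "Xr t s = r t + (\<Sum>i\<in>I. exp (- lam * st i s) * Xr (t - st i s) (shift i s))"
proof -
  have nn: "0 \<le> (\<Sum>i\<in>I. exp (- lam * st i s) * Xr (t - st i s) (shift i s))"
    by (intro sum_nonneg mult_nonneg_nonneg Xr_nonneg) simp
  have "ennreal (Xr t s) = ennreal (r t) + (\<Sum>i\<in>I. ennreal (exp (- lam * st i s)) * ennreal (Xr (t - st i s) (shift i s)))"
    unfolding Xr_XE[OF assms] XE_rec[of t s] ennreal_r
    by (intro arg_cong2[where f = "(+)"] refl sum.cong) (simp add: Xr_XE good_shift assms)
  also have "(\<Sum>i\<in>I. ennreal (exp (- lam * st i s)) * ennreal (Xr (t - st i s) (shift i s)))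
      = ennreal (\<Sum>i\<in>I. exp (- lam * st i s) * Xr (t - st i s) (shift i s))"
    by (subst sum_ennreal[symmetric]) (simp_all add: Xr_nonneg ennreal_mult')
  also have "ennreal (r t) + \<dots> = ennreal (r t + (\<Sum>i\<in>I. exp (- lam * st i s) * Xr (t - st i s) (shift i s)))"
    using nn r_nonneg by (intro ennreal_plus[symmetric])
  finally show ?thesis
    using nn r_nonneg[of t] Xr_nonneg[of t s] by (subst (asm) ennreal_inj) auto
qed

lemma Xr_growth: "good s \<Longrightarrow> 0 \<le> h \<Longrightarrow> Xr t s \<le> exp (lam * h) * Xr (t + h) s"
proof -
  assume "good s" "0 \<le> h"
  then have "ennreal (Xr t s) \<le> ennreal (exp (lam * h) * Xr (t + h) s)"
    using XE_growth[of h t s] by (simp add: Xr_XE ennreal_mult')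
  then show ?thesis by (subst (asm) ennreal_le_iff) (simp_all add: Xr_nonneg)
qed

lemma X_tendsto_Xr: "good s \<Longrightarrow> (\<lambda>n. X n t s) \<longlonglongrightarrow> Xr t s"
proof -
  assume "good s"
  then have "(\<lambda>n. ennreal (X n t s)) \<longlonglongrightarrow> ennreal (Xr t s)" using X_tendsto_XE[of t s] by (simp add: Xr_XE)
  then show ?thesis by (rule tendsto_ennrealD) (simp_all add: Xr_nonneg X_nonneg)
qed

definition m :: "real \<Rightarrow> real" where "m t = P.expectation (Xr t)"

lemma ennreal_m: "ennreal (m t) = (\<integral>\<^sup>+s. XE t s \<partial>P)"
proof -
  have eq: "(\<integral>\<^sup>+s. ennreal (Xr t s) \<partial>P) = (\<integral>\<^sup>+s. XE t s \<partial>P)"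
    by (rule nn_integral_cong_AE) (use AE_good in eventually_elim, simp add: Xr_XE)
  have "(\<integral>\<^sup>+s. XE t s \<partial>P) < \<top>" using mean_XE_le by (rule le_less_trans) simp
  moreover have "m t = enn2real (\<integral>\<^sup>+s. ennreal (Xr t s) \<partial>P)"
    unfolding m_def by (rule integral_eq_nn_integral) (simp_all add: Xr_nonneg)
  ultimately show ?thesis unfolding eq by simp
qed

lemma Xr_integrable: "integrable P (Xr t)"
proof (rule integrableI_nonneg)
  have "(\<integral>\<^sup>+s. ennreal (Xr t s) \<partial>P) = (\<integral>\<^sup>+s. XE t s \<partial>P)"
    by (rule nn_integral_cong_AE) (use AE_good in eventually_elim, simp add: Xr_XE)
  then show "(\<integral>\<^sup>+s. ennreal (Xr t s) \<partial>P) < \<infinity>" by (simp flip: ennreal_m)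
qed (simp_all add: Xr_nonneg)

sublocale sol: renewal_solution f lam "wmin / real K" "\<Sum>l<K. w l" m Bm
proof
  have "(\<lambda>t. enn2real (\<integral>\<^sup>+s. XE t s \<partial>P)) \<in> borel_measurable borel"
    using P.borel_measurable_nn_integral[of "\<lambda>t s. XE t s" borel] XE_meas by (simp add: case_prod_beta)
  moreover have m_nn: "0 \<le> m t" for t unfolding m_def by (intro integral_nonneg_AE) (simp add: Xr_nonneg)
  then have "m = (\<lambda>t. enn2real (\<integral>\<^sup>+s. XE t s \<partial>P))" by (simp add: ennreal_m[symmetric] fun_eq_iff)
  ultimately show "m \<in> borel_measurable borel" by simp
  show "0 \<le> m t" for t by (rule m_nn)
  show "m t = 0" if "t < 0" for t
  proof -
    have "(\<integral>\<^sup>+s. XE t s \<partial>P) = (\<integral>\<^sup>+s. 0 \<partial>P)"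
      by (rule nn_integral_cong_AE) (use AE_nonneg in eventually_elim, simp add: XE_def X_neg that)
    then have "ennreal (m t) = 0" by (simp add: ennreal_m)
    then show ?thesis using m_nn[of t] by simp
  qed
  show "m t \<le> Bm" for t
    using mean_XE_le[of t] Bm_nonneg unfolding ennreal_m[symmetric] by (subst (asm) ennreal_le_iff)
  show "ennreal (m t) = src t + (\<integral>\<^sup>+u. ennreal (f u) * ennreal (m (t - u)) \<partial>lborel)" for t
  proof -
    have "(\<integral>\<^sup>+s. XE t s \<partial>P)
      = (\<integral>\<^sup>+s. src t + (\<Sum>i\<in>I. ennreal (exp (- lam * st i s)) * XE (t - st i s) (shift i s)) \<partial>P)"
      by (rule nn_integral_cong) (rule XE_rec)
    also have "\<dots> = src t + (\<integral>\<^sup>+u. ennreal (f u) * (\<integral>\<^sup>+s. XE (t - u) s \<partial>P) \<partial>lborel)"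
      by (rule mean_recursion[OF XE_meas])
    finally show ?thesis unfolding ennreal_m .
  qed
qed

lemma m_growth: "0 \<le> h \<Longrightarrow> m t \<le> exp (lam * h) * m (t + h)"
proof -
  assume h: "0 \<le> h"
  have "m t \<le> P.expectation (\<lambda>s. exp (lam * h) * Xr (t + h) s)"
    unfolding m_def
    by (rule integral_mono_AE) (use AE_good in \<open>auto simp: Xr_integrable Xr_growth h elim!: eventually_mono\<close>)
  then show ?thesis by (simp add: m_def)
qed

lemma square_Xr_bounded: obtains C where "0 \<le> C" "\<And>t. (\<integral>\<^sup>+s. ennreal ((Xr t s)\<^sup>2) \<partial>P) \<le> ennreal C"
proof -
  obtain C where C: "0 \<le> C" "\<And>n t. (\<integral>\<^sup>+s. ennreal ((X n t s)\<^sup>2) \<partial>P) \<le> ennreal C" by (rule square_X_bounded, rule that)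
  have "(\<integral>\<^sup>+s. ennreal ((Xr t s)\<^sup>2) \<partial>P) \<le> ennreal C" for t
  proof (rule nn_integral_limit_le[OF _ _ C(2)[of _ t]])
    show "AE s in P. (\<lambda>n. ennreal ((X n t s)\<^sup>2)) \<longlonglongrightarrow> ennreal ((Xr t s)\<^sup>2)"
      using AE_good by eventually_elim (intro tendsto_ennrealI tendsto_power X_tendsto_Xr)
  qed simp
  then show thesis using C(1) that by blast
qed

text \<open>\<open>square_recursion\<close> for increments, whose means decay at rate
  \<open>e\<close> by the renewal equation. Weighted with \<open>exp (2 * e * u)\<close>, the kernel
  becomes \<open>f u * exp (- (lam - 2 * e) * u)\<close>, and its mass is below one because
  \<open>e \<le> lam / 4\<close>.\<close>

lemma square_increment_decay:
  obtains e C where "0 < e" "0 \<le> C"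
    "\<And>\<delta> t. 0 \<le> \<delta> \<Longrightarrow> (\<integral>\<^sup>+s. ennreal ((Xr (t + \<delta>) s - Xr t s)\<^sup>2) \<partial>P) \<le> ennreal (C * exp (- (2 * e) * t))"
proof -
  obtain e A where e: "0 < e" "e \<le> lam / 4" and A: "0 \<le> A"
    and mean: "\<And>\<delta> t. 0 \<le> \<delta> \<Longrightarrow> \<bar>m (t + \<delta>) - m t\<bar> \<le> A * exp (- e * t)"
    by (rule sol.increment_decay, rule that)
  obtain B where B: "0 \<le> B" "\<And>t. (\<integral>\<^sup>+s. ennreal ((Xr t s)\<^sup>2) \<partial>P) \<le> ennreal B" by (rule square_Xr_bounded, rule that)
  define \<rho> where "\<rho> = enn2real (\<integral>\<^sup>+u. ennreal (f u) * ennreal (exp (- (lam - 2 * e) * u)) \<partial>lborel)"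
  have "0 < lam - 2 * e" using e lam_pos by simp
  then have lt1: "(\<integral>\<^sup>+u. ennreal (f u) * ennreal (exp (- (lam - 2 * e) * u)) \<partial>lborel) < 1"
    by (rule exponential_moment_less_1)
  then have fin: "(\<integral>\<^sup>+u. ennreal (f u) * ennreal (exp (- (lam - 2 * e) * u)) \<partial>lborel) < \<top>"
    by (rule less_trans) (rule ennreal_one_less_top)
  then have \<rho>: "(\<integral>\<^sup>+u. ennreal (f u) * ennreal (exp (- (lam - 2 * e) * u)) \<partial>lborel) = ennreal \<rho>" by (simp add: \<rho>_def)
  have \<rho>0: "0 \<le> \<rho>" by (simp add: \<rho>_def)
  have \<rho>1: "\<rho> < 1" using lt1 \<rho>0 unfolding \<rho> by (simp add: ennreal_less_iff)
  define C where "C = (1 + real K * A)\<^sup>2"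
  have main: "(\<integral>\<^sup>+s. ennreal ((Xr (t + \<delta>) s - Xr t s)\<^sup>2) \<partial>P) \<le> ennreal (C / (1 - \<rho>) * exp (- (2 * e) * t))"
    if \<delta>: "0 \<le> \<delta>" for \<delta> t
  proof -
    define \<phi> where "\<phi> t s = Xr (t + \<delta>) s - Xr t s" for t s
    define y where "y t = (\<integral>\<^sup>+s. ennreal ((\<phi> t s)\<^sup>2) \<partial>P)" for t
    have "(\<lambda>z. (fst z + \<delta>, snd z)) \<in> measurable (borel \<Otimes>\<^sub>M P) (borel \<Otimes>\<^sub>M P)" by measurable
    from measurable_compose[OF this Xr_meas]
    have [measurable]: "(\<lambda>z. Xr (fst z + \<delta>) (snd z)) \<in> borel_measurable (borel \<Otimes>\<^sub>M P)" by simp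
    note Xr_meas[measurable]
    have \<phi>_meas: "(\<lambda>z. \<phi> (fst z) (snd z)) \<in> borel_measurable (borel \<Otimes>\<^sub>M P)"
      unfolding \<phi>_def by measurable
    \<comment> \<open>Crude, but it supplies the finiteness presupposed by the contraction argument
      and by \<open>square_recursion\<close>.\<close>
    have ybd: "y t \<le> ennreal (4 * B)" for t
    proof -
      have "y t \<le> (\<integral>\<^sup>+s. 2 * ennreal ((Xr (t + \<delta>) s)\<^sup>2) + 2 * ennreal ((Xr t s)\<^sup>2) \<partial>P)"
        unfolding y_def \<phi>_def
      proof (rule nn_integral_mono)
        fix s
        have "(Xr (t + \<delta>) s - Xr t s)\<^sup>2 \<le> 2 * (Xr (t + \<delta>) s)\<^sup>2 + 2 * (Xr t s)\<^sup>2"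
          using zero_le_power2[of "Xr (t + \<delta>) s + Xr t s"] by (simp add: power2_eq_square algebra_simps)
        then have "ennreal ((Xr (t + \<delta>) s - Xr t s)\<^sup>2) \<le> ennreal (2 * (Xr (t + \<delta>) s)\<^sup>2 + 2 * (Xr t s)\<^sup>2)"
          by (rule ennreal_leI)
        also have "\<dots> = 2 * ennreal ((Xr (t + \<delta>) s)\<^sup>2) + 2 * ennreal ((Xr t s)\<^sup>2)"
          by (simp add: ennreal_plus ennreal_mult')
        finally show "ennreal ((Xr (t + \<delta>) s - Xr t s)\<^sup>2) \<le> 2 * ennreal ((Xr (t + \<delta>) s)\<^sup>2) + 2 * ennreal ((Xr t s)\<^sup>2)" .
      qed
      also have "\<dots> = 2 * (\<integral>\<^sup>+s. ennreal ((Xr (t + \<delta>) s)\<^sup>2) \<partial>P) + 2 * (\<integral>\<^sup>+s. ennreal ((Xr t s)\<^sup>2) \<partial>P)"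
        by (subst nn_integral_add) (simp_all add: nn_integral_cmult)
      also have "\<dots> \<le> 2 * ennreal B + 2 * ennreal B"
        by (intro add_mono mult_left_mono B) simp_all
      also have "\<dots> = ennreal (2 * B + 2 * B)" using B(1) ennreal_mult'[of 2 B] by (simp only: ennreal_plus mult_nonneg_nonneg zero_le_numeral ennreal_numeral)
      finally show ?thesis by simp
    qed
    have "y t \<le> ennreal (C / (1 - \<rho>) * exp (- (2 * e) * t))" for t
    proof (rule convolution_contraction_decay[where k = "\<lambda>u. ennreal (f u) * ennreal (exp (- lam * u))" and B = "4 * B"])
      show "y t \<le> ennreal (C * exp (- (2 * e) * t)) + (\<integral>\<^sup>+u. ennreal (f u) * ennreal (exp (- lam * u)) * y (t - u) \<partial>lborel)" for t
      proof -
        have "y t = (\<integral>\<^sup>+s. ennreal (((r (t + \<delta>) - r t) + (\<Sum>i\<in>I. exp (- lam * st i s) * \<phi> (t - st i s) (shift i s)))\<^sup>2) \<partial>P)"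
          unfolding y_def
        proof (rule nn_integral_cong_AE)
          show "AE s in P. ennreal ((\<phi> t s)\<^sup>2) = ennreal (((r (t + \<delta>) - r t) + (\<Sum>i\<in>I. exp (- lam * st i s) * \<phi> (t - st i s) (shift i s)))\<^sup>2)"
            using AE_good
          proof eventually_elim
            case (elim s)
            have eq: "t + \<delta> - st i s = t - st i s + \<delta>" for i by simp
            have "\<phi> t s = (r (t + \<delta>) - r t) + (\<Sum>i\<in>I. exp (- lam * st i s) * \<phi> (t - st i s) (shift i s))"
              unfolding \<phi>_def Xr_rec[OF elim, of t] Xr_rec[OF elim, of "t + \<delta>"]
              by (simp add: right_diff_distrib sum_subtractf eq)
            then show ?case by simp
          qed
        qed
        also have "\<dots> \<le> ennreal ((1 + real K * A)\<^sup>2 * exp (- (2 * e) * t))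
          + (\<integral>\<^sup>+u. (ennreal (f u) * ennreal (exp (- lam * u))) * (\<integral>\<^sup>+s. ennreal ((\<phi> (t - u) s)\<^sup>2) \<partial>P) \<partial>lborel)"
        proof (rule square_recursion[OF \<phi>_meas])
          show "(\<integral>\<^sup>+s. ennreal ((\<phi> t s)\<^sup>2) \<partial>P) < \<top>" for t
            using ybd[of t] unfolding y_def by (rule le_less_trans) simp
          show "\<bar>P.expectation (\<phi> t)\<bar> \<le> A * exp (- e * t)" for t
            unfolding \<phi>_def using mean[OF \<delta>, of t] Xr_integrable by (simp add: m_def)
          show "\<bar>r (t + \<delta>) - r t\<bar> \<le> 1 * exp (- e * t)"
            unfolding r_src mult_1
            by (rule order_trans[OF sol.src_diff[OF \<delta>] min_exp_le]) (use e in simp_all)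
        qed (use e A in simp_all)
        finally show ?thesis unfolding C_def y_def .
      qed
      have "(\<integral>\<^sup>+u. ennreal (f u) * ennreal (exp (- lam * u)) * ennreal (exp (2 * e * u)) \<partial>lborel)
          = (\<integral>\<^sup>+u. ennreal (f u) * ennreal (exp (- (lam - 2 * e) * u)) \<partial>lborel)"
      proof (rule nn_integral_cong)
        fix u
        have "ennreal (exp (- lam * u)) * ennreal (exp (2 * e * u)) = ennreal (exp (- (lam - 2 * e) * u))"
          by (simp add: ennreal_mult'[symmetric] exp_add[symmetric] algebra_simps)
        then show "ennreal (f u) * ennreal (exp (- lam * u)) * ennreal (exp (2 * e * u)) = ennreal (f u) * ennreal (exp (- (lam - 2 * e) * u))"
          by (simp only: mult.assoc)
      qed
      then show "(\<integral>\<^sup>+u. ennreal (f u) * ennreal (exp (- lam * u)) * ennreal (exp (2 * e * u)) \<partial>lborel) \<le> ennreal \<rho>"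
        unfolding \<rho> by simp
      show "y t \<le> ennreal (4 * B)" for t by (rule ybd)
      show "ennreal (f u) * ennreal (exp (- lam * u)) = 0" if "u < 0" for u using f_neg[OF that] by simp
      show "0 \<le> C" by (simp add: C_def)
      show "0 \<le> 2 * e" using e by simp
    qed (use \<rho>0 \<rho>1 in simp_all)
    then show ?thesis unfolding y_def \<phi>_def .
  qed
  show thesis by (rule that[OF e(1) _ main]) (use \<rho>1 in \<open>simp_all add: C_def\<close>)
qed

end

subsection \<open>The limit of the normalised tree size\<close>

text \<open>On the lattice of mesh \<open>1 / n\<close>, \<open>g t\<close> is at most
  \<open>exp (l / n)\<close> times the value at the next point and at least
  \<open>exp (- l / n)\<close> times that at the previous one, and these factors tend to one. All
  the lattices contain the integers, so their limits agree.\<close>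

lemma tendsto_at_top_of_lattices:
  fixes g :: "real \<Rightarrow> real" and l :: real
  assumes nonneg: "\<And>t. 0 \<le> g t" and l: "0 \<le> l"
    and growth: "\<And>h t. 0 \<le> h \<Longrightarrow> g t \<le> exp (l * h) * g (t + h)"
    and conv: "\<And>N. convergent (\<lambda>k. g (real k * (1 / real (Suc N))))"
  shows "(g \<longlongrightarrow> lim (\<lambda>k. g (real k))) at_top"
proof -
  define L where "L = lim (\<lambda>k. g (real k))"
  have L: "(\<lambda>k. g (real k)) \<longlonglongrightarrow> L" using conv[of 0] by (simp add: L_def convergent_LIMSEQ_iff)
  have LN: "(\<lambda>k. g (real k * (1 / real (Suc N)))) \<longlonglongrightarrow> L" for N
  proof -
    obtain L' where L': "(\<lambda>k. g (real k * (1 / real (Suc N)))) \<longlonglongrightarrow> L'"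
      using conv[of N] by (auto simp: convergent_def)
    have "filterlim (\<lambda>k. k * Suc N) at_top sequentially"
      by (rule filterlim_subseq, rule strict_monoI, rule mult_strict_right_mono) simp_all
    from filterlim_compose[OF L' this] have "(\<lambda>k. g (real (k * Suc N) * (1 / real (Suc N)))) \<longlonglongrightarrow> L'" .
    moreover have "real (k * Suc N) * (1 / real (Suc N)) = real k" for k by (simp only: of_nat_mult) (simp del: of_nat_Suc)
    ultimately have "(\<lambda>k. g (real k)) \<longlonglongrightarrow> L'" by simp
    then have "L' = L" using L by (rule LIMSEQ_unique)
    then show ?thesis using L' by simp
  qed
  have exp_lim: "(\<lambda>N. exp (c / real (Suc N)) * L) \<longlonglongrightarrow> L" for c :: real
  proof -
    have "(\<lambda>N. c / real (Suc N)) \<longlonglongrightarrow> 0" by real_asymp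
    then have "(\<lambda>N. exp (c / real (Suc N)) * L) \<longlonglongrightarrow> exp 0 * L" by (intro tendsto_intros)
    then show ?thesis by simp
  qed
  have "(g \<longlongrightarrow> L) at_top"
  proof (rule order_tendstoI)
    fix a assume "a < L"
    then have "\<forall>\<^sub>F N in sequentially. a < exp (- l / real (Suc N)) * L"
      using order_tendstoD(1)[OF exp_lim] by blast
    then obtain N where N: "a < exp (- l / real (Suc N)) * L" by (auto simp: eventually_sequentially)
    define n where "n = real (Suc N)"
    have n: "0 < n" by (simp add: n_def)
    have "(\<lambda>k. exp (- l / n) * g (real k * (1 / n))) \<longlonglongrightarrow> exp (- l / n) * L"
      unfolding n_def by (intro tendsto_mult_left LN)
    then have "\<forall>\<^sub>F k in sequentially. a < exp (- l / n) * g (real k * (1 / n))"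
      using order_tendstoD(1) N unfolding n_def by blast
    then obtain k0 where k0: "\<And>k. k \<ge> k0 \<Longrightarrow> a < exp (- l / n) * g (real k * (1 / n))"
      by (auto simp: eventually_sequentially)
    show "\<forall>\<^sub>F t in at_top. a < g t"
      using eventually_ge_at_top[of "real k0 / n"]
    proof eventually_elim
      case (elim t)
      define k where "k = nat \<lfloor>t * n\<rfloor>"
      have "real k0 \<le> t * n" using elim n by (simp add: pos_divide_le_eq)
      then have k: "k0 \<le> k" "real k \<le> t * n" "t * n < real k + 1"
        unfolding k_def by linarith+
      define h where "h = t - real k * (1 / n)"
      have "h = (t * n - real k) / n" using n by (simp add: h_def diff_divide_distrib)
      then have h: "0 \<le> h" "h \<le> 1 / n" using k n by (simp_all add: divide_right_mono)
      have "exp (- l / n) * g (real k * (1 / n)) \<le> exp (- l / n) * (exp (l * h) * g t)"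
        using growth[OF h(1), of "real k * (1 / n)"] by (intro mult_left_mono) (simp_all add: h_def)
      also have "\<dots> = exp (l * h - l / n) * g t" by (simp add: exp_diff exp_minus field_simps)
      also have "\<dots> \<le> 1 * g t"
      proof (rule mult_right_mono[OF _ nonneg])
        have "l * h \<le> l * (1 / n)" by (rule mult_left_mono[OF h(2) l])
        then show "exp (l * h - l / n) \<le> 1" by simp
      qed
      finally show ?case using k0[OF k(1)] by simp
    qed
  next
    fix a assume "L < a"
    then have "\<forall>\<^sub>F N in sequentially. exp (l / real (Suc N)) * L < a"
      using order_tendstoD(2)[OF exp_lim] by blast
    then obtain N where N: "exp (l / real (Suc N)) * L < a" by (auto simp: eventually_sequentially)
    define n where "n = real (Suc N)"
    have n: "0 < n" by (simp add: n_def)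
    have "(\<lambda>k. exp (l / n) * g (real k * (1 / n))) \<longlonglongrightarrow> exp (l / n) * L"
      unfolding n_def by (intro tendsto_mult_left LN)
    then have "\<forall>\<^sub>F k in sequentially. exp (l / n) * g (real k * (1 / n)) < a"
      using order_tendstoD(2) N unfolding n_def by blast
    then obtain k0 where k0: "\<And>k. k \<ge> k0 \<Longrightarrow> exp (l / n) * g (real k * (1 / n)) < a"
      by (auto simp: eventually_sequentially)
    show "\<forall>\<^sub>F t in at_top. g t < a"
      using eventually_ge_at_top[of "real k0 / n"]
    proof eventually_elim
      case (elim t)
      \<comment> \<open>The upper bound compares with a lattice point after \<open>t\<close>, hence
        the successor.\<close>
      define k where "k = Suc (nat \<lfloor>t * n\<rfloor>)"
      have "real k0 \<le> t * n" using elim n by (simp add: pos_divide_le_eq)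
      then have k: "k0 \<le> k" "t * n \<le> real k" "real k \<le> t * n + 1"
        unfolding k_def by linarith+
      define h where "h = real k * (1 / n) - t"
      have "h = (real k - t * n) / n" using n by (simp add: h_def diff_divide_distrib)
      then have h: "0 \<le> h" "h \<le> 1 / n" using k n by (simp_all add: divide_right_mono)
      have "g t \<le> exp (l * h) * g (real k * (1 / n))"
        using growth[OF h(1), of t] by (simp add: h_def)
      also have "\<dots> \<le> exp (l / n) * g (real k * (1 / n))"
      proof (rule mult_right_mono[OF _ nonneg])
        have "l * h \<le> l * (1 / n)" by (rule mult_left_mono[OF h(2) l])
        then show "exp (l * h) \<le> exp (l / n)" by simp
      qed
      finally show ?case using k0[OF k(1)] by simp
    qed
  qed
  then show ?thesis unfolding L_def .
qed

context weighted_tree begin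

text \<open>The mean absolute differences along the lattice are bounded by a geometric sequence, so
  the differences are almost surely absolutely summable and telescope to a convergent
  sequence.\<close>

lemma AE_lattice_convergent:
  assumes \<delta>: "0 < \<delta>"
  shows "AE s in P. convergent (\<lambda>k. Xr (real k * \<delta>) s)"
proof -
  obtain e C where e: "0 < e" and C: "0 \<le> C"
    and dec: "\<And>\<delta> t. 0 \<le> \<delta> \<Longrightarrow> (\<integral>\<^sup>+s. ennreal ((Xr (t + \<delta>) s - Xr t s)\<^sup>2) \<partial>P) \<le> ennreal (C * exp (- (2 * e) * t))"
    by (rule square_increment_decay, rule that)
  define D where "D k s = Xr (real (Suc k) * \<delta>) s - Xr (real k * \<delta>) s" for k s
  have [measurable]: "D k \<in> borel_measurable P" for k unfolding D_def[abs_def] by measurable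
  define q where "q = exp (- e * \<delta>)"
  have q: "0 < q" "q < 1" using e \<delta> by (simp_all add: q_def)
  have "(\<integral>\<^sup>+s. ennreal \<bar>D k s\<bar> \<partial>P) \<le> ennreal ((1 + C) / 2 * q ^ k)" for k
  proof (rule P.nn_integral_abs_le)
    have "real (Suc k) * \<delta> = real k * \<delta> + \<delta>" by (simp add: algebra_simps)
    then have "(\<integral>\<^sup>+s. ennreal ((D k s)\<^sup>2) \<partial>P) \<le> ennreal (C * exp (- (2 * e) * (real k * \<delta>)))"
      unfolding D_def using dec[of \<delta> "real k * \<delta>"] \<delta> by simp
    also have "exp (- (2 * e) * (real k * \<delta>)) = (q ^ k)\<^sup>2"
      by (simp add: q_def exp_of_nat_mult[symmetric] power2_eq_square exp_add[symmetric] algebra_simps)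
    finally show "(\<integral>\<^sup>+s. ennreal ((D k s)\<^sup>2) \<partial>P) \<le> ennreal (C * (q ^ k)\<^sup>2)" .
  qed (use q C in simp_all)
  then have "(\<Sum>k. \<integral>\<^sup>+s. ennreal \<bar>D k s\<bar> \<partial>P) \<le> (\<Sum>k. ennreal ((1 + C) / 2 * q ^ k))"
    by (intro suminf_le) simp_all
  also have "\<dots> = ennreal (\<Sum>k. (1 + C) / 2 * q ^ k)"
    by (rule suminf_ennreal2) (use q C in \<open>auto intro!: summable_mult summable_geometric\<close>)
  finally have "(\<integral>\<^sup>+s. (\<Sum>k. ennreal \<bar>D k s\<bar>) \<partial>P) \<le> ennreal (\<Sum>k. (1 + C) / 2 * q ^ k)"
    by (subst nn_integral_suminf) simp_all
  then have "(\<integral>\<^sup>+s. (\<Sum>k. ennreal \<bar>D k s\<bar>) \<partial>P) \<noteq> \<infinity>" by (auto simp: top_unique)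
  then have "AE s in P. (\<Sum>k. ennreal \<bar>D k s\<bar>) \<noteq> \<infinity>"
    by (intro nn_integral_PInf_AE) simp_all
  then show ?thesis
  proof eventually_elim
    case (elim s)
    then have "summable (\<lambda>k. \<bar>D k s\<bar>)" by (intro summable_suminf_not_top) simp_all
    then have "summable (\<lambda>k. D k s)" by (rule summable_rabs_cancel)
    then have "convergent (\<lambda>n. \<Sum>k<n. D k s)" by (simp add: summable_iff_convergent)
    moreover have "(\<Sum>k<n. D k s) = Xr (real n * \<delta>) s - Xr 0 s" for n
      unfolding D_def by (subst sum_lessThan_telescope) simp
    ultimately have "convergent (\<lambda>n. (Xr (real n * \<delta>) s - Xr 0 s) + Xr 0 s)"
      by (intro convergent_add) (simp_all add: convergent_const)
    then show ?case by simp
  qed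
qed

text \<open>A limit along the integers is measurable outright; on \<open>settled\<close> samples it
  is also the limit along the reals.\<close>

definition \<Theta> :: "(nat list \<Rightarrow> real) \<Rightarrow> real" where
  "\<Theta> s = lim (\<lambda>k. Xr (real k) s)"

definition settled :: "(nat list \<Rightarrow> real) \<Rightarrow> bool" where
  "settled s \<longleftrightarrow> good s \<and> ((\<lambda>t. Xr t s) \<longlongrightarrow> \<Theta> s) at_top"

lemma \<Theta>_meas [measurable]: "\<Theta> \<in> borel_measurable P"
  unfolding \<Theta>_def[abs_def] by (rule borel_measurable_lim_metric) simp

lemma AE_settled: "AE s in P. settled s"
proof -
  have "AE s in P. \<forall>N. convergent (\<lambda>k. Xr (real k * (1 / real (Suc N))) s)"
    unfolding AE_all_countable by (intro allI AE_lattice_convergent) simp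
  then show ?thesis using AE_good
  proof eventually_elim
    case (elim s)
    have "((\<lambda>t. Xr t s) \<longlongrightarrow> lim (\<lambda>k. Xr (real k) s)) at_top"
      by (rule tendsto_at_top_of_lattices[where l = lam])
         (use elim lam_pos in \<open>simp_all add: Xr_nonneg Xr_growth\<close>)
    then show ?case using elim(2) by (simp add: settled_def \<Theta>_def)
  qed
qed

lemma settled_seq: "settled s \<Longrightarrow> filterlim g at_top F \<Longrightarrow> ((\<lambda>k. Xr (g k) s) \<longlongrightarrow> \<Theta> s) F"
  unfolding settled_def by (auto intro: filterlim_compose)

lemma \<Theta>_nonneg: "settled s \<Longrightarrow> 0 \<le> \<Theta> s"
  unfolding settled_def by (auto intro!: tendsto_lowerbound[of "\<lambda>t. Xr t s" _ at_top] simp: Xr_nonneg)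

lemma \<Theta>_square: "(\<integral>\<^sup>+s. ennreal ((\<Theta> s)\<^sup>2) \<partial>P) < \<top>"
proof -
  obtain C where C: "0 \<le> C" "\<And>t. (\<integral>\<^sup>+s. ennreal ((Xr t s)\<^sup>2) \<partial>P) \<le> ennreal C"
    by (rule square_Xr_bounded, rule that)
  have "(\<integral>\<^sup>+s. ennreal ((\<Theta> s)\<^sup>2) \<partial>P) \<le> ennreal C"
  proof (rule nn_integral_limit_le[where g = "\<lambda>k s. ennreal ((Xr (real k) s)\<^sup>2)"])
    show "AE s in P. (\<lambda>k. ennreal ((Xr (real k) s)\<^sup>2)) \<longlonglongrightarrow> ennreal ((\<Theta> s)\<^sup>2)"
      using AE_settled
      by eventually_elim (intro tendsto_ennrealI tendsto_power settled_seq filterlim_real_sequentially)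
  qed (simp_all add: C)
  then show ?thesis by (rule le_less_trans) simp
qed

lemma \<Theta>_square_integrable: "integrable P (\<lambda>s. (\<Theta> s)\<^sup>2)"
  using \<Theta>_square by (intro integrableI_nonneg) simp_all

lemma \<Theta>_integrable: "integrable P \<Theta>"
  by (rule P.square_integrable_imp_integrable[OF \<Theta>_meas \<Theta>_square_integrable])

text \<open>Almost sure convergence alone would not exclude mean zero. Sending the span of the
  increments to infinity, by Fatou, shows that \<open>m (real k)\<close> tends to the mean of
  \<open>\<Theta>\<close>, and \<open>limit_pos\<close> applies.\<close>

lemma \<Theta>_mean_pos: "0 < P.expectation \<Theta>"
proof -
  obtain e C where e: "0 < e" and C: "0 \<le> C"
    and dec: "\<And>\<delta> t. 0 \<le> \<delta> \<Longrightarrow> (\<integral>\<^sup>+s. ennreal ((Xr (t + \<delta>) s - Xr t s)\<^sup>2) \<partial>P) \<le> ennreal (C * exp (- (2 * e) * t))"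
    by (rule square_increment_decay, rule that)
  have bd: "\<bar>m (real k) - P.expectation \<Theta>\<bar> \<le> (1 + C) / 2 * exp (- e * real k)" for k
  proof -
    have "(\<integral>\<^sup>+s. ennreal ((\<Theta> s - Xr (real k) s)\<^sup>2) \<partial>P) \<le> ennreal (C * exp (- (2 * e) * real k))"
    proof (rule nn_integral_limit_le[where g = "\<lambda>j s. ennreal ((Xr (real k + real j) s - Xr (real k) s)\<^sup>2)"])
      have fl: "filterlim (\<lambda>j. real k + real j) at_top sequentially"
        by (rule filterlim_tendsto_add_at_top[OF tendsto_const filterlim_real_sequentially])
      show "AE s in P. (\<lambda>j. ennreal ((Xr (real k + real j) s - Xr (real k) s)\<^sup>2)) \<longlonglongrightarrow> ennreal ((\<Theta> s - Xr (real k) s)\<^sup>2)"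
        using AE_settled
        by eventually_elim (intro tendsto_ennrealI tendsto_power tendsto_diff settled_seq tendsto_const fl)
    qed (simp, rule dec, simp)
    also have "exp (- (2 * e) * real k) = (exp (- e * real k))\<^sup>2"
      by (simp add: power2_eq_square exp_add[symmetric] algebra_simps)
    finally have sq: "(\<integral>\<^sup>+s. ennreal ((\<Theta> s - Xr (real k) s)\<^sup>2) \<partial>P) \<le> ennreal (C * (exp (- e * real k))\<^sup>2)" .
    have "(\<integral>\<^sup>+s. ennreal \<bar>\<Theta> s - Xr (real k) s\<bar> \<partial>P) \<le> ennreal ((1 + C) / 2 * exp (- e * real k))"
      by (rule P.nn_integral_abs_le[OF _ sq _ C]) simp_all
    moreover have "ennreal \<bar>P.expectation (\<lambda>s. \<Theta> s - Xr (real k) s)\<bar> \<le> (\<integral>\<^sup>+s. ennreal \<bar>\<Theta> s - Xr (real k) s\<bar> \<partial>P)"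
      using integral_norm_bound_ennreal[of P "\<lambda>s. \<Theta> s - Xr (real k) s"] \<Theta>_integrable Xr_integrable by simp
    ultimately have "ennreal \<bar>P.expectation (\<lambda>s. \<Theta> s - Xr (real k) s)\<bar> \<le> ennreal ((1 + C) / 2 * exp (- e * real k))"
      by (rule order_trans[rotated])
    then have "\<bar>P.expectation (\<lambda>s. \<Theta> s - Xr (real k) s)\<bar> \<le> (1 + C) / 2 * exp (- e * real k)"
      using C by (subst (asm) ennreal_le_iff) simp_all
    then show ?thesis using \<Theta>_integrable Xr_integrable by (simp add: m_def abs_minus_commute)
  qed
  have "(\<lambda>k. m (real k) - P.expectation \<Theta>) \<longlonglongrightarrow> 0"
  proof (rule Lim_null_comparison)
    show "\<forall>\<^sub>F k in sequentially. norm (m (real k) - P.expectation \<Theta>) \<le> (1 + C) / 2 * exp (- e * real k)"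
      using bd by simp
    show "(\<lambda>k. (1 + C) / 2 * exp (- e * real k)) \<longlonglongrightarrow> 0" using e by real_asymp
  qed
  then have lim: "(\<lambda>k. m (real k)) \<longlonglongrightarrow> P.expectation \<Theta>" by (simp add: LIM_zero_iff)
  show ?thesis by (rule sol.limit_pos[OF _ lim]) (rule m_growth)
qed

lemma AE_settled_shift: "AE s in P. \<forall>i\<in>I. settled (shift i s)"
  by (subst AE_ball_countable) (auto intro!: AE_shift AE_settled countable_finite)

lemma \<Theta>_rec_settled:
  assumes "settled s" "\<And>i. i \<in> I \<Longrightarrow> settled (shift i s)"
  shows "\<Theta> s = (\<Sum>i\<in>I. exp (- lam * st i s) * \<Theta> (shift i s))"
proof (rule LIMSEQ_unique)
  show "(\<lambda>k. Xr (real k) s) \<longlonglongrightarrow> \<Theta> s" by (intro settled_seq assms filterlim_real_sequentially)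
  have "good s" using assms(1) by (simp add: settled_def)
  have "(\<lambda>k. r (real k) + (\<Sum>i\<in>I. exp (- lam * st i s) * Xr (real k - st i s) (shift i s)))
      \<longlonglongrightarrow> 0 + (\<Sum>i\<in>I. exp (- lam * st i s) * \<Theta> (shift i s))"
  proof (intro tendsto_add tendsto_sum tendsto_mult_left settled_seq assms)
    have "(\<lambda>k. exp (- c * real k)) \<longlonglongrightarrow> 0" if "0 < c" for c :: real using that by real_asymp
    from this[OF lam_pos] have "(\<lambda>k. exp (- lam * real k)) \<longlonglongrightarrow> 0" .
    then show "(\<lambda>k. r (real k)) \<longlonglongrightarrow> 0" by (simp add: r_def)
    have "filterlim (\<lambda>k. - st i s + real k) at_top sequentially" for i
      by (rule filterlim_tendsto_add_at_top[OF tendsto_const filterlim_real_sequentially])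
    then show "filterlim (\<lambda>k. real k - st i s) at_top sequentially" for i by simp
  qed
  then show "(\<lambda>k. Xr (real k) s) \<longlonglongrightarrow> (\<Sum>i\<in>I. exp (- lam * st i s) * \<Theta> (shift i s))"
    unfolding Xr_rec[OF \<open>good s\<close>] by simp
qed

text \<open>The discounts are positive, so \<open>\<Theta>\<close> vanishes exactly if it vanishes
  in each of the independent subtrees. As \<open>K \<ge> 2\<close>, the probability of this is
  \<open>0\<close> or \<open>1\<close>, and \<open>1\<close> contradicts the positive mean.\<close>

lemma AE_\<Theta>_pos: "AE s in P. 0 < \<Theta> s"
proof -
  define g :: "(nat list \<Rightarrow> real) \<Rightarrow> ennreal" where "g s = indicator {0} (\<Theta> s)" for s
  have [measurable]: "g \<in> borel_measurable P" unfolding g_def[abs_def] by measurable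
  define q where "q = measure P {s \<in> space P. \<Theta> s = 0}"
  have g_int: "(\<integral>\<^sup>+s. g s \<partial>P) = ennreal q"
  proof -
    have "(\<integral>\<^sup>+s. g s \<partial>P) = (\<integral>\<^sup>+s. indicator {s \<in> space P. \<Theta> s = 0} s \<partial>P)"
      by (rule nn_integral_cong) (auto simp: g_def indicator_def)
    then show ?thesis by (simp add: q_def P.emeasure_eq_measure)
  qed
  have prod_eq: "AE s in P. g s = (\<Prod>i\<in>I. g (shifts s i))"
    using AE_settled AE_settled_shift
  proof eventually_elim
    case (elim s)
    have nn: "0 \<le> exp (- lam * st i s) * \<Theta> (shift i s)" if "i \<in> I" for i
      using elim that \<Theta>_nonneg by (intro mult_nonneg_nonneg) auto
    have "\<Theta> s = (\<Sum>i\<in>I. exp (- lam * st i s) * \<Theta> (shift i s))"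
      using elim by (intro \<Theta>_rec_settled) auto
    then have "\<Theta> s = 0 \<longleftrightarrow> (\<forall>i\<in>I. exp (- lam * st i s) * \<Theta> (shift i s) = 0)"
      using sum_nonneg_eq_0_iff[OF finite_I nn] by simp
    then have "\<Theta> s = 0 \<longleftrightarrow> (\<forall>i\<in>I. \<Theta> (shift i s) = 0)" by simp
    then have iff: "\<Theta> s = 0 \<longleftrightarrow> (\<forall>i\<in>I. \<Theta> (shifts s i) = 0)" by (simp add: shifts_def)
    show ?case
    proof (cases "\<Theta> s = 0")
      case True
      then show ?thesis using iff by (simp add: g_def)
    next
      case False
      then obtain i where "i \<in> I" "\<Theta> (shifts s i) \<noteq> 0" using iff by blast
      then have "\<exists>i\<in>I. g (shifts s i) = 0" by (intro bexI[of _ i]) (simp_all add: g_def)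
      then have "(\<Prod>i\<in>I. g (shifts s i)) = 0" by (simp add: prod_zero_iff)
      then show ?thesis using False by (simp add: g_def)
    qed
  qed
  have "ennreal q = (\<integral>\<^sup>+s. (\<Prod>i\<in>I. g (shifts s i)) \<partial>P)"
    unfolding g_int[symmetric] by (rule nn_integral_cong_AE[OF prod_eq])
  also have "\<dots> = (\<integral>\<^sup>+ss. (\<Prod>i\<in>I. g (ss i)) \<partial>distr P PI shifts)"
  proof (rule nn_integral_distr[symmetric, OF shifts_meas])
    have c_meas [measurable]: "(\<lambda>ss. ss i) \<in> measurable PI P" if "i \<in> I" for i
      unfolding PI_def by (rule measurable_component_singleton[OF that])
    show "(\<lambda>ss. \<Prod>i\<in>I. g (ss i)) \<in> borel_measurable (distr P PI shifts)"
      unfolding distr_shifts by measurable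
  qed
  also have "\<dots> = (\<Prod>i\<in>I. \<integral>\<^sup>+s. g s \<partial>P)"
    unfolding distr_shifts unfolding PI_def by (rule PF.product_nn_integral_prod) simp_all
  also have "\<dots> = ennreal q ^ K" unfolding g_int by (simp add: I_def)
  also have "\<dots> = ennreal (q ^ K)" by (simp add: q_def ennreal_power)
  finally have qK: "q = q ^ K" by (simp add: q_def)
  have q01: "0 \<le> q" "q \<le> 1" by (simp_all add: q_def)
  have "q \<noteq> 1"
  proof
    assume "q = 1"
    then have "AE s in P. \<Theta> s = 0" unfolding q_def by (subst (asm) P.prob_Collect_eq_1) simp_all
    then have "P.expectation \<Theta> = P.expectation (\<lambda>_. 0)" by (intro integral_cong_AE) simp_all
    then show False using \<Theta>_mean_pos by simp
  qed
  moreover have "q = 0 \<or> q = 1"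
  proof (rule ccontr)
    assume "\<not> ?thesis"
    then have q: "0 < q" "q < 1" using q01 by auto
    then have "q ^ K \<le> q ^ 2" using K2 by (intro power_decreasing) auto
    also have "\<dots> < q" using q by (simp add: power2_eq_square)
    finally show False using qK by simp
  qed
  ultimately have "q = 0" by blast
  then have "AE s in P. \<Theta> s \<noteq> 0" unfolding q_def by (subst (asm) P.prob_Collect_eq_0) simp_all
  then show ?thesis using AE_settled
  proof eventually_elim
    case (elim s)
    then show ?case using \<Theta>_nonneg[of s] by simp
  qed
qed

end

subsection \<open>The entropy\<close>

text \<open>Bounds \<open>\<Theta> * ln \<Theta>\<close> by an integrable function, given the second
  moment.\<close>

lemma abs_mult_ln_le:
  fixes x :: real
  assumes "0 < x"
  shows "\<bar>x * ln x\<bar> \<le> 1 + x\<^sup>2"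
proof (cases "1 \<le> x")
  case True
  then have "x * ln x \<le> x * x" using ln_le_minus_one[of x] by (intro mult_left_mono) auto
  moreover have "0 \<le> x * ln x" using True by simp
  moreover have "x\<^sup>2 = x * x" by (simp add: power2_eq_square)
  ultimately show ?thesis by linarith
next
  case False
  have "ln (1 / x) \<le> 1 / x - 1" using assms by (intro ln_le_minus_one) simp
  then have "x * - ln x \<le> x * (1 / x - 1)" using assms by (intro mult_left_mono) (simp_all add: ln_div)
  also have "\<dots> \<le> 1" using assms by (simp add: right_diff_distrib)
  finally have "- (x * ln x) \<le> 1" by simp
  moreover have "x * ln x \<le> 0" using assms False by (intro mult_nonneg_nonpos) auto
  moreover have "0 \<le> x\<^sup>2" by simp
  ultimately show ?thesis by linarith
qed

text \<open>Gibbs' inequality against the uniform distribution: apply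
  \<open>ln y \<le> y - 1\<close> to \<open>y = 1 / (q x * n)\<close>; the errors
  \<open>1 / n - q x\<close> sum to zero.\<close>

lemma entropy_bounds:
  fixes q :: "'b \<Rightarrow> real"
  assumes fin: "finite A" "A \<noteq> {}" and pos: "\<And>x. x \<in> A \<Longrightarrow> 0 < q x" and sum: "sum q A = 1"
  shows "0 \<le> - (\<Sum>x\<in>A. q x * ln (q x))" "- (\<Sum>x\<in>A. q x * ln (q x)) \<le> ln (real (card A))"
proof -
  have "q x \<le> 1" if "x \<in> A" for x
    using member_le_sum[OF that _ fin(1), of q] pos sum by (simp add: less_imp_le)
  then have "(\<Sum>x\<in>A. q x * ln (q x)) \<le> 0"
    by (intro sum_nonpos mult_nonneg_nonpos) (auto simp: pos less_imp_le)
  then show "0 \<le> - (\<Sum>x\<in>A. q x * ln (q x))" by simp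
  define n where "n = real (card A)"
  have n: "0 < n" using fin by (simp add: n_def card_gt_0_iff)
  have "(\<Sum>x\<in>A. - (q x * ln (q x))) \<le> (\<Sum>x\<in>A. q x * ln n + (1 / n - q x))"
  proof (rule sum_mono)
    fix x assume x: "x \<in> A"
    have q: "0 < q x" by (rule pos[OF x])
    have "ln (1 / (q x * n)) \<le> 1 / (q x * n) - 1" using q n by (intro ln_le_minus_one) simp
    then have "q x * ln (1 / (q x * n)) \<le> q x * (1 / (q x * n) - 1)"
      using q by (intro mult_left_mono) simp_all
    moreover have "ln (1 / (q x * n)) = - ln (q x) - ln n" using q n by (simp add: ln_div ln_mult)
    moreover have "q x * (1 / (q x * n) - 1) = 1 / n - q x" using q n by (simp add: field_simps)
    ultimately have "q x * (- ln (q x) - ln n) \<le> 1 / n - q x" by (simp only:)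
    then show "- (q x * ln (q x)) \<le> q x * ln n + (1 / n - q x)" by (simp add: right_diff_distrib)
  qed
  also have "\<dots> = (\<Sum>x\<in>A. q x) * ln n + (n * (1 / n) - (\<Sum>x\<in>A. q x))"
    by (simp add: sum.distrib sum_subtractf sum_distrib_right n_def)
  also have "\<dots> = ln n" using n by (simp add: sum)
  finally show "- (\<Sum>x\<in>A. q x * ln (q x)) \<le> ln (real (card A))" by (simp add: sum_negf n_def)
qed

context weighted_tree begin

section \<open>Subtrees at arbitrary vertices and actual tree sizes\<close>

primrec sh :: "nat list \<Rightarrow> (nat list \<Rightarrow> real) \<Rightarrow> nat list \<Rightarrow> real" where
  "sh [] s = s"
| "sh (i # y) s = sh y (shift i s)"

lemma sh_meas: "x \<in> words K \<Longrightarrow> sh x \<in> measurable P P"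
proof (induction x)
  case (Cons i y)
  then have "sh y \<circ> shift i \<in> measurable P P"
    by (intro measurable_comp[OF shift_meas]) (auto simp: words_Cons)
  then show ?case by (simp add: comp_def)
next
  case Nil
  have "sh [] = (\<lambda>s. s)" by (simp add: fun_eq_iff)
  then show ?case by simp
qed

lemma AE_sh: "x \<in> words K \<Longrightarrow> AE s in P. Q s \<Longrightarrow> AE s in P. Q (sh x s)"
proof (induction x)
  case (Cons i y)
  then have "AE s in P. Q (sh y s)" by (auto simp: words_Cons)
  from AE_shift[OF _ this, of i] Cons.prems show ?case by (simp add: words_Cons)
qed simp

lemma tau_append: "tau (x @ y) s = tau x s + tau y (sh x s)"
  by (induction x arbitrary: s) simp_all

definition T :: "real \<Rightarrow> (nat list \<Rightarrow> real) \<Rightarrow> nat list set" where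
  "T t s = {x \<in> words K. tau x s \<le> t}"

definition Tn :: "nat \<Rightarrow> real \<Rightarrow> (nat list \<Rightarrow> real) \<Rightarrow> nat list set" where
  "Tn n t s = {x \<in> words K. length x \<le> n \<and> tau x s \<le> t}"

lemma finite_Tn: "finite (Tn n t s)"
  by (rule finite_subset[OF _ finite_lists_length_le[OF finite_I, of n]])
     (auto simp: Tn_def words_def I_def)

lemma Tn_Suc: "Tn (Suc n) t s = (if 0 \<le> t then {[]} else {}) \<union> (\<Union>i\<in>I. Cons i ` Tn n (t - st i s) (shift i s))"
proof (intro set_eqI)
  fix x
  show "x \<in> Tn (Suc n) t s \<longleftrightarrow> x \<in> (if 0 \<le> t then {[]} else {}) \<union> (\<Union>i\<in>I. Cons i ` Tn n (t - st i s) (shift i s))"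
  proof (cases x)
    case Nil
    then show ?thesis by (auto simp: Tn_def words_Nil)
  next
    case (Cons a y)
    have "x \<in> (\<Union>i\<in>I. Cons i ` Tn n (t - st i s) (shift i s)) \<longleftrightarrow> a \<in> I \<and> y \<in> Tn n (t - st a s) (shift a s)"
      unfolding Cons by blast
    also have "\<dots> \<longleftrightarrow> x \<in> Tn (Suc n) t s" by (auto simp: Tn_def words_Cons Cons)
    finally show ?thesis using Cons by auto
  qed
qed

lemma X_card: "X n t s = exp (- lam * t) * real (card (Tn n t s))"
proof (induction n arbitrary: t s)
  case 0
  have "Tn 0 t s = (if 0 \<le> t then {[]} else {})" by (auto simp: Tn_def words_Nil)
  then show ?case by (simp add: r_def)
next
  case (Suc n)
  have "card (Tn (Suc n) t s) = card (if 0 \<le> t then {[]::nat list} else {}) + card (\<Union>i\<in>I. Cons i ` Tn n (t - st i s) (shift i s))"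
    unfolding Tn_Suc by (rule card_Un_disjoint) (auto simp: finite_Tn)
  also have "card (\<Union>i\<in>I. Cons i ` Tn n (t - st i s) (shift i s)) = (\<Sum>i\<in>I. card (Cons i ` Tn n (t - st i s) (shift i s)))"
    by (rule card_UN_disjoint) (auto simp: finite_Tn)
  also have "\<dots> = (\<Sum>i\<in>I. card (Tn n (t - st i s) (shift i s)))"
    by (intro sum.cong refl card_image) simp
  finally have "real (card (Tn (Suc n) t s)) = (if 0 \<le> t then 1 else 0) + (\<Sum>i\<in>I. real (card (Tn n (t - st i s) (shift i s))))"
    by simp
  moreover have "exp (- lam * st i s) * (exp (- lam * (t - st i s)) * c) = exp (- lam * t) * c" for i c
    by (simp add: mult.assoc[symmetric] exp_add[symmetric] algebra_simps)
  ultimately show ?case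
    unfolding X.simps Suc by (simp only: distrib_left sum_distrib_left) (simp add: r_def)
qed

text \<open>Finiteness must be proved, since an infinite set has \<open>card\<close> zero. Each
  finite subset of \<open>T t s\<close> lies in some \<open>Tn n t s\<close>, and these have bounded
  cardinality; a finite \<open>T t s\<close> has bounded word length, so the truncation eventually
  has no effect.\<close>

lemma Xr_card:
  assumes "good s"
  shows "finite (T t s)" "Xr t s = exp (- lam * t) * real (card (T t s))"
proof -
  have le: "X n t s \<le> Xr t s" for n
    by (rule incseq_le[OF _ X_tendsto_Xr[OF assms]]) (intro incseq_SucI X_mono_Suc)
  have card_le: "card (Tn n t s) \<le> nat \<lceil>exp (lam * t) * Xr t s\<rceil>" for n
  proof -
    have "real (card (Tn n t s)) = exp (lam * t) * X n t s"
      unfolding X_card by (simp add: mult.assoc[symmetric] exp_add[symmetric])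
    also have "\<dots> \<le> exp (lam * t) * Xr t s" by (intro mult_left_mono le) simp
    finally show ?thesis by linarith
  qed
  have "finite (T t s) \<and> card (T t s) \<le> nat \<lceil>exp (lam * t) * Xr t s\<rceil>"
  proof (rule finite_if_finite_subsets_card_bdd)
    fix G assume G: "G \<subseteq> T t s" "finite G"
    then have "G \<subseteq> Tn (Max (length ` G)) t s" by (auto simp: T_def Tn_def)
    then show "card G \<le> nat \<lceil>exp (lam * t) * Xr t s\<rceil>"
      using card_mono[OF finite_Tn] card_le le_trans by blast
  qed
  then show fin: "finite (T t s)" by simp
  have "X n t s = exp (- lam * t) * real (card (T t s))" if nmax: "Max (length ` T t s) \<le> n" for n
  proof -
    have "length x \<le> n" if x: "x \<in> T t s" for x
      by (rule order_trans[OF Max_ge nmax]) (use fin x in simp_all)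
    then have "Tn n t s = T t s" by (auto simp: T_def Tn_def)
    then show ?thesis unfolding X_card by simp
  qed
  then have "\<forall>\<^sub>F n in sequentially. X n t s = exp (- lam * t) * real (card (T t s))"
    by (auto simp: eventually_sequentially)
  then have "(\<lambda>n. X n t s) \<longlonglongrightarrow> exp (- lam * t) * real (card (T t s))" by (rule tendsto_eventually)
  then show "Xr t s = exp (- lam * t) * real (card (T t s))"
    using X_tendsto_Xr[OF assms] LIMSEQ_unique by blast
qed

text \<open>There are countably many vertices, so one almost sure event serves all subtrees.\<close>

definition nice :: "(nat list \<Rightarrow> real) \<Rightarrow> bool" where
  "nice s \<longleftrightarrow> (\<forall>x\<in>words K. settled (sh x s) \<and> 0 < \<Theta> (sh x s))"

lemma AE_nice: "AE s in P. nice s"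
proof -
  have ae: "AE s in P. settled s \<and> 0 < \<Theta> s" using AE_settled AE_\<Theta>_pos by eventually_elim simp
  have cnt: "countable (words K)" by auto
  show ?thesis
    unfolding nice_def AE_ball_countable[OF cnt] by (intro ballI AE_sh[OF _ ae])
qed

lemma nice_shift: "nice s \<Longrightarrow> i \<in> I \<Longrightarrow> nice (shift i s)"
  unfolding nice_def by (metis sh.simps(2) words_Cons)

lemma nice_\<Theta>: "nice s \<Longrightarrow> settled s \<and> 0 < \<Theta> s"
  unfolding nice_def using words_Nil by (metis sh.simps(1))

section \<open>Sums over a generation\<close>

definition W :: "nat \<Rightarrow> nat list set" where "W n = {x \<in> words K. length x = n}"

lemma W_0: "W 0 = {[]}"
  by (auto simp: W_def words_Nil)

lemma W_lists: "W n = {x. set x \<subseteq> I \<and> length x = n}"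
  by (auto simp: W_def words_def I_def)

lemma finite_W: "finite (W n)"
  unfolding W_lists by (rule finite_lists_length_eq) simp

lemma card_W: "card (W n) = K ^ n"
  unfolding W_lists by (simp add: card_lists_length_eq) (simp add: I_def)

lemma W_nonempty: "W n \<noteq> {}"
  using card_W[of n] K2 by auto

lemma sum_W_Suc: "(\<Sum>x\<in>W (Suc n). g x) = (\<Sum>i\<in>I. \<Sum>y\<in>W n. g (i # y))"
proof -
  have "(\<Sum>i\<in>I. \<Sum>y\<in>W n. g (i # y)) = (\<Sum>z\<in>I \<times> W n. g (fst z # snd z))"
    by (simp add: sum.cartesian_product case_prod_beta)
  also have "\<dots> = (\<Sum>x\<in>W (Suc n). g x)"
    by (rule sum.reindex_bij_witness[of _ "\<lambda>x. (hd x, tl x)" "\<lambda>z. fst z # snd z"])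
       (auto simp: W_def words_Cons length_Suc_conv)
  finally show ?thesis ..
qed

text \<open>The \<open>n\<close>-fold iterate of the branching operator (see
  \<open>gen_Suc\<close>). For \<open>\<phi> = 1\<close> it is the additive martingale of the
  branching random walk of birth times; for \<open>\<phi> = \<Theta>\<close> it reproduces
  \<open>\<Theta>\<close>.\<close>

definition gen :: "nat \<Rightarrow> ((nat list \<Rightarrow> real) \<Rightarrow> real) \<Rightarrow> (nat list \<Rightarrow> real) \<Rightarrow> real" where
  "gen n \<phi> s = (\<Sum>x\<in>W n. exp (- lam * tau x s) * \<phi> (sh x s))"

lemma gen_0: "gen 0 \<phi> s = \<phi> s"
  by (simp add: gen_def W_0)

lemma gen_Suc: "gen (Suc n) \<phi> s = (\<Sum>i\<in>I. exp (- lam * st i s) * gen n \<phi> (shift i s))"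
  unfolding gen_def sum_W_Suc
  by (simp add: sum_distrib_left exp_add[symmetric] mult.assoc[symmetric] distrib_left)

text \<open>The contribution of the birth times to \<Theta> times the entropy.\<close>

definition A :: "nat \<Rightarrow> (nat list \<Rightarrow> real) \<Rightarrow> real" where
  "A n s = (\<Sum>x\<in>W n. lam * tau x s * (exp (- lam * tau x s) * \<Theta> (sh x s)))"

text \<open>Birth times add along a path while discounts multiply, so passing one generation down
  splits off a \<open>gen\<close> sum weighted by the time to the first generation.\<close>

lemma A_Suc: "A (Suc n) s = (\<Sum>i\<in>I. exp (- lam * st i s) * A n (shift i s))
    + (\<Sum>i\<in>I. lam * st i s * exp (- lam * st i s) * gen n \<Theta> (shift i s))"
proof -
  have "A (Suc n) s = (\<Sum>i\<in>I. \<Sum>y\<in>W n. exp (- lam * st i s) * (lam * tau y (shift i s) * (exp (- lam * tau y (shift i s)) * \<Theta> (sh y (shift i s))))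
      + lam * st i s * exp (- lam * st i s) * (exp (- lam * tau y (shift i s)) * \<Theta> (sh y (shift i s))))"
    unfolding A_def sum_W_Suc
  proof (intro sum.cong refl)
    fix i y
    define a b where "a = st i s" and "b = tau y (shift i s)"
    have "exp (- lam * (a + b)) = exp (- lam * a) * exp (- lam * b)"
      by (simp add: exp_add[symmetric] algebra_simps)
    then show "lam * tau (i # y) s * (exp (- lam * tau (i # y) s) * \<Theta> (sh (i # y) s))
      = exp (- lam * st i s) * (lam * tau y (shift i s) * (exp (- lam * tau y (shift i s)) * \<Theta> (sh y (shift i s))))
      + lam * st i s * exp (- lam * st i s) * (exp (- lam * tau y (shift i s)) * \<Theta> (sh y (shift i s)))"
      unfolding tau.simps sh.simps a_def[symmetric] b_def[symmetric] by (simp only: distrib_left distrib_right mult_ac)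
  qed
  then show ?thesis
    unfolding A_def gen_def by (simp only: sum.distrib sum_distrib_left)
qed

text \<open>The branching property for real functions of either sign, so that expectations involving
  \<open>\<psi>\<close> factorise as well.\<close>

lemma indep_st_shift:
  assumes i: "i \<in> I" and [measurable]: "g \<in> borel_measurable borel" and \<phi>: "\<phi> \<in> borel_measurable P"
  shows "P.indep_var borel (\<lambda>s. g (st i s)) borel (\<lambda>s. \<phi> (shift i s) :: real)"
proof -
  let ?A = "(\<lambda>j. [j]) ` I" and ?B = "Cons i ` J"
  let ?X = "\<lambda>a::nat list \<Rightarrow> real. g (\<Sum>j=1..i. a [j])"
  let ?Y = "\<lambda>b::nat list \<Rightarrow> real. \<phi> (\<lambda>y\<in>J. b (i # y))"
  have "P.indep_var (PiM ?A (\<lambda>_. borel)) (\<lambda>s. restrict (\<lambda>x. s x) ?A) (PiM ?B (\<lambda>_. borel)) (\<lambda>s. restrict (\<lambda>x. s x) ?B)"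
    by (rule P.indep_var_restrict[OF coords_indep]) (use i in \<open>auto simp: J_def words_def I_def\<close>)
  then have "P.indep_var borel (?X \<circ> (\<lambda>s. restrict (\<lambda>x. s x) ?A)) borel (?Y \<circ> (\<lambda>s. restrict (\<lambda>x. s x) ?B))"
  proof (rule P.indep_var_compose)
    have "(\<lambda>a::nat list \<Rightarrow> real. \<Sum>j=1..i. a [j]) \<in> borel_measurable (PiM ?A (\<lambda>_. borel))"
      by (intro borel_measurable_sum measurable_component_singleton) (use i in \<open>auto simp: I_iff\<close>)
    then show "?X \<in> borel_measurable (PiM ?A (\<lambda>_. borel))" by measurable
    have "(\<lambda>b::nat list \<Rightarrow> real. \<lambda>y\<in>J. b (i # y)) \<in> measurable (PiM ?B (\<lambda>_. borel)) P"
      unfolding measurable_cong_sets[OF refl sets_P]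
      by (intro measurable_restrict measurable_component_singleton) auto
    from measurable_compose[OF this \<phi>] show "?Y \<in> borel_measurable (PiM ?B (\<lambda>_. borel))" .
  qed
  moreover have "?X \<circ> (\<lambda>s. restrict (\<lambda>x. s x) ?A) = (\<lambda>s. g (st i s))"
  proof
    fix s
    have "(\<Sum>j=1..i. restrict (\<lambda>x. s x) ?A [j]) = st i s"
      unfolding st_def using i by (intro sum.cong) (auto simp: I_iff)
    then show "(?X \<circ> (\<lambda>s. restrict (\<lambda>x. s x) ?A)) s = g (st i s)" by simp
  qed
  moreover have "?Y \<circ> (\<lambda>s. restrict (\<lambda>x. s x) ?B) = (\<lambda>s. \<phi> (shift i s))"
  proof
    fix s
    have "(\<lambda>y\<in>J. restrict (\<lambda>x. s x) ?B (i # y)) = shift i s" by (auto simp: shift_def fun_eq_iff)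
    then show "(?Y \<circ> (\<lambda>s. restrict (\<lambda>x. s x) ?B)) s = \<phi> (shift i s)" by simp
  qed
  ultimately show ?thesis by simp
qed

lemma shift_expectation:
  fixes g :: "real \<Rightarrow> real" and \<phi> :: "(nat list \<Rightarrow> real) \<Rightarrow> real"
  assumes i: "i \<in> I" and g: "g \<in> borel_measurable borel" "integrable P (\<lambda>s. g (st i s))" and \<phi>: "integrable P \<phi>"
  shows "integrable P (\<lambda>s. g (st i s) * \<phi> (shift i s))"
    and "P.expectation (\<lambda>s. g (st i s) * \<phi> (shift i s)) = P.expectation (\<lambda>s. g (st i s)) * P.expectation \<phi>"
proof -
  have [measurable]: "\<phi> \<in> borel_measurable P" using \<phi> by simp
  have ind: "P.indep_var borel (\<lambda>s. g (st i s)) borel (\<lambda>s. \<phi> (shift i s))"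
    by (rule indep_st_shift[OF i g(1)]) simp
  have int: "integrable P (\<lambda>s. \<phi> (shift i s))"
    by (rule integrable_distr[OF shift_meas[OF i]]) (simp add: distr_shift[OF i] \<phi>)
  have eq: "P.expectation (\<lambda>s. \<phi> (shift i s)) = P.expectation \<phi>"
    using integral_distr[OF shift_meas[OF i], of \<phi>] by (simp add: distr_shift[OF i])
  show "integrable P (\<lambda>s. g (st i s) * \<phi> (shift i s))"
    by (rule P.indep_var_integrable[OF ind g(2) int])
  show "P.expectation (\<lambda>s. g (st i s) * \<phi> (shift i s)) = P.expectation (\<lambda>s. g (st i s)) * P.expectation \<phi>"
    unfolding P.indep_var_lebesgue_integral[OF ind g(2) int] eq ..
qed

lemma exp_st_integrable: "i \<in> I \<Longrightarrow> integrable P (\<lambda>s. exp (- lam * st i s))"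
proof -
  assume i: "i \<in> I"
  then have [measurable]: "st i \<in> borel_measurable P" by (simp add: I_iff)
  show ?thesis
  proof (rule P.integrable_const_bound[where B = 1])
    show "AE s in P. norm (exp (- lam * st i s)) \<le> 1"
      using AE_nonneg by eventually_elim (use nonneg_st i lam_pos in \<open>simp add: I_iff\<close>)
  qed measurable
qed

lemma lam_st_exp_integrable: "i \<in> I \<Longrightarrow> integrable P (\<lambda>s. lam * st i s * exp (- lam * st i s))"
proof -
  assume i: "i \<in> I"
  then have [measurable]: "st i \<in> borel_measurable P" by (simp add: I_iff)
  show ?thesis
  proof (rule P.integrable_const_bound[where B = 1])
    show "AE s in P. norm (lam * st i s * exp (- lam * st i s)) \<le> 1"
      using AE_nonneg
    proof eventually_elim
      case (elim s)
      have x: "0 \<le> lam * st i s" using nonneg_st[OF elim] i lam_pos by (simp add: I_iff)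
      have "lam * st i s \<le> exp (lam * st i s)" using exp_ge_add_one_self[of "lam * st i s"] by linarith
      then have "lam * st i s * exp (- lam * st i s) \<le> exp (lam * st i s) * exp (- lam * st i s)"
        by (rule mult_right_mono) simp
      also have "\<dots> = 1" by (simp add: exp_add[symmetric])
      finally show ?case using x by simp
    qed
  qed measurable
qed

lemma sum_exp_st: "(\<Sum>i\<in>I. P.expectation (\<lambda>s. exp (- lam * st i s))) = 1"
proof -
  have "ennreal (\<Sum>i\<in>I. P.expectation (\<lambda>s. exp (- lam * st i s))) = (\<Sum>i\<in>I. ennreal (P.expectation (\<lambda>s. exp (- lam * st i s))))"
    by (rule sum_ennreal[symmetric]) (simp add: integral_nonneg_AE)
  also have "\<dots> = (\<Sum>i\<in>I. \<integral>\<^sup>+s. ennreal (exp (- lam * st i s)) \<partial>P)"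
    by (intro sum.cong refl nn_integral_eq_integral[symmetric] exp_st_integrable) simp_all
  also have "\<dots> = ennreal 1" by (simp only: laplace_sum ennreal_1)
  finally show ?thesis by (subst (asm) ennreal_inj) (simp_all add: sum_nonneg integral_nonneg_AE)
qed

text \<open>Each generation contributes the factor \<open>1\<close> of \<open>sum_exp_st\<close>: at
  the Malthusian parameter the branching operator preserves expectations.\<close>

lemma gen_expectation:
  assumes \<phi>: "integrable P \<phi>"
  shows "integrable P (gen n \<phi>)" "P.expectation (gen n \<phi>) = P.expectation \<phi>"
proof -
  have "integrable P (gen n \<phi>) \<and> P.expectation (gen n \<phi>) = P.expectation \<phi>"
  proof (induction n)
    case 0
    then show ?case by (simp add: gen_0[abs_def] \<phi>)
  next
    case (Suc n)
    then have int: "integrable P (gen n \<phi>)" by simp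
    have 1: "integrable P (\<lambda>s. exp (- lam * st i s) * gen n \<phi> (shift i s))" if "i \<in> I" for i
      by (rule shift_expectation(1)[where g = "\<lambda>x. exp (- lam * x)", OF that _ exp_st_integrable[OF that] int]) simp
    have 2: "P.expectation (\<lambda>s. exp (- lam * st i s) * gen n \<phi> (shift i s))
      = P.expectation (\<lambda>s. exp (- lam * st i s)) * P.expectation (gen n \<phi>)" if "i \<in> I" for i
      by (rule shift_expectation(2)[where g = "\<lambda>x. exp (- lam * x)", OF that _ exp_st_integrable[OF that] int]) simp
    have "P.expectation (gen (Suc n) \<phi>) = (\<Sum>i\<in>I. P.expectation (\<lambda>s. exp (- lam * st i s) * gen n \<phi> (shift i s)))"
      unfolding gen_Suc[abs_def] by (rule Bochner_Integration.integral_sum) (rule 1)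
    also have "\<dots> = (\<Sum>i\<in>I. P.expectation (\<lambda>s. exp (- lam * st i s)) * P.expectation (gen n \<phi>))"
      by (rule sum.cong[OF refl 2])
    also have "\<dots> = P.expectation \<phi>" using Suc by (simp only: sum_distrib_right[symmetric] sum_exp_st mult_1)
    finally have "P.expectation (gen (Suc n) \<phi>) = P.expectation \<phi>" .
    moreover have "integrable P (gen (Suc n) \<phi>)"
      unfolding gen_Suc[abs_def] by (rule Bochner_Integration.integrable_sum) (rule 1)
    ultimately show ?case by (rule conjI[rotated])
  qed
  then show "integrable P (gen n \<phi>)" "P.expectation (gen n \<phi>) = P.expectation \<phi>" by simp_all
qed

definition hstar :: real where
  "hstar = (\<Sum>i\<in>I. P.expectation (\<lambda>s. lam * st i s * exp (- lam * st i s)))"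

lemma hstar_eq: "hstar = P.expectation (\<lambda>s. \<Sum>i\<in>I. lam * st i s * exp (- lam * st i s))"
proof -
  have "P.expectation (\<lambda>s. \<Sum>i\<in>I. lam * st i s * exp (- lam * st i s))
      = (\<Sum>i\<in>I. P.expectation (\<lambda>s. lam * st i s * exp (- lam * st i s)))"
    by (rule Bochner_Integration.integral_sum) (rule lam_st_exp_integrable)
  then show ?thesis by (simp only: hstar_def)
qed

text \<open>In \<open>A_Suc\<close> the first sum preserves the expectation, while the second has
  expectation \<open>hstar * P.expectation \<Theta>\<close> for every \<open>n\<close>, birth time
  and subtree being independent. So the expectation grows linearly.\<close>

lemma A_expectation: "integrable P (A n)" "P.expectation (A n) = real n * (hstar * P.expectation \<Theta>)"
proof -
  have "integrable P (A n) \<and> P.expectation (A n) = real n * (hstar * P.expectation \<Theta>)"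
  proof (induction n)
    case 0
    have "A 0 = (\<lambda>_. 0)" by (simp add: A_def[abs_def] W_0)
    then show ?case by simp
  next
    case (Suc n)
    then have int: "integrable P (A n)" by simp
    have intg: "integrable P (gen n \<Theta>)" by (rule gen_expectation(1)[OF \<Theta>_integrable])
    have a1: "integrable P (\<lambda>s. exp (- lam * st i s) * A n (shift i s))" if "i \<in> I" for i
      by (rule shift_expectation(1)[where g = "\<lambda>x. exp (- lam * x)", OF that _ exp_st_integrable[OF that] int]) simp
    have a2: "P.expectation (\<lambda>s. exp (- lam * st i s) * A n (shift i s))
      = P.expectation (\<lambda>s. exp (- lam * st i s)) * P.expectation (A n)" if "i \<in> I" for i
      by (rule shift_expectation(2)[where g = "\<lambda>x. exp (- lam * x)", OF that _ exp_st_integrable[OF that] int]) simp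
    have b1: "integrable P (\<lambda>s. lam * st i s * exp (- lam * st i s) * gen n \<Theta> (shift i s))" if "i \<in> I" for i
      by (rule shift_expectation(1)[where g = "\<lambda>x. lam * x * exp (- lam * x)", OF that _ lam_st_exp_integrable[OF that] intg]) simp
    have b2: "P.expectation (\<lambda>s. lam * st i s * exp (- lam * st i s) * gen n \<Theta> (shift i s))
      = P.expectation (\<lambda>s. lam * st i s * exp (- lam * st i s)) * P.expectation (gen n \<Theta>)" if "i \<in> I" for i
      by (rule shift_expectation(2)[where g = "\<lambda>x. lam * x * exp (- lam * x)", OF that _ lam_st_exp_integrable[OF that] intg]) simp
    let ?a = "\<lambda>s. \<Sum>i\<in>I. exp (- lam * st i s) * A n (shift i s)"
    let ?b = "\<lambda>s. \<Sum>i\<in>I. lam * st i s * exp (- lam * st i s) * gen n \<Theta> (shift i s)"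
    have ia: "integrable P ?a" by (rule Bochner_Integration.integrable_sum) (rule a1)
    have ib: "integrable P ?b" by (rule Bochner_Integration.integrable_sum) (rule b1)
    have "P.expectation ?a = (\<Sum>i\<in>I. P.expectation (\<lambda>s. exp (- lam * st i s) * A n (shift i s)))"
      by (rule Bochner_Integration.integral_sum) (rule a1)
    also have "\<dots> = (\<Sum>i\<in>I. P.expectation (\<lambda>s. exp (- lam * st i s)) * P.expectation (A n))"
      by (rule sum.cong[OF refl a2])
    also have "\<dots> = P.expectation (A n)" by (simp only: sum_distrib_right[symmetric] sum_exp_st mult_1)
    finally have ea: "P.expectation ?a = P.expectation (A n)" .
    have "P.expectation ?b = (\<Sum>i\<in>I. P.expectation (\<lambda>s. lam * st i s * exp (- lam * st i s) * gen n \<Theta> (shift i s)))"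
      by (rule Bochner_Integration.integral_sum) (rule b1)
    also have "\<dots> = (\<Sum>i\<in>I. P.expectation (\<lambda>s. lam * st i s * exp (- lam * st i s)) * P.expectation (gen n \<Theta>))"
      by (rule sum.cong[OF refl b2])
    also have "\<dots> = hstar * P.expectation \<Theta>"
      unfolding hstar_def by (simp only: sum_distrib_right[symmetric] gen_expectation(2)[OF \<Theta>_integrable])
    finally have eb: "P.expectation ?b = hstar * P.expectation \<Theta>" .
    have "P.expectation (\<lambda>s. ?a s + ?b s) = P.expectation ?a + P.expectation ?b"
      by (rule Bochner_Integration.integral_add[OF ia ib])
    then have "P.expectation (\<lambda>s. ?a s + ?b s) = real (Suc n) * (hstar * P.expectation \<Theta>)"
      unfolding ea eb using Suc by (simp add: distrib_right)
    moreover have "integrable P (\<lambda>s. ?a s + ?b s)" by (rule Bochner_Integration.integrable_add[OF ia ib])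
    ultimately show ?case unfolding A_Suc[abs_def] by simp
  qed
  then show "integrable P (A n)" "P.expectation (A n) = real n * (hstar * P.expectation \<Theta>)" by simp_all
qed

text \<open>\<open>D\<close> and \<open>Hc\<close> are \<open>Delta\<close> and \<open>H\<close> as functions of the sample, on the almost sure event \<open>nice\<close>
  (see \<open>Delta_eq\<close> and \<open>H_eq\<close> below).\<close>

definition D :: "nat list \<Rightarrow> (nat list \<Rightarrow> real) \<Rightarrow> real" where
  "D x s = exp (- lam * tau x s) * \<Theta> (sh x s) / \<Theta> s"

definition Hc :: "nat \<Rightarrow> (nat list \<Rightarrow> real) \<Rightarrow> real" where
  "Hc n s = - (\<Sum>x\<in>W n. D x s * ln (D x s))"

definition \<psi> :: "(nat list \<Rightarrow> real) \<Rightarrow> real" where "\<psi> s = \<Theta> s * ln (\<Theta> s)"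

lemma Hc_meas [measurable]: "Hc n \<in> borel_measurable P"
proof -
  have [measurable]: "tau x \<in> borel_measurable P" "sh x \<in> measurable P P" if "x \<in> W n" for x
    using that by (simp_all add: W_def tau_meas sh_meas)
  show ?thesis unfolding Hc_def[abs_def] D_def by measurable
qed

lemma \<psi>_integrable: "integrable P \<psi>"
proof (rule Bochner_Integration.integrable_bound)
  show "integrable P (\<lambda>s. 1 + (\<Theta> s)\<^sup>2)" using \<Theta>_square_integrable by simp
  show "\<psi> \<in> borel_measurable P" unfolding \<psi>_def[abs_def] by measurable
  show "AE s in P. norm (\<psi> s) \<le> norm (1 + (\<Theta> s)\<^sup>2)"
    using AE_\<Theta>_pos
  proof eventually_elim
    case (elim s)
    then have "\<bar>\<psi> s\<bar> \<le> 1 + (\<Theta> s)\<^sup>2" unfolding \<psi>_def by (rule abs_mult_ln_le)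
    then show ?case by simp
  qed
qed

lemma gen_\<Theta>: "nice s \<Longrightarrow> gen n \<Theta> s = \<Theta> s"
proof (induction n arbitrary: s)
  case (Suc n)
  have "gen (Suc n) \<Theta> s = (\<Sum>i\<in>I. exp (- lam * st i s) * \<Theta> (shift i s))"
    unfolding gen_Suc by (intro sum.cong refl) (simp add: Suc nice_shift)
  also have "\<dots> = \<Theta> s"
    using nice_\<Theta> nice_shift Suc.prems by (intro \<Theta>_rec_settled[symmetric]) auto
  finally show ?case .
qed (simp add: gen_0)

text \<open>Expanding \<open>ln (D x s)\<close> gives three terms. The common
  \<open>ln (\<Theta> s)\<close> collects to \<open>\<psi> s\<close> because
  \<open>gen n \<Theta>\<close> reproduces \<open>\<Theta>\<close>, and its mean cancels that of
  \<open>gen n \<psi>\<close>.\<close>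

lemma \<Theta>_Hc: "nice s \<Longrightarrow> \<Theta> s * Hc n s = A n s - gen n \<psi> s + \<psi> s"
proof -
  assume nice: "nice s"
  have pos: "0 < \<Theta> s" using nice_\<Theta>[OF nice] by simp
  have "\<Theta> s * Hc n s = (\<Sum>x\<in>W n. - (\<Theta> s * (D x s * ln (D x s))))"
    unfolding Hc_def by (simp add: sum_distrib_left sum_negf)
  also have "\<dots> = (\<Sum>x\<in>W n. lam * tau x s * (exp (- lam * tau x s) * \<Theta> (sh x s))
      - exp (- lam * tau x s) * \<psi> (sh x s) + exp (- lam * tau x s) * \<Theta> (sh x s) * ln (\<Theta> s))"
  proof (rule sum.cong[OF refl])
    fix x assume "x \<in> W n"
    then have px: "0 < \<Theta> (sh x s)" using nice by (simp add: nice_def W_def)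
    have l: "ln (D x s) = - lam * tau x s + ln (\<Theta> (sh x s)) - ln (\<Theta> s)"
      unfolding D_def using pos px by (simp add: ln_div ln_mult)
    have "\<Theta> s * D x s = exp (- lam * tau x s) * \<Theta> (sh x s)" unfolding D_def using pos by simp
    then have "\<Theta> s * (D x s * ln (D x s)) = exp (- lam * tau x s) * \<Theta> (sh x s) * ln (D x s)"
      by (simp only: mult.assoc[symmetric])
    then show "- (\<Theta> s * (D x s * ln (D x s))) = lam * tau x s * (exp (- lam * tau x s) * \<Theta> (sh x s))
      - exp (- lam * tau x s) * \<psi> (sh x s) + exp (- lam * tau x s) * \<Theta> (sh x s) * ln (\<Theta> s)"
      unfolding l \<psi>_def by (simp add: algebra_simps)
  qed
  also have "\<dots> = A n s - gen n \<psi> s + gen n \<Theta> s * ln (\<Theta> s)"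
    unfolding A_def gen_def by (simp only: sum.distrib sum_subtractf sum_distrib_right)
  finally show ?thesis unfolding gen_\<Theta>[OF nice] \<psi>_def .
qed

text \<open>By \<open>gen_\<Theta>\<close>, the numbers \<open>D x s\<close> form a probability
  vector on the \<open>K ^ n\<close> words of length \<open>n\<close>.\<close>

lemma Hc_bound: "nice s \<Longrightarrow> \<bar>Hc n s\<bar> \<le> real n * ln (real K)"
proof -
  assume nice: "nice s"
  have pos: "0 < \<Theta> s" using nice_\<Theta>[OF nice] by simp
  have Dpos: "0 < D x s" if "x \<in> W n" for x
    unfolding D_def using nice that pos by (simp add: nice_def W_def)
  have Dsum: "(\<Sum>x\<in>W n. D x s) = 1"
  proof -
    have "(\<Sum>x\<in>W n. D x s) = gen n \<Theta> s / \<Theta> s" by (simp add: D_def gen_def sum_divide_distrib)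
    then show ?thesis using gen_\<Theta>[OF nice] pos by simp
  qed
  have "0 \<le> Hc n s" "Hc n s \<le> ln (real (card (W n)))"
    unfolding Hc_def by (rule entropy_bounds[OF finite_W W_nonempty Dpos Dsum], assumption)+
  moreover have "ln (real (card (W n))) = real n * ln (real K)" using K2 by (simp add: card_W ln_realpow)
  ultimately show ?thesis by simp
qed

lemma \<Theta>_Hc_expectation: "P.expectation (\<lambda>s. \<Theta> s * Hc n s) = real n * (hstar * P.expectation \<Theta>)"
proof -
  have "P.expectation (\<lambda>s. \<Theta> s * Hc n s) = P.expectation (\<lambda>s. A n s - gen n \<psi> s + \<psi> s)"
  proof (rule integral_cong_AE)
    show "AE s in P. \<Theta> s * Hc n s = A n s - gen n \<psi> s + \<psi> s"
      using AE_nice by eventually_elim (rule \<Theta>_Hc)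
    show "(\<lambda>s. A n s - gen n \<psi> s + \<psi> s) \<in> borel_measurable P"
      using A_expectation(1) gen_expectation(1)[OF \<psi>_integrable] \<psi>_integrable
      by (intro borel_measurable_add borel_measurable_diff) (simp_all add: borel_measurable_integrable)
  qed simp
  then show ?thesis
    using A_expectation gen_expectation[OF \<psi>_integrable] \<psi>_integrable by simp
qed

section \<open>Return to the given waiting times\<close>

lemma birth_tau: "x \<in> words K \<Longrightarrow> birth \<sigma> x \<omega> = tau x (\<lambda>y\<in>J. \<sigma> y \<omega>)"
proof (induction x arbitrary: \<sigma>)
  case (Cons i y)
  then have iy: "i \<in> I" "y \<in> words K" by (auto simp: words_Cons)
  have "st i (\<lambda>y\<in>J. \<sigma> y \<omega>) = (\<Sum>j=1..i. \<sigma> [j] \<omega>)"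
    unfolding st_def using iy single_J by (intro sum.cong) (auto simp: I_iff)
  moreover have "shift i (\<lambda>y\<in>J. \<sigma> y \<omega>) = (\<lambda>y\<in>J. \<sigma> (i # y) \<omega>)"
    unfolding shift_def using iy by (auto simp: fun_eq_iff Cons_J)
  ultimately show ?case using Cons.IH[OF iy(2), of "\<lambda>x. \<sigma> (i # x)"] by (simp only: birth_Cons tau.simps)
qed simp

text \<open>The subtree at \<open>x\<close> at time \<open>t\<close> is the whole tree of
  \<open>sh x s\<close> at time \<open>t - tau x s\<close>. After normalising both counts, the
  factors \<open>exp (lam * t)\<close> cancel and \<open>exp (- lam * tau x s)\<close>
  remains.\<close>

lemma Delta_eq:
  assumes nice: "nice (\<lambda>y\<in>J. \<sigma> y \<omega>)" and x: "x \<in> words K"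
  shows "Delta K \<sigma> x \<omega> = D x (\<lambda>y\<in>J. \<sigma> y \<omega>)"
proof -
  define s where "s = (\<lambda>y\<in>J. \<sigma> y \<omega>)"
  have sx: "settled (sh x s)" and s0: "settled s" and pos: "0 < \<Theta> s"
    using nice nice_\<Theta>[OF nice] x by (auto simp: nice_def s_def)
  have app: "x @ y \<in> words K \<longleftrightarrow> y \<in> words K" for y using x by (auto simp: words_def)
  have tree: "tree K \<sigma> t \<omega> = T t s" for t
    by (auto simp: tree_def T_def birth_tau s_def)
  have sub: "subtree K \<sigma> x t \<omega> = T (t - tau x s) (sh x s)" for t
    unfolding subtree_def tree by (auto simp: T_def app tau_append)
  have card: "real (card (T t s')) = exp (lam * t) * Xr t s'" if "good s'" for t s'
    unfolding Xr_card(2)[OF that] by (simp add: mult.assoc[symmetric] exp_add[symmetric])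
  have ratio: "real (card (subtree K \<sigma> x t \<omega>)) / real (card (tree K \<sigma> t \<omega>))
      = exp (- lam * tau x s) * Xr (t - tau x s) (sh x s) / Xr t s" for t
  proof -
    have "exp (lam * (t - tau x s)) = exp (lam * t) * exp (- lam * tau x s)"
      by (simp add: exp_add[symmetric] algebra_simps)
    then show ?thesis
      unfolding tree sub using sx s0 by (simp add: card settled_def)
  qed
  have "filterlim (\<lambda>t. - tau x s + t) at_top at_top"
    by (rule filterlim_tendsto_add_at_top[OF tendsto_const filterlim_ident])
  then have "filterlim (\<lambda>t. t - tau x s) at_top at_top" by simp
  then have "((\<lambda>t. exp (- lam * tau x s) * Xr (t - tau x s) (sh x s) / Xr t s) \<longlongrightarrow> exp (- lam * tau x s) * \<Theta> (sh x s) / \<Theta> s) at_top"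
    using pos by (intro tendsto_divide tendsto_mult_left settled_seq sx s0 filterlim_ident) simp_all
  then show ?thesis
    unfolding Delta_def ratio D_def s_def[symmetric] by (intro tendsto_Lim) simp_all
qed

lemma H_eq: "nice (\<lambda>y\<in>J. \<sigma> y \<omega>) \<Longrightarrow> H K \<sigma> n \<omega> = Hc n (\<lambda>y\<in>J. \<sigma> y \<omega>)"
  unfolding H_def Hc_def W_def by (simp add: Delta_eq)

end

theorem theorem2p5:
  fixes K :: nat and w :: "nat \<Rightarrow> real" and M :: "'a measure"
    and \<sigma> :: "nat list \<Rightarrow> 'a \<Rightarrow> real" and h :: real
  assumes "K \<ge> 2"
    and "\<And>j. j < K \<Longrightarrow> w j > 0"
    and "prob_space M"
    and "prob_space.indep_vars M (\<lambda>_. borel) \<sigma> (words K - {[]})"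
    and "\<And>y i. y \<in> words K \<Longrightarrow> i \<in> {1..K} \<Longrightarrow>
           distributed M lborel (\<sigma> (y @ [i])) (exponential_density (w (i - 1)))"
    and "AE \<omega> in M. (\<lambda>n. H K \<sigma> n \<omega> / real n) \<longlonglongrightarrow> h"
  shows "h = (\<integral>\<omega>. (\<Sum>i=1..K. malthus K w * birth \<sigma> [i] \<omega> *
                      exp (- malthus K w * birth \<sigma> [i] \<omega>)) \<partial>M)"
proof -
  interpret weighted_tree K w by unfold_locales (use assms in auto)
  interpret M: prob_space M by fact
  \<comment> \<open>By independence and the marginal laws, this restriction has law
    \<open>P\<close>, so almost sure statements and expectations transfer from the canonical
    space.\<close>
  define S where "S \<omega> = (\<lambda>y\<in>J. \<sigma> y \<omega>)" for \<omega>
  have ind: "M.indep_vars (\<lambda>_. borel) \<sigma> J" using assms(4) by (simp add: J_def)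
  have rv: "\<sigma> x \<in> borel_measurable M" if "x \<in> J" for x
    using ind that by (simp add: M.indep_vars_def2)
  have law: "distr M borel (\<sigma> x) = E x" if x: "x \<in> J" for x
  proof -
    define y i where "y = butlast x" and "i = last x"
    have ne: "x \<noteq> []" using x by (simp add: J_def)
    then have xyi: "x = y @ [i]" by (simp add: y_def i_def)
    have "set x \<subseteq> {1..K}" using x by (auto simp: J_def words_def)
    then have "y \<in> words K" "i \<in> {1..K}" unfolding xyi by (auto simp: words_def)
    then have "distributed M lborel (\<sigma> x) (exponential_density (w (i - 1)))"
      unfolding xyi by (rule assms(5))
    then have "distr M lborel (\<sigma> x) = density lborel (exponential_density (w (i - 1)))"
      by (simp add: distributed_def)
    moreover have "distr M borel (\<sigma> x) = distr M lborel (\<sigma> x)" by (rule distr_cong) simp_all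
    ultimately show ?thesis using x by (simp add: E_def rate_def i_def)
  qed
  have S_meas [measurable]: "S \<in> measurable M P"
    unfolding measurable_cong_sets[OF refl sets_P] S_def[abs_def] by (intro measurable_restrict rv)
  have "J \<noteq> {}" using single_J I_ne by blast
  from M.indep_vars_iff_distr_eq_PiM'[OF this rv, THEN iffD1, OF _ ind]
  have "distr M (PiM J (\<lambda>_. borel)) S = PiM J (\<lambda>x. distr M borel (\<sigma> x))"
    unfolding S_def[abs_def] .
  moreover have "PiM J (\<lambda>x. distr M borel (\<sigma> x)) = P" unfolding P_def by (intro PiM_cong refl law)
  moreover have "distr M (PiM J (\<lambda>_. borel)) S = distr M P S" by (rule distr_cong) (simp_all add: sets_P)
  ultimately have distr_S: "distr M P S = P" by simp
  have expectation_S: "M.expectation (\<lambda>\<omega>. g (S \<omega>)) = P.expectation g" if "g \<in> borel_measurable P" for g :: "_ \<Rightarrow> real"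
    using integral_distr[OF S_meas that] unfolding distr_S by simp
  have nice: "AE \<omega> in M. nice (S \<omega>)"
    by (rule AE_distrD[OF S_meas]) (subst distr_S, rule AE_nice)
  have \<Theta>S: "integrable M (\<lambda>\<omega>. \<Theta> (S \<omega>))"
    by (rule integrable_distr[OF S_meas]) (simp add: distr_S \<Theta>_integrable)
  have "(\<lambda>n. M.expectation (\<lambda>\<omega>. \<Theta> (S \<omega>) * (Hc n (S \<omega>) / real n))) \<longlonglongrightarrow> M.expectation (\<lambda>\<omega>. \<Theta> (S \<omega>) * h)"
  proof (rule integral_dominated_convergence[where w = "\<lambda>\<omega>. \<bar>\<Theta> (S \<omega>)\<bar> * ln (real K)"])
    show "AE \<omega> in M. (\<lambda>n. \<Theta> (S \<omega>) * (Hc n (S \<omega>) / real n)) \<longlonglongrightarrow> \<Theta> (S \<omega>) * h"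
      using nice assms(6)
    proof eventually_elim
      case (elim \<omega>)
      have "H K \<sigma> n \<omega> = Hc n (S \<omega>)" for n
        using H_eq elim(1) unfolding S_def .
      then have "(\<lambda>n. Hc n (S \<omega>) / real n) \<longlonglongrightarrow> h" using elim(2) by (simp only:)
      then show ?case by (rule tendsto_mult_left)
    qed
    show "AE \<omega> in M. norm (\<Theta> (S \<omega>) * (Hc n (S \<omega>) / real n)) \<le> \<bar>\<Theta> (S \<omega>)\<bar> * ln (real K)" for n
      using nice
    proof eventually_elim
      case (elim \<omega>)
      \<comment> \<open>For \<open>n = 0\<close> the quotient is \<open>0\<close>, the value of
        division by zero.\<close>
      have "\<bar>Hc n (S \<omega>) / real n\<bar> \<le> ln (real K)"
        using Hc_bound[OF elim, of n] K2 by (cases "n = 0") (simp_all add: pos_divide_le_eq mult.commute)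
      then show ?case unfolding real_norm_def abs_mult by (rule mult_left_mono) simp
    qed
    show "integrable M (\<lambda>\<omega>. \<bar>\<Theta> (S \<omega>)\<bar> * ln (real K))"
      by (rule integrable_mult_left) (rule integrable_abs[OF \<Theta>S])
  qed measurable
  moreover have "\<forall>\<^sub>F n in sequentially. M.expectation (\<lambda>\<omega>. \<Theta> (S \<omega>) * (Hc n (S \<omega>) / real n)) = hstar * P.expectation \<Theta>"
    using eventually_gt_at_top[of 0]
  proof eventually_elim
    case (elim n)
    have "M.expectation (\<lambda>\<omega>. \<Theta> (S \<omega>) * (Hc n (S \<omega>) / real n)) = P.expectation (\<lambda>s. \<Theta> s * (Hc n s / real n))"
      by (rule expectation_S) measurable
    also have "\<dots> = P.expectation (\<lambda>s. \<Theta> s * Hc n s) / real n" by simp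
    finally show ?case using elim by (simp add: \<Theta>_Hc_expectation)
  qed
  then have "(\<lambda>n. M.expectation (\<lambda>\<omega>. \<Theta> (S \<omega>) * (Hc n (S \<omega>) / real n))) \<longlonglongrightarrow> hstar * P.expectation \<Theta>"
    by (rule tendsto_eventually)
  ultimately have "M.expectation (\<lambda>\<omega>. \<Theta> (S \<omega>) * h) = hstar * P.expectation \<Theta>" by (rule LIMSEQ_unique)
  moreover have "M.expectation (\<lambda>\<omega>. \<Theta> (S \<omega>) * h) = P.expectation \<Theta> * h"
    by (simp only: integral_mult_left_zero expectation_S[OF \<Theta>_meas])
  ultimately have "h * P.expectation \<Theta> = hstar * P.expectation \<Theta>" by (simp only: mult.commute)
  then have h_hstar: "h = hstar"
    by (subst (asm) mult_right_cancel) (rule less_imp_neq[OF \<Theta>_mean_pos, symmetric])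
  have meas: "(\<lambda>s. \<Sum>i\<in>I. lam * st i s * exp (- lam * st i s)) \<in> borel_measurable P"
    using lam_st_exp_integrable by (intro borel_measurable_sum borel_measurable_integrable)
  have h: "h = M.expectation (\<lambda>\<omega>. \<Sum>i\<in>I. lam * st i (S \<omega>) * exp (- lam * st i (S \<omega>)))"
    unfolding h_hstar hstar_eq expectation_S[OF meas] ..
  have birth1: "birth \<sigma> [i] \<omega> = st i (S \<omega>)" if "i \<in> I" for i \<omega>
    unfolding S_def using birth_tau[of "[i]" \<sigma> \<omega>] that by (simp only: words_Cons words_Nil tau.simps add_0_right)
  have "(\<Sum>i=1..K. malthus K w * birth \<sigma> [i] \<omega> * exp (- malthus K w * birth \<sigma> [i] \<omega>))
      = (\<Sum>i\<in>I. lam * st i (S \<omega>) * exp (- lam * st i (S \<omega>)))" for \<omega>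
    unfolding lam_def[symmetric] I_def[symmetric] by (rule sum.cong[OF refl]) (simp only: birth1)
  then show ?thesis unfolding h by (simp only:)
qed

end
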